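(* Let $A$ be a standard-graded Artinian Gorenstein algebra over a field $\pmb k$, $S=\operatorname{Sym}_{\bullet}^{\pmb k}A_1$, $I$ the kernel of the natural map $S\to A$, $d=\dim_{\pmb k}A_1\ge3$, and $n$ the least degree with $I_n\ne0$. Assume that the minimal homogeneous resolution of $A$ by free $S$-modules is Gorenstein-linear. Let $x_1$ be a non-zero element of $A_1$, $x_1,x_2,\dots,x_d$ a basis of $A_1$, and $\overline S=S/(x_1)=\pmb k[x_2,\dots,x_d]$. Assume that multiplication $x_1:A_{n-1}\to A_n$ is surjective. Let $\mathbb F$ be a minimal homogeneous resolution of $A$ by free $S$-modules and let $\mathbb S$ be the skeleton complex of free $\overline S$-modules defined in the context. Then $\overline S\otimes_S\mathbb F\simeq\mathbb S$ (isomorphism of complexes).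
   Context: Gorenstein-linear: a homogeneous complex of free modules over a graded ring $R$ of the form $0\to R(-2n-t+2)^{s_t}\to R(-n-t+2)^{s_{t-1}}\to\dots\to R(-n-1)^{s_2}\to R(-n)^{s_1}\to R^{s_0}$ for some integers $n,t,s_i$. The skeleton $\mathbb S$. Let $U_0$ be the free $\mathbb Z$-module with basis $x_2,\dots,x_d$, $U_0^*$ its $\mathbb Z$-dual with dual basis $x_2^*,\dots,x_d^*$; unadorned $\otimes,\bigwedge,\operatorname{Sym},D$ (divided powers) are over $\mathbb Z$; $\operatorname{Sym}_\bullet U_0$ acts on $D_\bullet(U_0^* )$ by contraction and $U_0^*$ acts on $\bigwedge^\bullet U_0$ by $u^*(u_1\wedge\dots\wedge u_r)=\sum_i(-1)^{i+1}u^*(u_i)u_1\wedge\dots\widehat{u_i}\dots\wedge u_r$. Put $\kappa(\theta\otimes\mu)=\sum_{i=2}^dx_i^*(\theta)\otimes x_i\mu$, $\eta(\theta\otimes\nu)=\sum_{i=2}^dx_i^*(\theta)\otimes x_i(\nu)$, $L_{a,b}U_0=\ker(\kappa:\bigwedge^aU_0\otimes\operatorname{Sym}_bU_0\to\bigwedge^{a-1}U_0\otimes\operatorname{Sym}_{b+1}U_0)$, $K_{a,b}U_0=\ker(\eta:\bigwedge^aU_0\otimes D_b(U_0^* )\to\bigwedge^{a-1}U_0\otimes D_{b-1}(U_0^* ))$. Let $\mathrm{Kos}$ denote the maps $\overline S\otimes K_{a,b}U_0\to\overline S\otimes K_{a-1,b}U_0$ and $\overline S\otimes L_{a,b}U_0\to\overline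 S\otimes L_{a-1,b}U_0$ induced by $\theta\mapsto\sum_{i=2}^dx_i\otimes x_i^*(\theta)$, with $x_i\in\overline S$. Let $c\in\pmb k$ be the determinant of the matrix $((m_im_j)\phi)$, where $\phi\in D_{2n-2}^{\pmb k}(A_1^* )$ is a Macaulay inverse system for $A$ (i.e. $I=\operatorname{ann}(\phi)$) and $m_i,m_j$ run over the monomials of degree $n-1$ in $x_1,\dots,x_d$; $c\neq0$ because the resolution is Gorenstein-linear. Define complexes of free $\overline S$-modules $\mathbb K:\ 0\to\overline S\otimes\bigwedge^{d-1}U_0\to\overline S\otimes K_{d-2,n-1}U_0\xrightarrow{c\,\mathrm{Kos}}\overline S\otimes K_{d-3,n-1}U_0\to\dots\xrightarrow{c\,\mathrm{Kos}}\overline S\otimes K_{0,n-1}U_0$, where the first map sends $\omega$ to $c\sum_mm\otimes\eta(\omega\otimes m^* )$, the sum over monomials $m=x_2^{a_2}\cdots x_d^{a_d}$ of degree $n$ in $x_2,\dots,x_d$, with $m^*={x_2^*}^{(a_2)}\cdots{x_d^*}^{(a_d)}$; and $\mathbb L:\ 0\to\overline S\otimes L_{d-2,n}U_0\xrightarrow{c\,\mathrm{Kos}}\overline S\otimes L_{d-3,n}U_0\to\dots\xrightarrow{c\,\mathrm{Kos}}\overline S\otimes L_{0,n}U_0\to\overline S$, where the last map sends $\mu\in\operatorname{Sym}_nU_0=L_{0,n}U_0$ to $c\mu\in\overline S$. $\mathbb S$ is the mapping cone of the zero map $\mathbb K\to\mathbb L$, i.e. $\mathbb S_0=\overline S$,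 $\mathbb S_r=\overline S\otimes(K_{r-1,n-1}U_0\oplus L_{r-1,n}U_0)$ for $1\le r\le d-1$, $\mathbb S_d=\overline S\otimes\bigwedge^{d-1}U_0$, with differential the direct sum of the maps above (the summand $K_{0,n-1}$ of $\mathbb S_1$ maps to zero). *)

theory Defs
  imports
    Complex_Main
    "HOL-Library.Poly_Mapping"
    "HOL-Library.Product_Plus"
    "HOL-Library.Cardinality"
    "HOL-Combinatorics.Permutations"
begin

section \<open>Free modules with a chosen basis, polynomials\<close>

text \<open>\<open>'i \<Rightarrow>\<^sub>0 'r\<close> is the free \<open>'r\<close>-module on \<open>'i\<close>. With \<open>'i\<close> the type of monomials it is also,
  with the convolution product of the library, the polynomial ring.\<close>

abbreviation lookup :: "('i \<Rightarrow>\<^sub>0 'r::zero) \<Rightarrow> 'i \<Rightarrow> 'r" where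
  "lookup \<equiv> Poly_Mapping.lookup"

abbreviation keys :: "('i \<Rightarrow>\<^sub>0 'r::zero) \<Rightarrow> 'i set" where
  "keys \<equiv> Poly_Mapping.keys"

definition smul :: "'r::comm_ring_1 \<Rightarrow> ('i \<Rightarrow>\<^sub>0 'r) \<Rightarrow> ('i \<Rightarrow>\<^sub>0 'r)" where
  "smul a f = Poly_Mapping.map (\<lambda>b. a * b) f"

definition lin_ext :: "('i \<Rightarrow> ('j \<Rightarrow>\<^sub>0 'r)) \<Rightarrow> ('i \<Rightarrow>\<^sub>0 'r) \<Rightarrow> ('j \<Rightarrow>\<^sub>0 'r::comm_ring_1)" where
  "lin_ext g f = (\<Sum>i\<in>keys f. smul (lookup f i) (g i))"

lemma lookup_smul [simp]: "lookup (smul a f) i = a * lookup f i"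
  by (simp add: smul_def Poly_Mapping.map.rep_eq when_def)

lemma module_smul: "module (smul :: 'r::comm_ring_1 \<Rightarrow> ('i \<Rightarrow>\<^sub>0 'r) \<Rightarrow> _)"
  by unfold_locales (auto intro!: poly_mapping_eqI simp: lookup_add algebra_simps)

type_synonym 'v mon = "'v \<Rightarrow>\<^sub>0 nat"
type_synonym ('v, 'k) mpol = "'v mon \<Rightarrow>\<^sub>0 'k"

definition mdeg :: "('v::finite) mon \<Rightarrow> nat" where
  "mdeg \<alpha> = (\<Sum>i\<in>UNIV. lookup \<alpha> i)"

text \<open>The library order on \<open>'v \<Rightarrow>\<^sub>0 nat\<close> is lexicographic, not divisibility.\<close>

definition mdvd :: "'v mon \<Rightarrow> 'v mon \<Rightarrow> bool" where
  "mdvd \<alpha> \<beta> \<longleftrightarrow> (\<forall>i. lookup \<alpha> i \<le> lookup \<beta> i)"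

definition monomials :: "nat \<Rightarrow> ('v::finite) mon set" where
  "monomials k = {\<alpha>. mdeg \<alpha> = k}"

definition monom :: "'v mon \<Rightarrow> ('v, 'k::comm_ring_1) mpol" where
  "monom \<alpha> = Poly_Mapping.single \<alpha> 1"

definition var :: "'v \<Rightarrow> ('v, 'k::comm_ring_1) mpol" where
  "var i = monom (Poly_Mapping.single i 1)"

definition const :: "'k \<Rightarrow> ('v, 'k::comm_ring_1) mpol" where
  "const a = Poly_Mapping.single 0 a"

definition homog :: "int \<Rightarrow> ('v::finite, 'k::comm_ring_1) mpol \<Rightarrow> bool" where
  "homog k p \<longleftrightarrow> (\<forall>\<alpha>\<in>keys p. int (mdeg \<alpha>) = k)"


section \<open>Standard-graded Artinian Gorenstein algebras\<close>

locale standard_graded_algebra = vector_space scale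
  for scale :: "'k::field \<Rightarrow> 'a::comm_ring_1 \<Rightarrow> 'a" +
  fixes gr :: "nat \<Rightarrow> 'a set"
  assumes scale_mult: "scale c (a * b) = scale c a * b"
    and gr_subspace: "subspace (gr i)"
    and gr_mult: "a \<in> gr i \<Longrightarrow> b \<in> gr j \<Longrightarrow> a * b \<in> gr (i + j)"
    and gr_direct_sum:
      "\<exists>!f :: nat \<Rightarrow>\<^sub>0 'a. (\<forall>i. lookup f i \<in> gr i) \<and> a = (\<Sum>i\<in>keys f. lookup f i)"
    and gr_0: "gr 0 = span {1}"
    and gr_1_fin: "\<exists>B. finite B \<and> gr 1 = span B"
    and gr_1_generates:
      "subspace B \<Longrightarrow> 1 \<in> B \<Longrightarrow> (\<And>a b. a \<in> B \<Longrightarrow> b \<in> B \<Longrightarrow> a * b \<in> B) \<Longrightarrow> gr 1 \<subseteq> B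
        \<Longrightarrow> B = UNIV"
begin

definition socle :: "'a set" where
  "socle = {a. \<forall>i>0. \<forall>b\<in>gr i. b * a = 0}"

end

definition artinian_ring :: "'a::comm_ring_1 itself \<Rightarrow> bool" where
  "artinian_ring _ \<longleftrightarrow>
    \<not> (\<exists>J :: nat \<Rightarrow> 'a set. \<forall>i. module.subspace (*) (J i) \<and> J (Suc i) \<subset> J i)"

text \<open>An Artinian local ring is Gorenstein iff its socle is a one-dimensional vector space over the
  residue field.\<close>

locale artinian_gorenstein_algebra = standard_graded_algebra scale gr
  for scale :: "'k::field \<Rightarrow> 'a::comm_ring_1 \<Rightarrow> 'a" and gr :: "nat \<Rightarrow> 'a set" +
  assumes artinian: "artinian_ring TYPE('a)"
    and gorenstein: "dim socle = 1"

text \<open>A basis \<open>x\<close> of \<open>A\<^sub>1\<close> identifies \<open>S = Sym A\<^sub>1\<close> with the polynomial ring; \<open>presentation\<close> is then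
  the natural map \<open>S \<rightarrow> A\<close>.\<close>

definition presentation ::
  "('k::comm_ring_1 \<Rightarrow> 'a::comm_ring_1 \<Rightarrow> 'a) \<Rightarrow> ('w::finite \<Rightarrow> 'a) \<Rightarrow> ('w, 'k) mpol \<Rightarrow> 'a" where
  "presentation scale x p = (\<Sum>\<alpha>\<in>keys p. scale (lookup p \<alpha>) (\<Prod>i\<in>UNIV. x i ^ lookup \<alpha> i))"


section \<open>Complexes of graded free modules\<close>

text \<open>The graded free module \<open>\<Oplus>\<^sub>j R(-a\<^sub>j)\<close> is given by the list of the \<open>a\<^sub>j\<close>; \<open>dcol r j\<close> is the image of
  the \<open>j\<close>-th basis vector of the \<open>r\<close>-th module under the differential to the \<open>(r-1)\<close>-st one.\<close>

record (overloaded) 'r free_complex =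
  twists :: "nat \<Rightarrow> int list"
  dcol :: "nat \<Rightarrow> nat \<Rightarrow> (nat \<Rightarrow>\<^sub>0 'r::zero)"

definition rank :: "'r::zero free_complex \<Rightarrow> nat \<Rightarrow> nat" where
  "rank F r = length (twists F r)"

definition free_mod :: "nat \<Rightarrow> (nat \<Rightarrow>\<^sub>0 'r::zero) set" where
  "free_mod b = {v. keys v \<subseteq> {..<b}}"

definition fdiff ::
  "'r::comm_ring_1 free_complex \<Rightarrow> nat \<Rightarrow> (nat \<Rightarrow>\<^sub>0 'r) \<Rightarrow> (nat \<Rightarrow>\<^sub>0 'r)" where
  "fdiff F r = lin_ext (dcol F r)"

definition homogeneous_complex :: "('w::finite, 'k::comm_ring_1) mpol free_complex \<Rightarrow> bool" where
  "homogeneous_complex F \<longleftrightarrow>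
    (\<forall>r\<ge>1. \<forall>j<rank F r.
        dcol F r j \<in> free_mod (rank F (r - 1)) \<and>
        (\<forall>i<rank F (r - 1). homog (twists F r ! j - twists F (r - 1) ! i) (lookup (dcol F r j) i))) \<and>
    (\<forall>r\<ge>1. \<forall>v\<in>free_mod (rank F (Suc r)). fdiff F r (fdiff F (Suc r) v) = 0)"

definition minimal_complex :: "('w::finite, 'k::comm_ring_1) mpol free_complex \<Rightarrow> bool" where
  "minimal_complex F \<longleftrightarrow>
    (\<forall>r\<ge>1. \<forall>j<rank F r. \<forall>i. lookup (lookup (dcol F r j) i) 0 = 0)"

definition gorenstein_linear :: "'r::zero free_complex \<Rightarrow> bool" where
  "gorenstein_linear F \<longleftrightarrow> (\<exists>(n::int) (t::nat) (s :: nat \<Rightarrow> nat). t \<ge> 1 \<and>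
    twists F 0 = replicate (s 0) 0 \<and>
    (\<forall>r. 1 \<le> r \<and> r < t \<longrightarrow> twists F r = replicate (s r) (n + int r - 1)) \<and>
    twists F t = replicate (s t) (2 * n + int t - 2) \<and>
    (\<forall>r>t. twists F r = []))"

text \<open>In the next definition \<open>e j\<close> is the image in \<open>A\<close> of the \<open>j\<close>-th basis vector of \<open>F\<^sub>0\<close>.\<close>

definition augmentation ::
  "(('w::finite, 'k::comm_ring_1) mpol \<Rightarrow> 'a::comm_ring_1) \<Rightarrow> (nat \<Rightarrow> 'a)
    \<Rightarrow> (nat \<Rightarrow>\<^sub>0 ('w, 'k) mpol) \<Rightarrow> 'a" where
  "augmentation \<rho> e v = (\<Sum>j\<in>keys v. \<rho> (lookup v j) * e j)"

definition homogeneous_resolution ::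
  "(nat \<Rightarrow> 'a set) \<Rightarrow> (('w::finite, 'k::comm_ring_1) mpol \<Rightarrow> 'a::comm_ring_1)
    \<Rightarrow> ('w, 'k) mpol free_complex \<Rightarrow> bool" where
  "homogeneous_resolution gr \<rho> F \<longleftrightarrow> homogeneous_complex F \<and>
    (\<exists>e.
      (\<forall>j<rank F 0. e j \<in> (if twists F 0 ! j \<ge> 0 then gr (nat (twists F 0 ! j)) else {0})) \<and>
      augmentation \<rho> e ` free_mod (rank F 0) = UNIV \<and>
      {v \<in> free_mod (rank F 0). augmentation \<rho> e v = 0} = fdiff F 1 ` free_mod (rank F 1)) \<and>
    (\<forall>r\<ge>1. {v \<in> free_mod (rank F r). fdiff F r v = 0} = fdiff F (Suc r) ` free_mod (rank F (Suc r)))"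


section \<open>Complexes of modules and their isomorphisms\<close>

text \<open>\<open>Diff X r\<close> maps \<open>Mod X r\<close> to \<open>Mod X (r - 1)\<close>; its value outside \<open>Mod X r\<close> and the map \<open>Diff X 0\<close>
  are irrelevant.\<close>

record 'm module_complex =
  Mod :: "nat \<Rightarrow> 'm set"
  Diff :: "nat \<Rightarrow> 'm \<Rightarrow> 'm"

definition complex_isomorphic ::
  "('r \<Rightarrow> 'm::ab_group_add \<Rightarrow> 'm) \<Rightarrow> ('r \<Rightarrow> 'l::ab_group_add \<Rightarrow> 'l)
    \<Rightarrow> 'm module_complex \<Rightarrow> 'l module_complex \<Rightarrow> bool" where
  "complex_isomorphic sm sl X Y \<longleftrightarrow> (\<exists>f :: nat \<Rightarrow> 'm \<Rightarrow> 'l.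
    (\<forall>r. bij_betw (f r) (Mod X r) (Mod Y r) \<and>
      (\<forall>u\<in>Mod X r. \<forall>v\<in>Mod X r. f r (u + v) = f r u + f r v) \<and>
      (\<forall>a. \<forall>u\<in>Mod X r. f r (sm a u) = sl a (f r u))) \<and>
    (\<forall>r\<ge>1. \<forall>u\<in>Mod X r. f (r - 1) (Diff X r u) = Diff Y r (f r u)))"

text \<open>The variables \<open>x\<^sub>2, \<dots>, x\<^sub>d\<close> are indexed by \<open>'v\<close>, and \<open>x\<^sub>1, \<dots>, x\<^sub>d\<close> by \<open>'v option\<close>, where \<open>None\<close> is
  the index of \<open>x\<^sub>1\<close>. The next map is the quotient map from \<open>S\<close> to \<open>S/(x\<^sub>1) = k[x\<^sub>2, \<dots>, x\<^sub>d]\<close>.\<close>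

definition mod_x1 :: "('v option, 'k::comm_ring_1) mpol \<Rightarrow> ('v, 'k) mpol" where
  "mod_x1 p = (\<Sum>\<alpha>\<in>{\<alpha>\<in>keys p. lookup \<alpha> None = 0}.
     Poly_Mapping.single (Poly_Mapping.map_key Some \<alpha>) (lookup p \<alpha>))"

definition tensor_Sbar ::
  "('v option, 'k::comm_ring_1) mpol free_complex \<Rightarrow> (nat \<Rightarrow>\<^sub>0 ('v, 'k) mpol) module_complex" where
  "tensor_Sbar F = \<lparr>
     Mod = (\<lambda>r. free_mod (rank F r)),
     Diff = (\<lambda>r. lin_ext (\<lambda>j. Poly_Mapping.map mod_x1 (dcol F r j))) \<rparr>"


section \<open>Divided powers and the constant \<open>c\<close>\<close>

text \<open>An element of \<open>D(V\<^sup>*)\<close> is written in the basis of divided power monomials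
  \<open>x\<^sup>*\<^sup>(\<^sup>\<beta>\<^sup>)\<close>, dual to the monomials \<open>x\<^sup>\<beta>\<close>, so that
  \<open>x\<^sup>\<alpha>\<close> sends \<open>x\<^sup>*\<^sup>(\<^sup>\<beta>\<^sup>)\<close> to \<open>x\<^sup>*\<^sup>(\<^sup>\<beta>\<^sup>-\<^sup>\<alpha>\<^sup>)\<close> or to 0.
  It has the same type as a polynomial, but the ring structure of that type is not used for it.\<close>

definition contract :: "('w, 'k::comm_ring_1) mpol \<Rightarrow> ('w mon \<Rightarrow>\<^sub>0 'k) \<Rightarrow> ('w mon \<Rightarrow>\<^sub>0 'k)" where
  "contract p \<phi> = (\<Sum>\<alpha>\<in>keys p. smul (lookup p \<alpha>)
     (lin_ext (\<lambda>\<beta>. if mdvd \<alpha> \<beta> then Poly_Mapping.single (\<beta> - \<alpha>) 1 else 0) \<phi>))"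

definition leibniz_det :: "'i set \<Rightarrow> ('i \<Rightarrow> 'i \<Rightarrow> 'k::comm_ring_1) \<Rightarrow> 'k" where
  "leibniz_det M a = (\<Sum>\<pi> | \<pi> permutes M. of_int (sign \<pi>) * (\<Prod>m\<in>M. a m (\<pi> m)))"

text \<open>For \<open>\<phi>\<close> of degree \<open>2n-2\<close> each \<open>(m m')\<phi>\<close> lies in \<open>D\<^sub>0 = k\<close>; \<open>lookup _ 0\<close> extracts it.\<close>

definition macaulay_const :: "nat \<Rightarrow> (('w::finite) mon \<Rightarrow>\<^sub>0 'k::comm_ring_1) \<Rightarrow> 'k" where
  "macaulay_const n \<phi> =
    leibniz_det (monomials (n - 1)) (\<lambda>m m'. lookup (contract (monom m * monom m') \<phi>) 0)"


section \<open>The skeleton\<close>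

text \<open>\<open>U\<^sub>0\<close> has basis indexed by \<open>'v\<close>. A pair \<open>(J, \<mu>)\<close> is the basis element \<open>x\<^sub>J \<otimes> x\<^sup>\<mu>\<close> of \<open>\<Lambda>U\<^sub>0 \<otimes> Sym U\<^sub>0\<close>,
  or \<open>x\<^sub>J \<otimes> x\<^sup>*\<^sup>(\<^sup>\<mu>\<^sup>)\<close> of \<open>\<Lambda>U\<^sub>0 \<otimes> D(U\<^sub>0\<^sup>*)\<close>, where \<open>x\<^sub>J\<close> is the wedge product of the
  \<open>x\<^sub>j\<close>, \<open>j \<in> J\<close>, in increasing order. Hence \<open>x\<^sub>i\<^sup>*(x\<^sub>J) = wsign i J * x\<^sub>J\<^sub>-\<^sub>{\<^sub>i\<^sub>}\<close>
  for \<open>i \<in> J\<close>, and \<open>x\<^sub>i\<^sup>*(x\<^sub>J) = 0\<close> otherwise.\<close>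

type_synonym 'v bas = "'v set \<times> 'v mon"

definition wsign :: "'v::linorder \<Rightarrow> 'v set \<Rightarrow> 'r::comm_ring_1" where
  "wsign i J = (- 1) ^ card {j \<in> J. j < i}"

definition bideg :: "nat \<Rightarrow> nat \<Rightarrow> (('v::finite) bas \<Rightarrow>\<^sub>0 'r::zero) set" where
  "bideg a b = {f. \<forall>(J, \<mu>)\<in>keys f. card J = a \<and> mdeg \<mu> = b}"

definition kappa ::
  "('v::{finite,linorder} bas \<Rightarrow>\<^sub>0 'r::comm_ring_1) \<Rightarrow> ('v bas \<Rightarrow>\<^sub>0 'r)" where
  "kappa = lin_ext (\<lambda>(J, \<mu>). \<Sum>i\<in>J.
     Poly_Mapping.single (J - {i}, \<mu> + Poly_Mapping.single i 1) (wsign i J))"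

definition eta ::
  "('v::{finite,linorder} bas \<Rightarrow>\<^sub>0 'r::comm_ring_1) \<Rightarrow> ('v bas \<Rightarrow>\<^sub>0 'r)" where
  "eta = lin_ext (\<lambda>(J, \<nu>). \<Sum>i\<in>J.
     if lookup \<nu> i > 0
     then Poly_Mapping.single (J - {i}, \<nu> - Poly_Mapping.single i 1) (wsign i J) else 0)"

definition Lmod :: "nat \<Rightarrow> nat \<Rightarrow> ('v::{finite,linorder} bas \<Rightarrow>\<^sub>0 int) set" where
  "Lmod a b = {f \<in> bideg a b. kappa f = 0}"

definition Kmod :: "nat \<Rightarrow> nat \<Rightarrow> ('v::{finite,linorder} bas \<Rightarrow>\<^sub>0 int) set" where
  "Kmod a b = {f \<in> bideg a b. eta f = 0}"

text \<open>\<open>R \<otimes>\<^sub>\<int> M\<close> for a subgroup \<open>M\<close> of a free abelian group \<open>P = (\<int> on 'i)\<close>, taken inside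
  \<open>R \<otimes>\<^sub>\<int> P = (R on 'i)\<close>. This is legitimate when \<open>P/M\<close> is torsion-free, since then \<open>R \<otimes> M \<rightarrow> R \<otimes> P\<close>
  is injective; it is only used for \<open>M\<close> a homogeneous part of \<open>P\<close> or the kernel of a map from such a
  part to a free abelian group.\<close>

definition base_change :: "('i \<Rightarrow>\<^sub>0 int) set \<Rightarrow> ('i \<Rightarrow>\<^sub>0 'r::comm_ring_1) set" where
  "base_change M = module.span smul (Poly_Mapping.map of_int ` M)"

definition kos ::
  "('v::{finite,linorder} bas \<Rightarrow>\<^sub>0 ('v, 'k::comm_ring_1) mpol) \<Rightarrow> ('v bas \<Rightarrow>\<^sub>0 ('v, 'k) mpol)" where
  "kos = lin_ext (\<lambda>(J, \<mu>). \<Sum>i\<in>J. Poly_Mapping.single (J - {i}, \<mu>) (wsign i J * var i))"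

text \<open>\<open>K_top n c\<close> is the first map of \<open>\<bbbK>\<close>, with \<open>\<Lambda>\<^sup>d\<^sup>-\<^sup>1U\<^sub>0\<close> written as
  \<open>\<Lambda>\<^sup>d\<^sup>-\<^sup>1U\<^sub>0 \<otimes> D\<^sub>0(U\<^sub>0\<^sup>*)\<close>; \<open>L_bot c\<close> is the last map of \<open>\<bbbL>\<close>, with the target
  \<open>k[x\<^sub>2, \<dots>, x\<^sub>d]\<close> written as its tensor product with \<open>\<Lambda>\<^sup>0U\<^sub>0 \<otimes> Sym\<^sub>0U\<^sub>0 = \<int>\<close>.\<close>

definition K_top :: "nat \<Rightarrow> 'k
    \<Rightarrow> ('v::{finite,linorder} bas \<Rightarrow>\<^sub>0 ('v, 'k::comm_ring_1) mpol) \<Rightarrow> ('v bas \<Rightarrow>\<^sub>0 ('v, 'k) mpol)" where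
  "K_top n c = lin_ext (\<lambda>(J, _). smul (const c)
     (\<Sum>m\<in>monomials n. smul (monom m) (eta (Poly_Mapping.single (J, m) 1))))"

definition L_bot :: "'k
    \<Rightarrow> ('v::{finite,linorder} bas \<Rightarrow>\<^sub>0 ('v, 'k::comm_ring_1) mpol) \<Rightarrow> ('v bas \<Rightarrow>\<^sub>0 ('v, 'k) mpol)" where
  "L_bot c = lin_ext (\<lambda>(J, \<mu>). Poly_Mapping.single ({}, 0) (const c * monom \<mu>))"

text \<open>Here \<open>CARD('v) = d - 1\<close>.\<close>

definition KK :: "nat \<Rightarrow> 'k
    \<Rightarrow> ('v::{finite,linorder} bas \<Rightarrow>\<^sub>0 ('v, 'k::comm_ring_1) mpol) module_complex" where
  "KK n c = \<lparr>
     Mod = (\<lambda>r. if r < CARD('v) then base_change (Kmod r (n - 1))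
                else if r = CARD('v) then base_change (bideg r 0) else {0}),
     Diff = (\<lambda>r. if r < CARD('v) then (\<lambda>u. smul (const c) (kos u)) else K_top n c) \<rparr>"

definition LL :: "nat \<Rightarrow> 'k
    \<Rightarrow> ('v::{finite,linorder} bas \<Rightarrow>\<^sub>0 ('v, 'k::comm_ring_1) mpol) module_complex" where
  "LL n c = \<lparr>
     Mod = (\<lambda>r. if r = 0 then base_change (bideg 0 0)
                else if r \<le> CARD('v) then base_change (Lmod (r - 1) n) else {0}),
     Diff = (\<lambda>r. if r = 1 then L_bot c else (\<lambda>u. smul (const c) (kos u))) \<rparr>"

definition cone_of_zero ::
  "'m::zero module_complex \<Rightarrow> 'l module_complex \<Rightarrow> ('m \<times> 'l) module_complex" where
  "cone_of_zero K L = \<lparr>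
     Mod = (\<lambda>r. (if r = 0 then {0} else Mod K (r - 1)) \<times> Mod L r),
     Diff = (\<lambda>r (u, v). (if r \<le> 1 then 0 else Diff K (r - 1) u, Diff L r v)) \<rparr>"

definition skeleton :: "nat \<Rightarrow> 'k
    \<Rightarrow> (('v::{finite,linorder} bas \<Rightarrow>\<^sub>0 ('v, 'k::comm_ring_1) mpol)
       \<times> ('v bas \<Rightarrow>\<^sub>0 ('v, 'k) mpol)) module_complex" where
  "skeleton n c = cone_of_zero (KK n c) (LL n c)"

end

theory Submission
  imports Defs "Jordan_Normal_Form.Determinant"
begin

text \<open>Write \<open>x\<^sub>1\<close> for the variable with index \<open>None\<close> and \<open>d - 1\<close> for the number of the others. The
  resolution \<open>F\<close> stays exact in degrees \<open>\<ge> 2\<close> modulo \<open>x\<^sub>1\<close>, and its differentials between the degrees \<open>1, \<dots>, d - 1\<close> are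
  linear. By minimality its \<open>r\<close>-th module, \<open>3 \<le> r \<le> d - 1\<close>, is therefore generated by the linear cycles one
  degree below, and the skeleton has the same property. So it suffices to compare the two complexes in the
  degrees 1 and 2 and at the top. (The length of \<open>F\<close> is \<open>d\<close> because the skeleton has non-zero linear cycles in
  the degrees \<open>1, \<dots>, d - 2\<close>, and has non-zero cycles but no linear ones in degree \<open>d - 1\<close>.)

  In degree 1, write \<open>g \<in> I\<^sub>n\<close> as \<open>g = m + x\<^sub>1 b\<close> with \<open>m\<close> free of \<open>x\<^sub>1\<close>, and send it to the pair of the
  restriction of \<open>b\<phi>\<close> to \<open>k[x\<^sub>2, \<dots>, x\<^sub>d]\<close> and of \<open>c\<^sup>-\<^sup>1m\<close>. Since the pairing \<open>(p, q) \<mapsto> (pq)\<phi>\<close> is perfect on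
  the forms of degree \<open>n - 1\<close>, this is a bijection onto \<open>K\<^bsub>0,n-1\<^esub> \<oplus> L\<^bsub>0,n\<^esub>\<close>. A linear syzygy
  \<open>\<Sum> l\<^sub>i g\<^sub>i + x\<^sub>1 h = 0\<close> with \<open>h \<in> I\<^sub>n\<close> amounts to \<open>\<Sum> l\<^sub>i m\<^sub>i = 0\<close> and \<open>\<Sum> l\<^sub>i b\<^sub>i = - h \<in> I\<^sub>n\<close>. Given the first
  condition, the second one says that \<open>\<Sum> l\<^sub>i (b\<^sub>i \<phi>)\<close> restricts to 0. So the linear syzygies, which generate
  the second module of \<open>F\<close>, form \<open>K\<^bsub>1,n-1\<^esub> \<oplus> L\<^bsub>1,n\<^esub>\<close>. At the top, the cycles of the skeleton
  are the multiples of one element, the image of the generator of \<open>\<Lambda>\<^sup>d\<^sup>-\<^sup>1U\<^sub>0\<close>.\<close>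

text \<open>Exactness modulo x_1 in degree r >= 2 rests on exactness of F in the degrees r and r - 1
  and on x_1 being a nonzerodivisor. Degree 1 is not reached in this way, so the linear syzygies are
  lifted by hand. The restriction suffices to test the second condition on a syzygy: once sum l_i
  m_i = 0, the product x_1 (sum l_i b_i) lies in I, so pairings with monomials divisible by x_1
  vanish anyway. The skeleton is defined over the integers and the field may have any
  characteristic. So its kernels must be shown to commute with base change, by homotopies without
  denominators. A linear Koszul cycle is the image of exactly one vector of constants. Hence each
  comparison map is a matrix over the field, determined by the one below it. Neither the length of F
  nor the integer in its twists is given. The integer is found from the degree of the generators of
  I. The length is found because the twists jump by n >= 2 at the last place, whereas a linear cycle
  forces a jump of at most 1. The constant c enters only as a unit: it is absorbed into the second
  component in degree 1 and into every later lift.\<close>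

abbreviation single :: "'i \<Rightarrow> 'r::zero \<Rightarrow> ('i \<Rightarrow>\<^sub>0 'r)" where
  "single \<equiv> Poly_Mapping.single"

abbreviation pm_map :: "('r::zero \<Rightarrow> 's::zero) \<Rightarrow> ('i \<Rightarrow>\<^sub>0 'r) \<Rightarrow> ('i \<Rightarrow>\<^sub>0 's)" where
  "pm_map \<equiv> Poly_Mapping.map"

type_synonym ('v, 'k) bpol = "'v bas \<Rightarrow>\<^sub>0 ('v, 'k) mpol"

hide_const (open) Polynomial.monom

section \<open>Linear extension from a basis, and coefficientwise maps\<close>

lemma smul_zero [simp]: "smul 0 f = 0" "smul a 0 = 0"
  by (auto intro!: poly_mapping_eqI)

lemma smul_one [simp]: "smul 1 f = f"
  by (auto intro!: poly_mapping_eqI)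

lemma smul_add: "smul a (f + g) = smul a f + smul a g"
  and smul_add_left: "smul (a + b) f = smul a f + smul b f"
  and smul_smul: "smul a (smul b f) = smul (a * b) f"
  by (auto intro!: poly_mapping_eqI simp: lookup_add algebra_simps)

lemma smul_single [simp]: "smul a (single i b) = single i (a * b)"
  by (auto intro!: poly_mapping_eqI simp: lookup_single when_def)

lemma smul_sum: "smul a (sum g S) = (\<Sum>i\<in>S. smul a (g i))"
  by (induction S rule: infinite_finite_induct) (auto simp: smul_add)

lemma lin_ext_superset:
  "finite S \<Longrightarrow> keys f \<subseteq> S \<Longrightarrow> lin_ext g f = (\<Sum>i\<in>S. smul (lookup f i) (g i))"
  unfolding lin_ext_def by (rule sum.mono_neutral_left) (auto simp: in_keys_iff)

lemma lookup_lin_ext: "lookup (lin_ext g f) j = (\<Sum>i\<in>keys f. lookup f i * lookup (g i) j)"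
  by (simp add: lin_ext_def lookup_sum)

lemma lookup_lin_ext_superset:
  "finite S \<Longrightarrow> keys f \<subseteq> S \<Longrightarrow> lookup (lin_ext g f) j = (\<Sum>i\<in>S. lookup f i * lookup (g i) j)"
  by (simp add: lin_ext_superset lookup_sum)

lemma lin_ext_0 [simp]: "lin_ext g 0 = 0"
  by (simp add: lin_ext_def)

lemma lin_ext_add: "lin_ext g (a + b) = lin_ext g a + lin_ext g b"
proof -
  let ?S = "keys a \<union> keys b"
  have "keys (a + b) \<subseteq> ?S" by (rule Poly_Mapping.keys_add)
  then show ?thesis
    by (simp add: lin_ext_superset[of ?S] lookup_add smul_add_left sum.distrib)
qed

lemma keys_smul: "keys (smul a f) \<subseteq> keys f"
  by (auto simp: in_keys_iff)

lemma lin_ext_smul: "lin_ext g (smul a f) = smul a (lin_ext g f)"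
  unfolding lin_ext_superset[OF finite_keys keys_smul] by (simp add: smul_sum smul_smul lin_ext_def)

lemma lin_ext_single [simp]: "lin_ext g (single i a) = smul a (g i)"
  by (cases "a = 0") (auto simp: lin_ext_def)

lemma lin_ext_sum: "lin_ext g (sum h S) = (\<Sum>i\<in>S. lin_ext g (h i))"
  by (induction S rule: infinite_finite_induct) (auto simp: lin_ext_add)

lemma lin_ext_minus: "lin_ext g (a - b) = lin_ext g a - lin_ext g b"
  using lin_ext_add[of g "a - b" b] by (simp add: algebra_simps)

lemma lin_ext_lin_ext: "lin_ext g (lin_ext h f) = lin_ext (\<lambda>i. lin_ext g (h i)) f"
  by (simp add: lin_ext_def[of h] lin_ext_sum lin_ext_smul lin_ext_def[of "\<lambda>i. lin_ext g (h i)"])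

lemma lin_ext_id: "lin_ext (\<lambda>i. single i 1) f = f"
  by (rule poly_mapping_eqI)
    (auto simp: lookup_lin_ext lookup_single when_def in_keys_iff sum.delta' if_distrib cong: if_cong)

lemma lin_ext_cong: "(\<And>i. i \<in> keys f \<Longrightarrow> g i = h i) \<Longrightarrow> lin_ext g f = lin_ext h f"
  by (simp add: lin_ext_def)

lemma lin_ext_plus: "lin_ext (\<lambda>i. g i + h i) f = lin_ext g f + lin_ext h f"
  by (simp add: lin_ext_def smul_add sum.distrib)

lemma lin_ext_smul_fun: "lin_ext (\<lambda>i. smul a (g i)) f = smul a (lin_ext g f)"
  by (simp add: lin_ext_def smul_sum smul_smul mult.commute)

lemma pm_decompose: "f = (\<Sum>i\<in>keys f. single i (lookup f i))"
  by (rule poly_mapping_eqI)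
    (auto simp: lookup_sum lookup_single when_def in_keys_iff sum.delta' cong: if_cong)

lemma lookup_pmap: "h 0 = 0 \<Longrightarrow> lookup (pm_map h f) i = h (lookup f i)"
  by (simp add: Poly_Mapping.map.rep_eq when_def)

text \<open>Changes of coefficients commute with linear extension and hence with all operators built
  from it. The instances are \<open>of_int\<close>, \<open>const\<close>, the constant term,
  \<open>mod_x1\<close> and \<open>incl\<close>.\<close>

locale rhom =
  fixes h :: "'r::comm_ring_1 \<Rightarrow> 's::comm_ring_1"
  assumes add: "h (a + b) = h a + h b" and mult: "h (a * b) = h a * h b" and one: "h 1 = 1"
begin

lemma zero [simp]: "h 0 = 0"
  using add[of 0 0] by simp

lemma uminus: "h (- a) = - h a"
  using add[of a "- a"] by (simp add: eq_neg_iff_add_eq_0 add.commute)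

lemma diff: "h (a - b) = h a - h b"
  using add[of a "- b"] by (simp add: uminus)

lemma sum: "h (sum g S) = (\<Sum>i\<in>S. h (g i))"
  by (induction S rule: infinite_finite_induct) (auto simp: add)

lemma power: "h (a ^ n) = h a ^ n"
  by (induction n) (auto simp: mult one)

lemma lookup [simp]: "lookup (pm_map h f) i = h (lookup f i)"
  by (simp add: lookup_pmap)

lemma keys: "keys (pm_map h f) \<subseteq> keys f"
  by (auto simp: in_keys_iff)

lemma map_lin_ext:
  "pm_map h (lin_ext g f) = lin_ext (\<lambda>i. pm_map h (g i)) (pm_map h f)"
proof (rule poly_mapping_eqI)
  fix j
  show "lookup (pm_map h (lin_ext g f)) j
      = lookup (lin_ext (\<lambda>i. pm_map h (g i)) (pm_map h f)) j"
    unfolding lookup_lin_ext_superset[OF finite_keys keys] by (simp add: lookup_lin_ext sum mult)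
qed

end

lemma rhom_of_int: "rhom (of_int :: int \<Rightarrow> 'r::comm_ring_1)"
  by unfold_locales auto

subsection \<open>Monomials\<close>

lemma lookup_single_mult_add:
  fixes p :: "('v, 'k::comm_ring_1) mpol"
  shows "lookup (single \<alpha> c * p) (\<alpha> + \<beta>) = c * lookup p \<beta>"
proof -
  have "lookup (single \<alpha> c * p) (\<alpha> + \<beta>)
      = lookup (single \<alpha> c * (\<Sum>i\<in>keys p. single i (lookup p i))) (\<alpha> + \<beta>)"
    by (simp only: pm_decompose[symmetric])
  also have "\<dots> = (\<Sum>i\<in>keys p. if i = \<beta> then c * lookup p i else 0)"
    by (simp add: sum_distrib_left mult_single lookup_sum lookup_single when_def)
  also have "\<dots> = c * lookup p \<beta>" by (auto simp: sum.delta in_keys_iff)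
  finally show ?thesis .
qed

lemma lookup_single_mult_0:
  fixes p :: "('v, 'k::comm_ring_1) mpol"
  assumes "\<not> mdvd \<alpha> \<beta>"
  shows "lookup (single \<alpha> c * p) \<beta> = 0"
proof -
  have *: "\<beta> \<noteq> \<alpha> + i" for i using assms by (auto simp: mdvd_def lookup_add)
  have "lookup (single \<alpha> c * p) \<beta>
      = lookup (single \<alpha> c * (\<Sum>i\<in>keys p. single i (lookup p i))) \<beta>"
    by (simp only: pm_decompose[symmetric])
  also have "\<dots> = 0"
    using *[symmetric] by (simp add: sum_distrib_left mult_single lookup_sum lookup_single when_def)
  finally show ?thesis .
qed

lemma mdvd_add_diff: "mdvd \<alpha> \<beta> \<Longrightarrow> \<alpha> + (\<beta> - \<alpha>) = \<beta>"
  by (auto intro!: poly_mapping_eqI simp: mdvd_def lookup_add lookup_minus)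

lemma lookup_monom_mult:
  "lookup (monom \<alpha> * p) \<beta> = (if mdvd \<alpha> \<beta> then lookup p (\<beta> - \<alpha>) else 0)"
  using lookup_single_mult_add[of \<alpha> 1 p "\<beta> - \<alpha>"]
  by (auto simp: Defs.monom_def lookup_single_mult_0 mdvd_add_diff)

lemma mdvd_single: "mdvd (single i 1) \<beta> \<longleftrightarrow> lookup \<beta> i > 0"
  by (auto simp: mdvd_def lookup_single when_def Suc_le_eq)

lemma lookup_var_mult:
  "lookup (var i * p) \<beta> = (if lookup \<beta> i > 0 then lookup p (\<beta> - single i 1) else 0)"
  using lookup_monom_mult[of "single i 1" p \<beta>] mdvd_single[of i \<beta>] by (simp add: var_def)

lemma lookup_const_mult [simp]: "lookup (const a * p) \<beta> = a * lookup p \<beta>"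
  using lookup_single_mult_add[of 0 a p \<beta>] by (simp add: const_def)

lemma monom_0 [simp]: "monom 0 = 1"
  by (simp add: Defs.monom_def)

lemma monom_add: "monom (\<alpha> + \<beta>) = monom \<alpha> * monom \<beta>"
  by (simp add: Defs.monom_def mult_single)

lemma const_monom: "const a * monom \<alpha> = single \<alpha> a"
  by (simp add: Defs.monom_def const_def mult_single)

lemma mpol_expand: "p = (\<Sum>\<alpha>\<in>keys p. const (lookup p \<alpha>) * monom \<alpha>)"
  unfolding const_monom by (rule pm_decompose)

lemma rhom_const: "rhom (const :: 'k::comm_ring_1 \<Rightarrow> ('v, 'k) mpol)"
  by unfold_locales (auto simp: const_def mult_single single_add)

text \<open>Both sides are biadditive, so single terms suffice. This makes the constant term, the
  reduction modulo x_1 and the inclusion multiplicative.\<close>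

lemma mult_on_singles:
  fixes h :: "('a::comm_monoid_add \<Rightarrow>\<^sub>0 'r::comm_ring_1) \<Rightarrow> 's::comm_ring_1"
  assumes add: "\<And>p q. h (p + q) = h p + h q"
    and single: "\<And>\<alpha> \<beta> c d. h (single (\<alpha> + \<beta>) (c * d)) =
      h (single \<alpha> c) * h (single \<beta> d)"
  shows "h (p * q) = h p * h q"
proof -
  have h0: "h 0 = 0" using add[of 0 0] by simp
  have hs: "h (sum g S) = (\<Sum>i\<in>S. h (g i))" for g :: "'b \<Rightarrow> _" and S
    by (induction S rule: infinite_finite_induct) (auto simp: add h0)
  have hs2: "h (sum g S) = (\<Sum>i\<in>S. h (g i))" for g :: "'a \<Rightarrow> _" and S
    by (induction S rule: infinite_finite_induct) (auto simp: add h0)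
  define p' q' where "p' = (\<lambda>i. single i (lookup p i))"
    and "q' = (\<lambda>i. single i (lookup q i))"
  have expand: "p = sum p' (keys p)" "q = sum q' (keys q)"
    unfolding p'_def q'_def by (rule pm_decompose)+
  have "h (sum p' (keys p) * sum q' (keys q)) = h (sum p' (keys p)) * h (sum q' (keys q))"
    unfolding sum_product hs2 by (simp add: p'_def q'_def mult_single single)
  then show ?thesis
    by (simp only: expand[symmetric])
qed

lemma lookup_0_add: "(\<alpha> :: 'v mon) + \<beta> = 0 \<longleftrightarrow> \<alpha> = 0 \<and> \<beta> = 0"
  by (auto simp: poly_mapping_eq_iff fun_eq_iff lookup_add)

lemma rhom_lookup_0: "rhom (\<lambda>p :: ('v, 'k::comm_ring_1) mpol. lookup p 0)"
proof
  fix p q :: "('v, 'k) mpol"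
  show "lookup (p * q) 0 = lookup p 0 * lookup q 0"
    by (rule mult_on_singles[where h = "\<lambda>p. lookup p 0"])
       (auto simp: lookup_add lookup_single when_def lookup_0_add)
qed (auto simp: lookup_add)

lemma lookup_const [simp]: "lookup (const a) \<alpha> = (if \<alpha> = 0 then a else 0)"
  by (simp add: const_def lookup_single when_def)

lemma mdeg_add [simp]: "mdeg (\<alpha> + \<beta>) = mdeg \<alpha> + mdeg \<beta>"
  by (simp add: mdeg_def lookup_add sum.distrib)

lemma mdeg_single [simp]: "mdeg (single i k) = k"
  by (simp add: mdeg_def lookup_single when_def)

lemma mdeg_0 [simp]: "mdeg 0 = 0"
  by (simp add: mdeg_def)

lemma mdeg_eq_0_iff: "mdeg \<alpha> = 0 \<longleftrightarrow> \<alpha> = 0"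
  by (auto simp: mdeg_def poly_mapping_eq_iff fun_eq_iff)

lemma mon_split: "lookup \<alpha> i > 0 \<Longrightarrow> \<alpha> - single i 1 + single i (1::nat) = \<alpha>"
  by (auto intro!: poly_mapping_eqI simp: lookup_add lookup_minus lookup_single when_def)

lemma mdeg_minus_single: "lookup \<alpha> i > 0 \<Longrightarrow> mdeg (\<alpha> - single i 1) = mdeg \<alpha> - 1"
  using mon_split[of \<alpha> i] by (metis add_diff_cancel_right' mdeg_add mdeg_single)

lemma mdeg_Suc_D: "mdeg \<alpha> = Suc k \<Longrightarrow> \<exists>i. lookup \<alpha> i > 0"
  by (metis (no_types, lifting) mdeg_def nat.simps(3) gr0I sum.neutral)

lemma mdeg_eq_1_D: "mdeg \<alpha> = 1 \<Longrightarrow> \<exists>i. \<alpha> = single i 1"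
proof -
  assume 1: "mdeg \<alpha> = 1"
  then obtain i where i: "lookup \<alpha> i > 0" using mdeg_Suc_D[of \<alpha> 0] by auto
  have "\<alpha> - single i 1 = 0"
    using mdeg_minus_single[OF i] 1 by (simp add: mdeg_eq_0_iff)
  then show ?thesis using mon_split[OF i] by (metis add_0)
qed

lemma finite_monomials: "finite (monomials k :: 'v::finite mon set)"
proof (rule finite_subset)
  show "monomials k \<subseteq> (\<lambda>f. Abs_poly_mapping f) ` (UNIV \<rightarrow>\<^sub>E {..k} :: ('v \<Rightarrow> nat) set)"
  proof
    fix \<alpha> :: "'v mon" assume "\<alpha> \<in> monomials k"
    then have "lookup \<alpha> i \<le> k" for i
      unfolding monomials_def mdeg_def by (auto intro: member_le_sum)
    then show "\<alpha> \<in> (\<lambda>f. Abs_poly_mapping f) ` (UNIV \<rightarrow>\<^sub>E {..k})"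
      by (intro image_eqI[of _ _ "lookup \<alpha>"]) (auto simp: PiE_def extensional_def)
  qed
  show "finite ((\<lambda>f. Abs_poly_mapping f) ` (UNIV \<rightarrow>\<^sub>E {..k} :: ('v \<Rightarrow> nat) set))"
    by (intro finite_imageI finite_PiE) auto
qed

lemma homog_iff: "homog k p \<longleftrightarrow> (\<forall>\<alpha>. int (mdeg \<alpha>) \<noteq> k \<longrightarrow> lookup p \<alpha> = 0)"
  by (auto simp: homog_def in_keys_iff)

subsection \<open>Reduction modulo the first variable\<close>

definition emb :: "'v::finite mon \<Rightarrow> 'v option mon" where
  "emb \<beta> = Abs_poly_mapping (\<lambda>i. case i of None \<Rightarrow> 0 | Some j \<Rightarrow> lookup \<beta> j)"

lemma lookup_emb: "lookup (emb \<beta>) i = (case i of None \<Rightarrow> 0 | Some j \<Rightarrow> lookup \<beta> j)"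
  unfolding emb_def by (subst lookup_Abs_poly_mapping) auto

lemma lookup_emb_simps [simp]: "lookup (emb \<beta>) None = 0" "lookup (emb \<beta>) (Some j) = lookup \<beta> j"
  by (simp_all add: lookup_emb)

lemma emb_add: "emb (\<alpha> + \<beta>) = emb \<alpha> + emb \<beta>"
  by (rule poly_mapping_eqI) (simp add: lookup_emb lookup_add split: option.split)

lemma emb_0 [simp]: "emb 0 = 0"
  by (rule poly_mapping_eqI) (simp add: lookup_emb split: option.split)

lemma mdeg_emb [simp]: "mdeg (emb \<beta>) = mdeg (\<beta> :: 'v::finite mon)"
  by (simp add: mdeg_def UNIV_option_conv sum.reindex)

lemma lookup_map_key_Some [simp]: "lookup (Poly_Mapping.map_key Some \<alpha>) i = lookup \<alpha> (Some i)"
  by (simp add: map_key.rep_eq)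

lemma emb_map_key: "lookup \<alpha> None = 0 \<Longrightarrow> emb (Poly_Mapping.map_key Some \<alpha>) = \<alpha>"
  by (rule poly_mapping_eqI) (auto simp: lookup_emb split: option.split)

lemma map_key_emb [simp]: "Poly_Mapping.map_key Some (emb \<alpha>) = \<alpha>"
  by (rule poly_mapping_eqI) auto

lemma lookup_mod_x1 [simp]: "lookup (mod_x1 p) \<beta> = lookup p (emb \<beta>)"
proof -
  have "lookup (mod_x1 p) \<beta> = (\<Sum>\<alpha>\<in>{\<alpha> \<in> keys p. lookup \<alpha> None = 0}. if \<alpha> = emb \<beta> then lookup p \<alpha> else 0)"
    unfolding mod_x1_def lookup_sum
    by (rule sum.cong) (auto simp: lookup_single when_def emb_map_key)
  also have "\<dots> = lookup p (emb \<beta>)"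
    by (subst sum.delta) (auto simp: in_keys_iff)
  finally show ?thesis .
qed

lemma mod_x1_single:
  "mod_x1 (single (\<alpha> :: 'v::finite option mon) c) =
    (if lookup \<alpha> None = 0 then single (Poly_Mapping.map_key Some \<alpha>) c else 0)"
  by (rule poly_mapping_eqI) (auto simp: lookup_single when_def emb_map_key)

lemma map_key_Some_add: "Poly_Mapping.map_key Some (\<alpha> + \<beta> :: 'v option mon)
    = Poly_Mapping.map_key Some \<alpha> + Poly_Mapping.map_key Some \<beta>"
  by (rule poly_mapping_eqI) (simp add: lookup_add)

lemma map_key_Some_0: "Poly_Mapping.map_key Some (0 :: 'v option mon) = 0"
  by (rule poly_mapping_eqI) simp

lemma rhom_mod_x1: "rhom (mod_x1 :: ('v::finite option, 'k::comm_ring_1) mpol \<Rightarrow> _)"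
proof
  fix p q :: "('v option, 'k) mpol"
  show add: "mod_x1 (p + q) = mod_x1 p + mod_x1 q" for p q :: "('v option, 'k) mpol"
    by (rule poly_mapping_eqI) (simp add: lookup_add)
  show "mod_x1 (p * q) = mod_x1 p * mod_x1 q"
    by (rule mult_on_singles[OF add]) (auto simp: mod_x1_single lookup_add map_key_Some_add mult_single)
  show "mod_x1 1 = (1 :: ('v, 'k) mpol)"
    using mod_x1_single[of 0 "1::'k"] by (simp add: map_key_Some_0)
qed

definition incl :: "('v::finite, 'k::comm_ring_1) mpol \<Rightarrow> ('v option, 'k) mpol" where
  "incl p = (\<Sum>\<beta>\<in>keys p. single (emb \<beta>) (lookup p \<beta>))"

lemma lookup_incl: "lookup (incl p) \<alpha> =
    (if lookup \<alpha> None = 0 then lookup p (Poly_Mapping.map_key Some \<alpha>) else 0)"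
proof -
  have "lookup (incl p) \<alpha> = (\<Sum>\<beta>\<in>keys p. if emb \<beta> = \<alpha> then lookup p \<beta> else 0)"
    unfolding incl_def lookup_sum by (rule sum.cong) (auto simp: lookup_single when_def)
  also have "\<dots> = (\<Sum>\<beta>\<in>keys p. if \<beta> = Poly_Mapping.map_key Some \<alpha> then
      (if lookup \<alpha> None = 0 then lookup p \<beta> else 0) else 0)"
    by (rule sum.cong) (auto simp: emb_map_key)
  also have "\<dots> = (if lookup \<alpha> None = 0 then lookup p (Poly_Mapping.map_key Some \<alpha>) else 0)"
    by (subst sum.delta) (auto simp: in_keys_iff)
  finally show ?thesis .
qed

lemma incl_single: "incl (single \<alpha> c) = single (emb \<alpha>) c"
  by (cases "c = 0") (auto simp: incl_def)

lemma mod_x1_incl [simp]: "mod_x1 (incl p) = p"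
  by (rule poly_mapping_eqI) (simp add: lookup_incl)

lemma rhom_incl: "rhom (incl :: ('v::finite, 'k::comm_ring_1) mpol \<Rightarrow> _)"
proof
  fix p q :: "('v, 'k) mpol"
  show add: "incl (p + q) = incl p + incl q" for p q :: "('v, 'k) mpol"
    by (rule poly_mapping_eqI) (simp add: lookup_add lookup_incl)
  show "incl (p * q) = incl p * incl q"
    by (rule mult_on_singles[OF add]) (auto simp: incl_single emb_add mult_single)
  show "incl 1 = (1 :: ('v option, 'k) mpol)"
    using incl_single[of 0 "1::'k"] by simp
qed

text \<open>The quotient in the division by x_1 whose remainder \<open>incl (mod_x1 p)\<close> is
  free of x_1. For g = m + x_1 b it returns b.\<close>

definition quot_x1 :: "('v option, 'k::comm_ring_1) mpol \<Rightarrow> ('v option, 'k) mpol" where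
  "quot_x1 = Poly_Mapping.map_key (\<lambda>\<gamma>. \<gamma> + single None 1)"

lemma lookup_quot_x1 [simp]: "lookup (quot_x1 p) \<gamma> = lookup p (\<gamma> + single None 1)"
  unfolding quot_x1_def by (subst map_key.rep_eq) (auto simp: inj_def)

lemma quot_x1_add: "quot_x1 (p + q) = quot_x1 p + quot_x1 q"
  by (rule poly_mapping_eqI) (simp add: lookup_add)

lemma quot_x1_0 [simp]: "quot_x1 0 = 0"
  by (rule poly_mapping_eqI) simp

lemma quot_x1_sum: "quot_x1 (sum g S) = (\<Sum>i\<in>S. quot_x1 (g i))"
  by (induction S rule: infinite_finite_induct) (auto simp: quot_x1_add)

lemma quot_x1_const_mult: "quot_x1 (const a * g) = const a * quot_x1 g"
  by (rule poly_mapping_eqI) simp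

lemma x1_decompose: "p = incl (mod_x1 p) + var None * quot_x1 p"
proof (rule poly_mapping_eqI)
  fix \<alpha> show "lookup p \<alpha> = lookup (incl (mod_x1 p) + var None * quot_x1 p) \<alpha>"
    using mon_split[of \<alpha> None] emb_map_key[of \<alpha>] by (simp add: lookup_add lookup_incl lookup_var_mult)
qed

lemma quot_x1_var_mult [simp]: "quot_x1 (var None * p) = p"
  by (rule poly_mapping_eqI) (simp add: lookup_var_mult lookup_add)

lemma quot_x1_incl [simp]: "quot_x1 (incl p) = 0"
  by (rule poly_mapping_eqI) (simp add: lookup_incl lookup_add)

text \<open>A Leibniz rule. When \<open>p\<close> lies in an ideal, so does the second summand;
  modulo the ideal only the x_1-free part of \<open>q\<close> acts on the quotient of
  \<open>p\<close>.\<close>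

lemma quot_x1_mult: "quot_x1 (q * p) = incl (mod_x1 q) * quot_x1 p + quot_x1 q * p"
proof -
  have "q * p = incl (mod_x1 q) * (incl (mod_x1 p) + var None * quot_x1 p) + var None * quot_x1 q * p"
    using x1_decompose[of q] x1_decompose[of p] by (metis distrib_right)
  also have "\<dots> = incl (mod_x1 (q * p)) + var None * (incl (mod_x1 q) * quot_x1 p + quot_x1 q * p)"
    by (simp add: rhom.mult[OF rhom_incl] rhom.mult[OF rhom_mod_x1] algebra_simps)
  finally show ?thesis by (metis quot_x1_add quot_x1_incl quot_x1_var_mult add_0)
qed

lemma mod_x1_var [simp]: "mod_x1 (var None :: ('v::finite option, 'k::comm_ring_1) mpol) = 0"
  by (simp add: var_def Defs.monom_def mod_x1_single)

lemma x1_mult_cancel: "var None * p = 0 \<Longrightarrow> p = (0 :: ('v::finite option, 'k::comm_ring_1) mpol)"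
  by (metis quot_x1_var_mult quot_x1_0)

lemma mod_x1_eq_0_D:
  fixes p :: "('v::finite option, 'k::comm_ring_1) mpol"
  shows "mod_x1 p = 0 \<Longrightarrow> p = var None * quot_x1 p"
  using x1_decompose[of p] rhom.zero[OF rhom_incl] by (metis add_0)

subsection \<open>The Koszul operators\<close>

text \<open>For each \<open>i\<close> the maps \<open>s i\<close> and \<open>r i\<close> are inverse
  shifts of basis elements, defined where \<open>P i\<close> and \<open>Q i\<close> hold, so
  \<open>i\<close> contributes at \<open>c\<close> from one source only. The coefficient formulas of
  \<open>kappa\<close>, \<open>eta\<close> and \<open>kos\<close> are its instances.\<close>

lemma lookup_lin_ext_shift:
  fixes w :: "'v::finite \<Rightarrow> 'i \<Rightarrow> 'r::comm_ring_1"
  assumes "\<And>i b c. (P i b \<and> s i b = c) \<longleftrightarrow> (Q i c \<and> b = r i c)"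
  shows "lookup (lin_ext (\<lambda>b. \<Sum>i\<in>UNIV. if P i b then single (s i b) (w i b) else 0) f) c
    = (\<Sum>i\<in>UNIV. if Q i c then w i (r i c) * lookup f (r i c) else 0)"
proof -
  have *: "(\<Sum>b\<in>keys f. lookup f b * lookup (if P i b then single (s i b) (w i b) else 0) c)
      = (if Q i c then w i (r i c) * lookup f (r i c) else 0)" for i
  proof -
    have "(\<Sum>b\<in>keys f. lookup f b * lookup (if P i b then single (s i b) (w i b) else 0) c)
      = (\<Sum>b\<in>keys f. if b = r i c then (if Q i c then w i b * lookup f b else 0) else 0)"
      using assms by (intro sum.cong) (auto simp: lookup_single when_def)
    also have "\<dots> = (if Q i c then w i (r i c) * lookup f (r i c) else 0)"
      by (subst sum.delta) (auto simp: in_keys_iff)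
    finally show ?thesis .
  qed
  have "lookup (lin_ext (\<lambda>b. \<Sum>i\<in>UNIV. if P i b then single (s i b) (w i b) else 0) f) c
    = (\<Sum>b\<in>keys f. \<Sum>i\<in>UNIV. lookup f b * lookup (if P i b then single (s i b) (w i b) else 0) c)"
    by (simp add: lookup_lin_ext lookup_sum sum_distrib_left)
  also have "\<dots> = (\<Sum>i\<in>UNIV. if Q i c then w i (r i c) * lookup f (r i c) else 0)"
    by (subst sum.swap) (simp add: *)
  finally show ?thesis .
qed

section \<open>Signs of wedge products, and relations between \<open>kappa\<close>,
  \<open>eta\<close> and \<open>kos\<close>\<close>

lemma wsign_insert_self [simp]: "wsign i (insert i J) = wsign i J"
  and wsign_remove_self [simp]: "wsign i (J - {i}) = wsign i J"
  unfolding wsign_def by (intro arg_cong[where f = "\<lambda>X. (- 1) ^ card X"]; auto)+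

lemma wsign_insert_less:
  "j < i \<Longrightarrow> j \<notin> J \<Longrightarrow> wsign i (insert j J) = - wsign (i::'v::{finite,linorder}) J"
proof -
  assume "j < i" "j \<notin> J"
  then have "{k \<in> insert j J. k < i} = insert j {k \<in> J. k < i}" by auto
  then show ?thesis using \<open>j \<notin> J\<close> by (simp add: wsign_def)
qed

lemma wsign_insert_greater: "i < j \<Longrightarrow> wsign i (insert j J) = wsign i J"
  unfolding wsign_def by (rule arg_cong[where f = "\<lambda>X. (- 1) ^ card X"]) auto

lemma wsign_square [simp]: "wsign i J * wsign i J = 1"
  by (simp add: wsign_def flip: power_mult_distrib)

lemma wsign_square_left [simp]: "wsign i J * (wsign i J * a) = a"
  by (simp flip: mult.assoc)

lemma wsign_nonzero [simp]: "wsign i J \<noteq> 0"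
  by (metis mult_zero_left wsign_square zero_neq_one)

lemma wsign_cancel [simp]: "wsign i J * a = 0 \<longleftrightarrow> a = 0"
  by (metis mult_zero_right wsign_square_left)

lemma (in rhom) wsign [simp]: "h (wsign i J) = wsign i J"
  using uminus[of 1] by (simp add: wsign_def power one)

lemma wsign_swap:
  fixes i j :: "'v::{finite,linorder}"
  assumes "i \<noteq> j" "i \<notin> J" "j \<notin> J"
  shows "wsign i J * wsign j (insert i J) = - (wsign j J * wsign i (insert j J) :: 'r::comm_ring_1)"
  using assms by (cases "i < j") (auto simp: wsign_insert_less wsign_insert_greater)

lemma wsign_swap_left:
  fixes i j :: "'v::{finite,linorder}"
  assumes "i \<noteq> j" "i \<notin> J" "j \<notin> J"
  shows "wsign i J * (wsign j (insert i J) * x) = - (wsign j J * (wsign i (insert j J) *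
      (x :: 'r::comm_ring_1)))"
  unfolding mult.assoc[symmetric] by (subst wsign_swap[OF assms]) (rule mult_minus_left)

text \<open>The order of two insertions affects only the sign, by \<open>wsign_swap\<close>. For
  this reason \<open>kos\<close> anticommutes with \<open>eta\<close> and
  \<open>kappa\<close>.\<close>

lemma wedge_sum_flip:
  fixes F :: "'v::{finite,linorder} \<Rightarrow> 'v \<Rightarrow> 'r::comm_ring_1"
  shows "(\<Sum>i\<in>-J. \<Sum>j\<in>-insert i J. wsign i J * (wsign j (insert i J) * F i j))
    = - (\<Sum>i\<in>-J. \<Sum>j\<in>-insert i J. wsign i J * (wsign j (insert i J) * F j i))"
proof -
  define a where "a G i j = (if i \<noteq> j then wsign i J * (wsign j (insert i J) * G i j) else 0)"
    for G :: "'v \<Rightarrow> 'v \<Rightarrow> 'r" and i j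
  have *: "(\<Sum>i\<in>-J. \<Sum>j\<in>-insert i J. wsign i J * (wsign j (insert i J) * G i j))
      = (\<Sum>i\<in>-J. \<Sum>j\<in>-J. a G i j)" for G :: "'v \<Rightarrow> 'v \<Rightarrow> 'r"
    unfolding a_def by (intro sum.cong sum.mono_neutral_cong_left) auto
  have "(\<Sum>i\<in>-J. \<Sum>j\<in>-J. a F i j) = (\<Sum>j\<in>-J. \<Sum>i\<in>-J. a F i j)"
    by (rule sum.swap)
  also have "\<dots> = (\<Sum>j\<in>-J. \<Sum>i\<in>-J. - a (\<lambda>i j. F j i) j i)"
  proof (intro sum.cong refl)
    fix i j assume "i \<in> -J" "j \<in> -J"
    then show "a F i j = - a (\<lambda>i j. F j i) j i"
      by (auto simp: a_def wsign_swap_left[of i j J])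
  qed
  finally show ?thesis unfolding * by (simp add: sum_negf)
qed

text \<open>\<open>wedge_sum_flip\<close> would only show that twice the sum vanishes, which is too
  weak in characteristic 2. So the terms with \<open>i < j\<close> are cancelled against those with
  \<open>j < i\<close>.\<close>

lemma wedge_sum_symmetric:
  fixes F :: "'v::{finite,linorder} \<Rightarrow> 'v \<Rightarrow> 'r::comm_ring_1"
  assumes "\<And>i j. i \<noteq> j \<Longrightarrow> F i j = F j i"
  shows "(\<Sum>i\<in>-J. \<Sum>j\<in>-insert i J. wsign i J * (wsign j (insert i J) * F i j)) = 0"
proof -
  define a where "a i j = wsign i J * (wsign j (insert i J) * F i j)" for i j
  have flip: "a i j = - a j i" if "i \<noteq> j" "i \<notin> J" "j \<notin> J" for i j
    unfolding a_def assms[OF that(1)] by (rule wsign_swap_left[OF that])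
  have "(\<Sum>i\<in>-J. \<Sum>j\<in>-insert i J. a i j)
    = (\<Sum>i\<in>-J. \<Sum>j\<in>-J. (if i < j then a i j else 0) + (if j < i then a i j else 0))"
    by (intro sum.cong sum.mono_neutral_cong_left) auto
  also have "\<dots> = (\<Sum>i\<in>-J. \<Sum>j\<in>-J. if i < j then a i j else 0) + (\<Sum>i\<in>-J. \<Sum>j\<in>-J. if j < i then a i j else 0)"
    by (simp add: sum.distrib)
  also have "(\<Sum>i\<in>-J. \<Sum>j\<in>-J. if j < i then a i j else 0) = (\<Sum>j\<in>-J. \<Sum>i\<in>-J. if j < i then a i j else 0)"
    by (rule sum.swap)
  also have "\<dots> = (\<Sum>j\<in>-J. \<Sum>i\<in>-J. - (if j < i then a j i else 0))"
  proof (intro sum.cong refl)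
    fix i j assume "j \<in> -J" "i \<in> -J"
    then show "(if j < i then a i j else 0) = - (if j < i then a j i else 0)"
      using flip[of i j] by (cases "j < i") auto
  qed
  finally show ?thesis by (simp add: a_def sum_negf)
qed

lemma sum_mem_UNIV: "(\<Sum>i\<in>J. g i) = (\<Sum>i\<in>(UNIV::'v::finite set). if i \<in> J then g i else 0)"
  by (simp add: sum.If_cases)

lemma sum_Compl_UNIV: "(\<Sum>i\<in>-J. g i) = (\<Sum>i\<in>(UNIV::'v::finite set). if i \<notin> J then g i else 0)"
  by (simp add: sum.If_cases Compl_eq)

lemma lookup_kappa:
  "lookup (kappa f) (J, \<mu>) = (\<Sum>i\<in>-J. wsign i J *
    (if lookup \<mu> i > 0 then lookup f (insert i J, \<mu> - single i 1) else 0))"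
proof -
  have "kappa f = lin_ext (\<lambda>b. \<Sum>i\<in>UNIV. if i \<in> fst b then single
      (fst b - {i}, snd b + single i 1) (wsign i (fst b)) else 0) f"
    unfolding kappa_def by (rule lin_ext_cong) (simp only: case_prod_beta, rule sum_mem_UNIV)
  also have "lookup \<dots> (J, \<mu>) = (\<Sum>i\<in>UNIV. if i \<notin> fst (J, \<mu>) \<and> lookup (snd (J, \<mu>)) i > 0
      then wsign i (fst (insert i (fst (J, \<mu>)), snd (J, \<mu>) - single i 1)) *
        lookup f (insert i (fst (J, \<mu>)), snd (J, \<mu>) - single i 1) else 0)"
    by (rule lookup_lin_ext_shift) (auto simp: lookup_add mon_split[unfolded One_nat_def])
  finally show ?thesis unfolding sum_Compl_UNIV by (auto intro!: sum.cong)
qed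

lemma lookup_eta:
  "lookup (eta f) (J, \<mu>) = (\<Sum>i\<in>-J. wsign i J * lookup f (insert i J, \<mu> + single i 1))"
proof -
  have "eta f = lin_ext (\<lambda>b. \<Sum>i\<in>UNIV. if i \<in> fst b \<and> lookup (snd b) i > 0 then single
      (fst b - {i}, snd b - single i 1) (wsign i (fst b)) else 0) f"
    unfolding eta_def by (rule lin_ext_cong) (clarsimp, subst sum_mem_UNIV, auto intro!: sum.cong)
  also have "lookup \<dots> (J, \<mu>) = (\<Sum>i\<in>UNIV. if i \<notin> fst (J, \<mu>)
      then wsign i (fst (insert i (fst (J, \<mu>)), snd (J, \<mu>) + single i 1)) *
        lookup f (insert i (fst (J, \<mu>)), snd (J, \<mu>) + single i 1) else 0)"
    by (rule lookup_lin_ext_shift) (auto simp: lookup_add mon_split[unfolded One_nat_def])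
  finally show ?thesis unfolding sum_Compl_UNIV by (auto intro!: sum.cong)
qed

lemma lookup_kos:
  "lookup (kos f) (J, \<mu>) = (\<Sum>i\<in>-J. wsign i J * (var i * lookup f (insert i J, \<mu>)))"
proof -
  have "kos f = lin_ext (\<lambda>b. \<Sum>i\<in>UNIV. if i \<in> fst b then single
      (fst b - {i}, snd b) (wsign i (fst b) * var i) else 0) f"
    unfolding kos_def by (rule lin_ext_cong) (simp only: case_prod_beta, rule sum_mem_UNIV)
  also have "lookup \<dots> (J, \<mu>) = (\<Sum>i\<in>UNIV. if i \<notin> fst (J, \<mu>)
      then (wsign i (fst (insert i (fst (J, \<mu>)), snd (J, \<mu>))) * var i) *
        lookup f (insert i (fst (J, \<mu>)), snd (J, \<mu>)) else 0)"
    by (rule lookup_lin_ext_shift) auto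
  finally show ?thesis unfolding sum_Compl_UNIV by (auto intro!: sum.cong simp: mult.assoc)
qed

lemma bas_eqI: "(\<And>J \<mu>. lookup f (J, \<mu>) = lookup g (J, \<mu>)) \<Longrightarrow> f = g"
  by (rule poly_mapping_eqI) auto

lemma kappa_kappa: "kappa (kappa f) = 0"
proof (rule bas_eqI)
  fix J :: "'a set" and \<mu> :: "'a mon"
  let ?F = "\<lambda>i j. if lookup \<mu> i > 0 \<and> lookup (\<mu> - single i 1) j > 0
    then lookup f (insert j (insert i J), \<mu> - single i 1 - single j 1) else 0"
  have "lookup (kappa (kappa f)) (J, \<mu>)
      = (\<Sum>i\<in>-J. \<Sum>j\<in>-insert i J. wsign i J * (wsign j (insert i J) * ?F i j))"
    unfolding lookup_kappa by (auto simp: sum_distrib_left intro!: sum.cong)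
  also have "\<dots> = 0"
    by (rule wedge_sum_symmetric)
      (auto simp: insert_commute lookup_minus lookup_single when_def diff_right_commute diff_diff_eq
          add.commute)
  finally show "lookup (kappa (kappa f)) (J, \<mu>) = lookup 0 (J, \<mu>)" by simp
qed

lemma eta_eta: "eta (eta f) = 0"
proof (rule bas_eqI)
  fix J :: "'a set" and \<mu> :: "'a mon"
  let ?F = "\<lambda>i j. lookup f (insert j (insert i J), \<mu> + single i 1 + single j 1)"
  have "lookup (eta (eta f)) (J, \<mu>)
      = (\<Sum>i\<in>-J. \<Sum>j\<in>-insert i J. wsign i J * (wsign j (insert i J) * ?F i j))"
    unfolding lookup_eta by (auto simp: sum_distrib_left intro!: sum.cong)
  also have "\<dots> = 0"
    by (rule wedge_sum_symmetric) (simp add: insert_commute ac_simps)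
  finally show "lookup (eta (eta f)) (J, \<mu>) = lookup 0 (J, \<mu>)" by simp
qed

lemma kos_kos: "kos (kos f) = 0"
proof (rule bas_eqI)
  fix J :: "'a set" and \<mu> :: "'a mon"
  let ?F = "\<lambda>i j. var i * (var j * lookup f (insert j (insert i J), \<mu>))"
  have "lookup (kos (kos f)) (J, \<mu>)
      = (\<Sum>i\<in>-J. \<Sum>j\<in>-insert i J. wsign i J * (wsign j (insert i J) * ?F i j))"
    unfolding lookup_kos by (auto simp: sum_distrib_left ac_simps intro!: sum.cong)
  also have "\<dots> = 0"
    by (rule wedge_sum_symmetric) (simp add: insert_commute ac_simps)
  finally show "lookup (kos (kos f)) (J, \<mu>) = lookup 0 (J, \<mu>)" by simp
qed

lemma eta_kos: "eta (kos f) = - kos (eta f)"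
proof (rule bas_eqI)
  fix J :: "'a set" and \<mu> :: "'a mon"
  let ?F = "\<lambda>i j. var j * lookup f (insert j (insert i J), \<mu> + single i 1)"
  have "lookup (eta (kos f)) (J, \<mu>)
      = (\<Sum>i\<in>-J. \<Sum>j\<in>-insert i J. wsign i J * (wsign j (insert i J) * ?F i j))"
    unfolding lookup_eta lookup_kos by (auto simp: sum_distrib_left intro!: sum.cong)
  also have "\<dots> = - (\<Sum>i\<in>-J. \<Sum>j\<in>-insert i J. wsign i J * (wsign j (insert i J) * ?F j i))"
    by (rule wedge_sum_flip)
  also have "\<dots> = - lookup (kos (eta f)) (J, \<mu>)"
    unfolding lookup_eta lookup_kos by (auto simp: sum_distrib_left insert_commute ac_simps intro!: sum.cong)
  finally show "lookup (eta (kos f)) (J, \<mu>) = lookup (- kos (eta f)) (J, \<mu>)" by simp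
qed

lemma kappa_kos: "kappa (kos f) = - kos (kappa f)"
proof (rule bas_eqI)
  fix J :: "'a set" and \<mu> :: "'a mon"
  let ?F = "\<lambda>i j. if lookup \<mu> i > 0 then
    var j * lookup f (insert j (insert i J), \<mu> - single i 1) else 0"
  have "lookup (kappa (kos f)) (J, \<mu>)
      = (\<Sum>i\<in>-J. \<Sum>j\<in>-insert i J. wsign i J * (wsign j (insert i J) * ?F i j))"
    unfolding lookup_kappa lookup_kos by (auto simp: sum_distrib_left intro!: sum.cong)
  also have "\<dots> = - (\<Sum>i\<in>-J. \<Sum>j\<in>-insert i J. wsign i J * (wsign j (insert i J) * ?F j i))"
    by (rule wedge_sum_flip)
  also have "\<dots> = - lookup (kos (kappa f)) (J, \<mu>)"
    unfolding lookup_kappa lookup_kos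
    by (auto simp: sum_distrib_left insert_commute ac_simps intro!: sum.cong split: if_splits)
  finally show "lookup (kappa (kos f)) (J, \<mu>) = lookup (- kos (kappa f)) (J, \<mu>)" by simp
qed

lemma kappa_add: "kappa (f + g) = kappa f + kappa g"
  and kappa_smul: "kappa (smul a f) = smul a (kappa f)"
  and kappa_0 [simp]: "kappa 0 = 0"
  by (simp_all add: kappa_def lin_ext_add lin_ext_smul)

lemma eta_add: "eta (f + g) = eta f + eta g"
  and eta_smul: "eta (smul a f) = smul a (eta f)"
  and eta_0 [simp]: "eta 0 = 0"
  by (simp_all add: eta_def lin_ext_add lin_ext_smul)

lemma kos_diff: "kos (f - g) = kos f - kos g"
  and kos_smul: "kos (smul a f) = smul a (kos f)"
  and kos_0 [simp]: "kos 0 = 0"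
  by (simp_all add: kos_def lin_ext_minus lin_ext_smul)

lemma (in rhom) kappa_map: "kappa (pm_map h f) = pm_map h (kappa f)"
  by (rule bas_eqI) (simp add: lookup_kappa sum mult if_distrib[of h] cong: if_cong)

lemma (in rhom) eta_map: "eta (pm_map h f) = pm_map h (eta f)"
  by (rule bas_eqI) (simp add: lookup_eta sum mult)

lemma bideg_iff: "f \<in> bideg a b \<longleftrightarrow> (\<forall>J \<mu>. lookup f (J, \<mu>) \<noteq> 0 \<longrightarrow> card J = a \<and> mdeg \<mu> = b)"
  by (auto simp: bideg_def in_keys_iff)

lemma bidegD: "f \<in> bideg a b \<Longrightarrow> lookup f (J, \<mu>) \<noteq> 0 \<Longrightarrow> card J = a \<and> mdeg \<mu> = b"
  by (auto simp: bideg_iff)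

lemma bideg_0 [simp]: "0 \<in> bideg a b"
  by (simp add: bideg_iff)

lemma bideg_add: "f \<in> bideg a b \<Longrightarrow> g \<in> bideg a b \<Longrightarrow> f + g \<in> bideg a b"
  by (auto simp: bideg_iff lookup_add) (metis add_0)+

lemma bideg_smul: "f \<in> bideg a b \<Longrightarrow> smul c f \<in> bideg a b"
  unfolding bideg_iff lookup_smul by (metis mult_zero_right)

lemma (in rhom) bideg_map: "f \<in> bideg a b \<Longrightarrow> pm_map h f \<in> bideg a b"
  by (auto simp: bideg_iff) (metis zero)+

lemma kappa_bideg:
  assumes "f \<in> bideg (Suc a) b"
  shows "kappa f \<in> bideg a (Suc b)"
  unfolding bideg_iff
proof (intro allI impI)
  fix J \<mu> assume "lookup (kappa f) (J, \<mu>) \<noteq> 0"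
  then obtain i where "i \<notin> J" "lookup \<mu> i > 0" "lookup f (insert i J, \<mu> - single i 1) \<noteq> 0"
    unfolding lookup_kappa by (auto elim!: sum.not_neutral_contains_not_neutral split: if_splits)
  then show "card J = a \<and> mdeg \<mu> = Suc b"
    using bidegD[OF assms, of "insert i J" "\<mu> - single i 1"] mon_split[of \<mu> i]
    by (metis Suc_eq_plus1 card_insert_disjoint finite mdeg_add mdeg_single old.nat.inject)
qed

lemma eta_bideg:
  assumes "f \<in> bideg (Suc a) (Suc b)"
  shows "eta f \<in> bideg a b"
  unfolding bideg_iff
proof (intro allI impI)
  fix J \<mu> assume "lookup (eta f) (J, \<mu>) \<noteq> 0"
  then obtain i where "i \<notin> J" "lookup f (insert i J, \<mu> + single i 1) \<noteq> 0"
    unfolding lookup_eta by (auto elim!: sum.not_neutral_contains_not_neutral)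
  then show "card J = a \<and> mdeg \<mu> = b"
    using bidegD[OF assms, of "insert i J" "\<mu> + single i 1"] by auto
qed

lemma kos_bideg:
  assumes "f \<in> bideg (Suc a) b"
  shows "kos f \<in> bideg a b"
  unfolding bideg_iff
proof (intro allI impI)
  fix J \<mu> assume "lookup (kos f) (J, \<mu>) \<noteq> 0"
  then obtain i where "i \<notin> J" "lookup f (insert i J, \<mu>) \<noteq> 0"
    unfolding lookup_kos by (metis (no_types, lifting) ComplD mult_zero_right sum.neutral)
  then show "card J = a \<and> mdeg \<mu> = b"
    using bidegD[OF assms, of "insert i J" "\<mu>"] by auto
qed

subsection \<open>Contracting homotopies and base change\<close>

text \<open>Only the least variable that can be contracted (respectively integrated) is used; the homotopy that
  sums over all variables would need division by integers.\<close>

definition kappa_homotopy :: "'v::{finite,linorder} bas \<Rightarrow> ('v bas \<Rightarrow>\<^sub>0 'r::comm_ring_1)" where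
  "kappa_homotopy = (\<lambda>(J, \<mu>). let i = Min (J \<union> {i. lookup \<mu> i > 0}) in
     if i \<in> J then 0 else single (insert i J, \<mu> - single i 1) 1)"

definition eta_homotopy :: "'v::{finite,linorder} bas \<Rightarrow> ('v bas \<Rightarrow>\<^sub>0 'r::comm_ring_1)" where
  "eta_homotopy = (\<lambda>(J, \<mu>). let i = Min (- J \<union> {i. lookup \<mu> i > 0}) in
     if i \<in> J then 0 else single (insert i J, \<mu> + single i 1) (wsign i J))"

lemma kappa_single: "kappa (single (J, \<mu>) a) =
    (\<Sum>i\<in>J. single (J - {i}, \<mu> + single i 1) (a * wsign i J))"
  by (simp add: kappa_def smul_sum)

lemma eta_single: "eta (single (J, \<mu>) a) =
    (\<Sum>i\<in>J. if lookup \<mu> i > 0 then single (J - {i}, \<mu> - single i 1) (a * wsign i J) else 0)"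
  by (auto simp add: eta_def smul_sum intro!: sum.cong)

lemma wsign_Min: "(\<And>j. j \<in> J \<Longrightarrow> i \<le> j) \<Longrightarrow> wsign i J = 1"
proof -
  assume "\<And>j. j \<in> J \<Longrightarrow> i \<le> j"
  then have "{j \<in> J. j < i} = {}" by (auto simp: not_less)
  then show ?thesis unfolding wsign_def by (metis card.empty power_0)
qed

text \<open>\<open>kappa\<close> moves a variable from the wedge factor to the symmetric one, so all
  its terms share the least variable \<open>i0\<close>. If \<open>i0\<close> lies in
  \<open>J\<close>, only the term that removes it survives, and the homotopy puts it back. Otherwise
  the homotopy moves \<open>i0\<close> into \<open>J\<close>: the term \<open>i0\<close> of
  \<open>kappa\<close> restores the basis element, and the others cancel because \<open>i0\<close>
  precedes every element of \<open>J\<close>.\<close>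

lemma kappa_homotopy_basis:
  fixes J :: "'v::{finite,linorder} set"
  assumes "(J, \<mu>) \<noteq> ({}, 0)"
  shows "kappa (kappa_homotopy (J, \<mu>)) + lin_ext kappa_homotopy (kappa (single (J, \<mu>) 1))
    = single (J, \<mu>) (1::'r::comm_ring_1)"
proof -
  define i0 where "i0 = Min (J \<union> {i. lookup \<mu> i > 0})"
  have ne: "J \<union> {i. lookup \<mu> i > 0} \<noteq> {}"
    using assms by (auto simp: poly_mapping_eq_iff fun_eq_iff)
  then have i0: "i0 \<in> J \<union> {i. lookup \<mu> i > 0}" unfolding i0_def by (intro Min_in) auto
  have i0_le: "i0 \<le> j" if "j \<in> J" for j using that unfolding i0_def by auto
  have w0: "wsign i0 J = (1::'r)" by (rule wsign_Min) (rule i0_le)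
  have same: "(J - {i}) \<union> {k. lookup (\<mu> + single i 1) k > 0} = J \<union> {i. lookup \<mu> i > 0}"
    if "i \<in> J" for i using that by (auto simp: lookup_add lookup_single when_def)
  define t where "t i = (if i0 \<in> J - {i} then 0 else
      single (insert i0 (J - {i}), \<mu> + single i 1 - single i0 1) (1::'r))" for i
  have hb: "kappa_homotopy (J - {i}, \<mu> + single i 1) = t i" if "i \<in> J" for i
    unfolding kappa_homotopy_def case_prod_conv same[OF that] i0_def[symmetric] Let_def t_def ..
  have second: "lin_ext kappa_homotopy (kappa (single (J, \<mu>) 1)) = (\<Sum>i\<in>J. smul (wsign i J) (t i))"
    unfolding kappa_single lin_ext_sum lin_ext_single by (intro sum.cong refl) (simp add: hb del: One_nat_def)
  show ?thesis
  proof (cases "i0 \<in> J")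
    case True
    have "lin_ext kappa_homotopy (kappa (single (J, \<mu>) 1)) =
        (\<Sum>i\<in>J. if i = i0 then single (J, \<mu>) (1::'r) else 0)"
      unfolding second t_def using True w0
      by (intro sum.cong refl) (auto simp: insert_absorb simp del: One_nat_def)
    also have "\<dots> = single (J, \<mu>) 1" using True by simp
    finally show ?thesis using True by (simp add: kappa_homotopy_def flip: i0_def)
  next
    case False
    then have pos: "lookup \<mu> i0 > 0" using i0 by auto
    let ?s = "\<lambda>i. single (insert i0 J - {i}, \<mu> - single i0 1 + single i 1) (wsign i (insert i0 J) :: 'r)"
    have "kappa_homotopy (J, \<mu>) = single (insert i0 J, \<mu> - single i0 1) (1::'r)"
      using False by (simp add: kappa_homotopy_def flip: i0_def)
    then have "kappa (kappa_homotopy (J, \<mu>)) = single (J, \<mu>) 1 + (\<Sum>i\<in>J. ?s i)"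
      using False pos w0 by (simp add: kappa_single mon_split del: One_nat_def)
    also have "(\<Sum>i\<in>J. ?s i) = (\<Sum>i\<in>J. - smul (wsign i J) (t i))"
    proof (intro sum.cong refl)
      fix i assume i: "i \<in> J"
      with False i0_le[OF i] have "i0 < i" by (metis order_le_less)
      moreover have "\<mu> - single i0 1 + single i 1 = \<mu> + single i 1 - single i0 1"
        using pos by (auto intro!: poly_mapping_eqI simp: lookup_add lookup_minus lookup_single when_def)
      moreover have "insert i0 J - {i} = insert i0 (J - {i})" using False i by auto
      ultimately show "?s i = - smul (wsign i J) (t i)"
        using False by (simp add: t_def wsign_insert_less single_uminus del: One_nat_def)
    qed
    finally show ?thesis unfolding second by (simp add: sum_negf)
  qed
qed

text \<open>Here the union of the complement of \<open>J\<close> with the support of the exponent is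
  what all terms of \<open>eta\<close> share. Elements of \<open>J\<close> with exponent 0 may lie
  below its minimum \<open>i0\<close>, which is why \<open>eta_homotopy\<close> carries a sign,
  unlike \<open>kappa_homotopy\<close>.\<close>

lemma eta_homotopy_basis:
  fixes J :: "'v::{finite,linorder} set"
  assumes "(J, \<mu>) \<noteq> (UNIV, 0)"
  shows "eta (eta_homotopy (J, \<mu>)) + lin_ext eta_homotopy (eta (single (J, \<mu>) 1))
    = single (J, \<mu>) (1::'r::comm_ring_1)"
proof -
  define i0 where "i0 = Min (- J \<union> {i. lookup \<mu> i > 0})"
  have ne: "- J \<union> {i. lookup \<mu> i > 0} \<noteq> {}"
    using assms by (auto simp: poly_mapping_eq_iff fun_eq_iff)
  then have i0: "i0 \<in> - J \<union> {i. lookup \<mu> i > 0}" unfolding i0_def by (intro Min_in) auto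
  have i0_le: "i0 \<le> j" if "lookup \<mu> j > 0" for j using that unfolding i0_def by auto
  have same: "- (J - {i}) \<union> {k. lookup (\<mu> - single i 1) k > 0} = - J \<union> {i. lookup \<mu> i > 0}"
    if "i \<in> J" "lookup \<mu> i > 0" for i using that by (auto simp: lookup_minus lookup_single when_def)
  define t where "t i = (if i0 \<in> J - {i} then 0 else
      single (insert i0 (J - {i}), \<mu> - single i 1 + single i0 1) (wsign i0 (J - {i}) :: 'r))" for i
  have hb: "eta_homotopy (J - {i}, \<mu> - single i 1) = t i" if "i \<in> J" "lookup \<mu> i > 0" for i
    unfolding eta_homotopy_def case_prod_conv same[OF that] i0_def[symmetric] Let_def t_def ..
  have second: "lin_ext eta_homotopy (eta (single (J, \<mu>) 1)) =
      (\<Sum>i\<in>J. if lookup \<mu> i > 0 then smul (wsign i J) (t i) else 0)"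
    unfolding eta_single lin_ext_sum by (intro sum.cong refl) (auto simp: hb simp del: One_nat_def)
  show ?thesis
  proof (cases "i0 \<in> J")
    case True
    then have pos: "lookup \<mu> i0 > 0" using i0 by auto
    have "lin_ext eta_homotopy (eta (single (J, \<mu>) 1)) =
        (\<Sum>i\<in>J. if i = i0 then single (J, \<mu>) (1::'r) else 0)"
      unfolding second t_def using True pos
      by (intro sum.cong refl) (auto simp: insert_absorb mon_split simp del: One_nat_def)
    also have "\<dots> = single (J, \<mu>) 1" using True by simp
    finally show ?thesis using True by (simp add: eta_homotopy_def flip: i0_def)
  next
    case False
    let ?s = "\<lambda>i. if lookup (\<mu> + single i0 1) i > 0 then
      single (insert i0 J - {i}, \<mu> + single i0 1 - single i 1)
        (wsign i0 J * wsign i (insert i0 J) :: 'r) else 0"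
    have "eta_homotopy (J, \<mu>) = single (insert i0 J, \<mu> + single i0 1) (wsign i0 J :: 'r)"
      using False by (simp add: eta_homotopy_def flip: i0_def)
    then have "eta (eta_homotopy (J, \<mu>)) = single (J, \<mu>) 1 + (\<Sum>i\<in>J. ?s i)"
      using False by (simp add: eta_single lookup_add del: One_nat_def)
    also have "(\<Sum>i\<in>J. ?s i) = (\<Sum>i\<in>J. - (if lookup \<mu> i > 0 then smul (wsign i J) (t i) else 0))"
    proof (intro sum.cong refl)
      fix i assume i: "i \<in> J"
      with False have ne: "i \<noteq> i0" by auto
      have lk: "lookup (\<mu> + single i0 1) i = lookup \<mu> i"
        using ne by (simp add: lookup_add lookup_single)
      show "?s i = - (if lookup \<mu> i > 0 then smul (wsign i J) (t i) else 0)"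
      proof (cases "lookup \<mu> i > 0")
        case True
        then have lt: "i0 < i" using i0_le[of i] ne by auto
        have "\<mu> + single i0 1 - single i 1 = \<mu> - single i 1 + single i0 1"
          using True by (auto intro!: poly_mapping_eqI simp: lookup_add lookup_minus lookup_single when_def)
        moreover have "insert i0 J - {i} = insert i0 (J - {i})" using ne by auto
        moreover have "wsign i0 (J - {i}) = (wsign i0 J :: 'r)"
          using wsign_insert_greater[OF lt, of "J - {i}"] i by (metis insert_Diff)
        ultimately show ?thesis
          using False lt by (simp add: lk t_def wsign_insert_less single_uminus mult.commute del: One_nat_def)
      qed (simp add: lk del: One_nat_def)
    qed
    finally show ?thesis unfolding second by (simp add: sum_negf)
  qed
qed

text \<open>More than exactness: the cycle \<open>f\<close> is expanded, with its own coefficients,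
  in the boundaries \<open>d (h i)\<close>. For \<open>kappa\<close> and \<open>eta\<close> these
  come from integral cycles.\<close>

lemma homotopy_exact:
  assumes "lin_ext d f = 0"
    and "\<And>i. i \<in> keys f \<Longrightarrow> lin_ext d (h i) + lin_ext h (d i) = single i 1"
  shows "f = lin_ext (\<lambda>i. lin_ext d (h i)) f"
proof -
  have "f = lin_ext (\<lambda>i. single i 1) f" by (simp only: lin_ext_id)
  also have "\<dots> = lin_ext (\<lambda>i. lin_ext d (h i) + lin_ext h (d i)) f"
    by (rule lin_ext_cong) (simp add: assms(2))
  also have "\<dots> = lin_ext (\<lambda>i. lin_ext d (h i)) f + lin_ext h (lin_ext d f)"
    by (simp only: lin_ext_plus lin_ext_lin_ext)
  finally show ?thesis using assms(1) by simp
qed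

lemma kappa_exact:
  assumes f: "f \<in> bideg a b" "kappa f = 0" and ab: "a > 0 \<or> b > 0"
  shows "f = lin_ext (\<lambda>c. kappa (kappa_homotopy c)) f"
  unfolding kappa_def
proof (rule homotopy_exact)
  fix c assume "c \<in> keys f"
  then obtain J \<mu> where c: "c = (J, \<mu>)" "card J = a" "mdeg \<mu> = b"
    using f(1) by (cases c) (auto simp: bideg_def)
  then have "(J, \<mu>) \<noteq> ({}, 0)" using ab by auto
  from kappa_homotopy_basis[OF this] c(1)
  show "lin_ext (\<lambda>(J, \<mu>). \<Sum>i\<in>J. single (J - {i}, \<mu> + single i 1) (wsign i J)) (kappa_homotopy c) +
      lin_ext kappa_homotopy (case c of (J, \<mu>) \<Rightarrow>
        \<Sum>i\<in>J. single (J - {i}, \<mu> + single i 1) (wsign i J)) = single c 1"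
    by (simp add: kappa_def)
qed (use f(2) in \<open>simp add: kappa_def\<close>)

lemma eta_exact:
  fixes f :: "'v::{finite,linorder} bas \<Rightarrow>\<^sub>0 'r::comm_ring_1"
  assumes f: "f \<in> bideg a b" "eta f = 0" and ab: "a < CARD('v) \<or> b > 0"
  shows "f = lin_ext (\<lambda>c. eta (eta_homotopy c)) f"
  unfolding eta_def
proof (rule homotopy_exact)
  fix c assume "c \<in> keys f"
  then obtain J \<mu> where c: "c = (J, \<mu>)" "card J = a" "mdeg \<mu> = b"
    using f(1) by (cases c) (auto simp: bideg_def)
  then have "(J, \<mu>) \<noteq> (UNIV, 0)" using ab by auto
  from eta_homotopy_basis[OF this] c(1)
  show "lin_ext (\<lambda>(J, \<nu>). \<Sum>i\<in>J. if lookup \<nu> i > 0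
        then single (J - {i}, \<nu> - single i 1) (wsign i J) else 0) (eta_homotopy c) +
      lin_ext eta_homotopy (case c of (J, \<nu>) \<Rightarrow> \<Sum>i\<in>J. if lookup \<nu> i > 0
        then single (J - {i}, \<nu> - single i 1) (wsign i J) else 0) = single c 1"
    by (simp add: eta_def)
qed (use f(2) in \<open>simp add: eta_def\<close>)

lemma of_int_kappa_homotopy:
  "pm_map of_int (kappa_homotopy c :: _ \<Rightarrow>\<^sub>0 int) = (kappa_homotopy c :: _ \<Rightarrow>\<^sub>0 'r::comm_ring_1)"
  by (cases c) (auto simp: kappa_homotopy_def Let_def rhom.lookup[OF rhom_of_int] lookup_single when_def
      intro!: poly_mapping_eqI)

lemma of_int_eta_homotopy:
  "pm_map of_int (eta_homotopy c :: _ \<Rightarrow>\<^sub>0 int) = (eta_homotopy c :: _ \<Rightarrow>\<^sub>0 'r::comm_ring_1)"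
  by (cases c) (auto simp: eta_homotopy_def Let_def rhom.lookup[OF rhom_of_int] rhom.wsign[OF rhom_of_int]
      lookup_single when_def intro!: poly_mapping_eqI)

lemma kappa_homotopy_in_Lmod:
  assumes "card J = a" "mdeg \<mu> = b" "a > 0 \<or> b > 0"
  shows "kappa (kappa_homotopy (J, \<mu>)) \<in> Lmod a b"
proof -
  define i0 where "i0 = Min (J \<union> {i. lookup \<mu> i > 0})"
  have "J \<union> {i. lookup \<mu> i > 0} \<noteq> {}"
    using assms by (cases b) (auto dest: mdeg_Suc_D)
  then have i0: "i0 \<in> J \<union> {i. lookup \<mu> i > 0}" unfolding i0_def by (intro Min_in) auto
  show ?thesis
  proof (cases "i0 \<in> J")
    case True
    then show ?thesis by (simp add: Lmod_def kappa_homotopy_def flip: i0_def)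
  next
    case False
    then have pos: "lookup \<mu> i0 > 0" using i0 by auto
    then have "b = Suc (b - 1)"
      using assms mon_split[OF pos] by (metis Suc_eq_plus1 add_diff_cancel_right' mdeg_add mdeg_single)
    moreover have "kappa_homotopy (J, \<mu>) \<in> (bideg (Suc a) (b - 1) :: (_ \<Rightarrow>\<^sub>0 int) set)"
      using False assms mdeg_minus_single[OF pos]
      by (simp add: kappa_homotopy_def bideg_def flip: i0_def)
    ultimately show ?thesis using kappa_bideg[of "kappa_homotopy (J, \<mu>)" a "b - 1"]
      by (simp add: Lmod_def kappa_kappa)
  qed
qed

lemma eta_homotopy_in_Kmod:
  assumes "card J = a" "mdeg \<mu> = b"
  shows "eta (eta_homotopy (J, \<mu>)) \<in> Kmod a b"
proof -
  have "eta_homotopy (J, \<mu>) \<in> (bideg (Suc a) (Suc b) :: (_ \<Rightarrow>\<^sub>0 int) set)"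
    using assms by (auto simp: eta_homotopy_def bideg_def Let_def card_insert_if split: if_splits)
  then show ?thesis by (simp add: Kmod_def eta_bideg eta_eta)
qed

section \<open>Kernels commute with base change\<close>

interpretation smul_module: Modules.module "smul :: 'r::comm_ring_1 \<Rightarrow> ('i \<Rightarrow>\<^sub>0 'r) \<Rightarrow> _"
  by (rule module_smul)

lemma base_change_subset:
  assumes "\<And>f. f \<in> M \<Longrightarrow> pm_map of_int f \<in> N" "smul_module.subspace N"
  shows "base_change M \<subseteq> N"
  unfolding base_change_def by (rule smul_module.span_minimal) (use assms in auto)

lemma lin_ext_in_subspace:
  "smul_module.subspace N \<Longrightarrow> (\<And>i. i \<in> keys f \<Longrightarrow> g i \<in> N) \<Longrightarrow> lin_ext g f \<in> N"
  unfolding lin_ext_def by (intro smul_module.subspace_sum smul_module.subspace_scale)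

lemma base_changeI: "f \<in> M \<Longrightarrow> pm_map of_int f \<in> base_change M"
  unfolding base_change_def by (intro smul_module.span_base imageI)

lemma subspace_base_change: "smul_module.subspace (base_change M)"
  unfolding base_change_def by simp

lemma base_change_eqI:
  assumes "\<And>f. f \<in> M \<Longrightarrow> pm_map of_int f \<in> N" "smul_module.subspace N"
    and "\<And>f. f \<in> N \<Longrightarrow> f = lin_ext (\<lambda>i. pm_map of_int (g i)) f"
    and "\<And>f i. f \<in> N \<Longrightarrow> i \<in> keys f \<Longrightarrow> g i \<in> M"
  shows "base_change M = N"
proof
  show "base_change M \<subseteq> N" by (rule base_change_subset[OF assms(1,2)])
  show "N \<subseteq> base_change M"
  proof
    fix f assume f: "f \<in> N"
    have "lin_ext (\<lambda>i. pm_map of_int (g i)) f \<in> base_change M"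
      using assms(4)[OF f] by (intro lin_ext_in_subspace[OF subspace_base_change] base_changeI)
    then show "f \<in> base_change M" using assms(3)[OF f] by simp
  qed
qed

text \<open>By \<open>kappa_exact\<close> the integral cycles
  \<open>kappa (kappa_homotopy c)\<close> span the kernel over every commutative ring. The bidegree
  (0,0) is left out because the homotopy identity fails at its basis element; for \<open>eta\<close>
  the exception is the basis element \<open>(UNIV, 0)\<close>.\<close>

lemma base_change_Lmod:
  assumes ab: "a > 0 \<or> b > 0"
  shows "base_change (Lmod a b) = {f :: 'v::{finite,linorder} bas \<Rightarrow>\<^sub>0 'r::comm_ring_1. f \<in> bideg a b
      \<and> kappa f = 0}"
proof (rule base_change_eqI[where g = "\<lambda>c. kappa (kappa_homotopy c)"])
  show "f = lin_ext (\<lambda>c. pm_map of_int (kappa (kappa_homotopy c))) f"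
    if "f \<in> {f. f \<in> bideg a b \<and> kappa f = 0}" for f :: "'v bas \<Rightarrow>\<^sub>0 'r"
    using kappa_exact[of f a b] that ab by (simp add: of_int_kappa_homotopy flip: rhom.kappa_map[OF
        rhom_of_int])
  show "kappa (kappa_homotopy i) \<in> Lmod a b"
    if "f \<in> {f. f \<in> bideg a b \<and> kappa f = 0}" "i \<in> keys f" for f :: "'v bas \<Rightarrow>\<^sub>0 'r" and i
    using that ab by (cases i) (auto simp: bideg_def intro!: kappa_homotopy_in_Lmod)
qed (auto simp: Lmod_def rhom.bideg_map[OF rhom_of_int] rhom.kappa_map[OF rhom_of_int]
    smul_module.subspace_def bideg_add bideg_smul kappa_add kappa_smul map_eq_zero_iff)

lemma base_change_Kmod:
  assumes ab: "a < CARD('v) \<or> b > 0"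
  shows "base_change (Kmod a b) = {f :: 'v::{finite,linorder} bas \<Rightarrow>\<^sub>0 'r::comm_ring_1. f \<in> bideg a b \<and> eta f
      = 0}"
proof (rule base_change_eqI[where g = "\<lambda>c. eta (eta_homotopy c)"])
  show "f = lin_ext (\<lambda>c. pm_map of_int (eta (eta_homotopy c))) f"
    if "f \<in> {f. f \<in> bideg a b \<and> eta f = 0}" for f :: "'v bas \<Rightarrow>\<^sub>0 'r"
    using eta_exact[of f a b] that ab by (simp add: of_int_eta_homotopy flip: rhom.eta_map[OF rhom_of_int])
  show "eta (eta_homotopy i) \<in> Kmod a b"
    if "f \<in> {f. f \<in> bideg a b \<and> eta f = 0}" "i \<in> keys f" for f :: "'v bas \<Rightarrow>\<^sub>0 'r" and i
    using that by (cases i) (auto simp: bideg_def intro!: eta_homotopy_in_Kmod)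
qed (auto simp: Kmod_def rhom.bideg_map[OF rhom_of_int] rhom.eta_map[OF rhom_of_int]
    smul_module.subspace_def bideg_add bideg_smul eta_add eta_smul map_eq_zero_iff)

lemma base_change_bideg:
  "base_change (bideg a b) = (bideg a b :: ('v::{finite,linorder} bas \<Rightarrow>\<^sub>0 'r::comm_ring_1) set)"
proof (rule base_change_eqI[where g = "\<lambda>c. single c 1"])
  show "f = lin_ext (\<lambda>c. pm_map of_int (single c 1)) f" for f :: "'v bas \<Rightarrow>\<^sub>0 'r"
    by (simp add: lin_ext_id)
  show "single i 1 \<in> bideg a b" if "f \<in> bideg a b" "i \<in> keys f" for f :: "'v bas \<Rightarrow>\<^sub>0 'r" and i
    using that by (auto simp: bideg_def)
qed (auto simp: rhom.bideg_map[OF rhom_of_int] smul_module.subspace_def bideg_add bideg_smul)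

subsection \<open>Kernels of the Koszul differential\<close>

lemma lookup_wsign_mult [simp]: "lookup (wsign i J * p) \<alpha> = wsign i J * lookup p (\<alpha> :: 'v mon)"
  unfolding wsign_def by (cases "even (card {j \<in> J. j < i})") (simp_all add: uminus_poly_mapping.rep_eq)

lemma single_add_eq_single:
  "lookup (single i (1::nat) + single j 1) l > 0 \<longleftrightarrow> l = i \<or> l = j"
  by (auto simp: lookup_add lookup_single when_def)

lemma lookup_lookup_kos_linear:
  "lookup (lookup (kos u) (J, \<mu>)) (single i 1) =
    (if i \<in> J then 0 else wsign i J * lookup (lookup u (insert i J, \<mu>)) 0)"
proof -
  have "lookup (lookup (kos u) (J, \<mu>)) (single i 1) =
    (\<Sum>l\<in>-J. if l = i then wsign i J * lookup (lookup u (insert i J, \<mu>)) 0 else 0)"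
    unfolding lookup_kos lookup_sum
    by (intro sum.cong refl) (auto simp: lookup_var_mult lookup_single when_def)
  also have "\<dots> = (if i \<in> J then 0 else wsign i J * lookup (lookup u (insert i J, \<mu>)) 0)"
    by (simp add: sum.delta)
  finally show ?thesis .
qed

text \<open>x_i x_j arises as x_i times a term x_j or as x_j times a term x_i. For
  \<open>i = j\<close> these coincide, and the second summand drops out.\<close>

lemma lookup_lookup_kos_quadratic:
  "lookup (lookup (kos u) (J, \<mu>)) (single i 1 + single j 1) =
    (if i \<in> J then 0 else wsign i J * lookup (lookup u (insert i J, \<mu>)) (single j 1)) +
    (if j \<in> J \<or> i = j then 0 else wsign j J * lookup (lookup u (insert j J, \<mu>)) (single i 1))"
proof -
  have "lookup (lookup (kos u) (J, \<mu>)) (single i 1 + single j 1) =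
    (\<Sum>l\<in>-J. (if l = i then wsign i J * lookup (lookup u (insert i J, \<mu>)) (single j 1) else 0)
      + (if l = j then (if i = j then 0 else
          wsign j J * lookup (lookup u (insert j J, \<mu>)) (single i 1)) else 0))"
    unfolding lookup_kos lookup_sum lookup_wsign_mult lookup_var_mult single_add_eq_single
    by (intro sum.cong refl) (auto simp: add.commute simp del: One_nat_def)
  also have "\<dots> = (if i \<in> J then 0 else wsign i J * lookup (lookup u (insert i J, \<mu>)) (single j 1)) +
    (if j \<in> J \<or> i = j then 0 else wsign j J * lookup (lookup u (insert j J, \<mu>)) (single i 1))"
    unfolding sum.distrib by (simp add: sum.delta)
  finally show ?thesis .
qed

text \<open>Turns a two-term cycle relation into an equality with the signs taken in all of
  \<open>M\<close>; the signed entry then does not depend on which element of \<open>M\<close> is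
  removed. Multiplication by the product of both signs interchanges \<open>a\<close> and
  \<open>b\<close>.\<close>

lemma wsign_pair_iff:
  fixes a b :: "'r::comm_ring_1" and i j :: "'v::{finite,linorder}"
  assumes "i \<in> M" "j \<in> M" "i \<noteq> j"
  shows "wsign i (M - {i, j}) * a + wsign j (M - {i, j}) * b = 0 \<longleftrightarrow> wsign i M * b = wsign j M * a"
proof -
  have *: "wsign i M = (wsign i (insert j (M - {i, j})) :: 'r)" "wsign j M = (wsign j (insert i
      (M - {i, j})) :: 'r)"
  proof -
    have "insert j (M - {i, j}) = M - {i}" "insert i (M - {i, j}) = M - {j}" using assms by auto
    then show "wsign i M = (wsign i (insert j (M - {i, j})) :: 'r)"
      "wsign j M = (wsign j (insert i (M - {i, j})) :: 'r)" by simp_all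
  qed
  define s t where "s = (wsign i (M - {i, j}) :: 'r)" and "t = (wsign j (M - {i, j}) :: 'r)"
  have ss: "s * s = 1" "t * t = 1" by (simp_all add: s_def t_def)
  have eq: "s * a + t * b = 0 \<longleftrightarrow> s * b + t * a = 0"
  proof
    assume "s * a + t * b = 0"
    then have "(s * t) * (s * a + t * b) = 0" by simp
    moreover have "(s * t) * (s * a + t * b) = (s * s) * (t * a) + (t * t) * (s * b)" by
        (simp add: algebra_simps)
    ultimately show "s * b + t * a = 0" by (simp add: ss add.commute)
  next
    assume "s * b + t * a = 0"
    then have "(s * t) * (s * b + t * a) = 0" by simp
    moreover have "(s * t) * (s * b + t * a) = (s * s) * (t * b) + (t * t) * (s * a)" by
        (simp add: algebra_simps)
    ultimately show "s * a + t * b = 0" by (simp add: ss add.commute)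
  qed
  show ?thesis
  proof (cases "i < j")
    case True
    then show ?thesis unfolding * using eq
      by (simp add: wsign_insert_less wsign_insert_greater eq_neg_iff_add_eq_0 flip: s_def t_def)
  next
    case False
    then have "j < i" using assms by auto
    then show ?thesis unfolding * using eq
      by (simp add: wsign_insert_less wsign_insert_greater eq_neg_iff_add_eq_0 minus_equation_iff
          add.commute flip: s_def t_def)
        (metis add.inverse_inverse eq_neg_iff_add_eq_0 add.commute)
  qed
qed

text \<open>The quadratic coefficients of \<open>kos u = 0\<close> show that
  \<open>wsign i M\<close> times the coefficient of x_i at \<open>M - {i}\<close> is the same for
  every \<open>i\<close> in \<open>M\<close>. This common value is the coefficient of
  \<open>w\<close> at \<open>M\<close>; no averaging over \<open>i\<close>, hence no division, takes
  place.\<close>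

lemma kos_lift:
  fixes u :: "'v::{finite,linorder} bas \<Rightarrow>\<^sub>0 ('v, 'k::comm_ring_1) mpol"
  assumes u: "u \<in> bideg a b" "kos u = 0" and lin: "\<And>J \<mu>. homog 1 (lookup u (J, \<mu>))"
  obtains w where "w \<in> bideg (Suc a) b" "u = kos (pm_map const w)"
proof -
  define U where "U i J \<mu> = lookup (lookup u (J, \<mu>)) (single i 1)" for i J \<mu>
  \<comment> \<open>The coefficient of the square of x_j in \<open>kos u\<close> at
    \<open>J - {j}\<close>.\<close>
  have U_mem: "U j J \<mu> = 0" if "j \<in> J" for j J \<mu>
    using lookup_lookup_kos_quadratic[of u "J - {j}" \<mu> j j] that u(2)
    by (simp add: U_def insert_absorb)
  have U_pair: "wsign i M * U i (M - {i}) \<mu> = wsign j M * U j (M - {j}) \<mu>"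
    if "i \<in> M" "j \<in> M" for i j M \<mu>
  proof (cases "i = j")
    case False
    have "insert i (M - {i, j}) = M - {j}" "insert j (M - {i, j}) = M - {i}" using that False by auto
    then have "wsign i (M - {i, j}) * U j (M - {j}) \<mu> + wsign j (M - {i, j}) * U i (M - {i}) \<mu> = 0"
      using lookup_lookup_kos_quadratic[of u "M - {i, j}" \<mu> i j] False u(2) by (simp add: U_def)
    then show ?thesis using wsign_pair_iff[OF that False] by metis
  qed simp
  \<comment> \<open>Every element of \<open>M\<close> would give the same value, by
    \<open>U_pair\<close>; \<open>Min M\<close> is just a definite choice.\<close>
  define W where "W = (\<lambda>(M, \<mu>). if M = {} then 0 else wsign (Min M) M * U (Min M) (M - {Min M}) \<mu>)"
  have W_eq: "W (M, \<mu>) = wsign i M * U i (M - {i}) \<mu>" if "i \<in> M" for i M \<mu>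
    using U_pair[OF _ that, of "Min M" \<mu>] that Min_in[of M] by (auto simp: W_def)
  have W_supp: "card M = Suc a \<and> mdeg \<mu> = b" if nz: "W (M, \<mu>) \<noteq> 0" for M \<mu>
  proof -
    have "M \<noteq> {}" using nz by (cases "M = {}") (simp_all add: W_def)
    then obtain i where i: "i \<in> M" by blast
    have "U i (M - {i}) \<mu> \<noteq> 0" using nz unfolding W_eq[OF i] by auto
    then have "lookup u (M - {i}, \<mu>) \<noteq> 0" by (auto simp: U_def)
    from bidegD[OF u(1) this] show ?thesis using card_Suc_Diff1[of M i] i by simp
  qed
  have "finite {x. W x \<noteq> 0}"
  proof (rule finite_subset)
    show "{x. W x \<noteq> 0} \<subseteq> UNIV \<times> monomials b" using W_supp by (auto simp: monomials_def)
  qed (simp add: finite_monomials)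
  then have w: "lookup (Abs_poly_mapping W) = W" by simp
  let ?w = "Abs_poly_mapping W"
  have "?w \<in> bideg (Suc a) b" unfolding bideg_iff w using W_supp by blast
  moreover have "u = kos (pm_map const ?w)"
  proof (rule bas_eqI, rule poly_mapping_eqI)
    fix J \<mu> \<alpha>
    show "lookup (lookup u (J, \<mu>)) \<alpha> = lookup (lookup (kos (pm_map const ?w)) (J, \<mu>)) \<alpha>"
    proof (cases "mdeg \<alpha> = 1")
      case True
      then obtain i where i: "\<alpha> = single i 1" using mdeg_eq_1_D by blast
      show ?thesis
        using U_mem[of i J \<mu>] W_eq[of i "insert i J" \<mu>]
        unfolding i lookup_lookup_kos_linear rhom.lookup[OF rhom_const] w by (auto simp: U_def)
    next
      case False
      have "lookup (var i * const c) \<alpha> = 0" for i and c :: 'k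
      proof (cases "lookup \<alpha> i > 0")
        case True
        then show ?thesis using False mon_split[OF True] by (auto simp: lookup_var_mult simp del: One_nat_def)
      qed (simp add: lookup_var_mult)
      then show ?thesis using lin[of J \<mu>] False
        by (simp add: homog_iff lookup_kos lookup_sum rhom.lookup[OF rhom_const])
    qed
  qed
  ultimately show ?thesis by (rule that)
qed

text \<open>For \<open>i\<close> in \<open>J\<close>, the coefficient of x_i in \<open>kos u\<close>
  at \<open>J - {i}\<close> is this constant up to sign. Consequently the lifts of
  \<open>kos_lift\<close> are unique.\<close>

lemma kos_const_coeff:
  fixes u :: "'v::{finite,linorder} bas \<Rightarrow>\<^sub>0 ('v, 'k::comm_ring_1) mpol"
  assumes "u \<in> bideg (Suc a) b" "kos u = 0"
  shows "lookup (lookup u (J, \<mu>)) 0 = 0"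
proof (cases "lookup u (J, \<mu>) = 0")
  case False
  with bidegD[OF assms(1)] have "card J = Suc a" by blast
  then obtain i where i: "i \<in> J" by fastforce
  then show ?thesis
    using lookup_lookup_kos_linear[of u "J - {i}" \<mu> i] assms(2) by (simp add: insert_absorb)
qed simp

lemma kos_map_const_inj:
  fixes w :: "'v::{finite,linorder} bas \<Rightarrow>\<^sub>0 'k::comm_ring_1"
  assumes "w \<in> bideg (Suc a) b" "kos (pm_map const w) = (0 :: ('v, 'k) bpol)"
  shows "w = 0"
proof (rule bas_eqI)
  fix J \<mu>
  show "lookup w (J, \<mu>) = lookup 0 (J, \<mu>)"
    using kos_const_coeff[OF rhom.bideg_map[OF rhom_const assms(1)] assms(2), of J \<mu>]
    by (simp add: rhom.lookup[OF rhom_const])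
qed

section \<open>Koszul cycles of exterior degree d - 2\<close>

lemma ex_other: "CARD('v::finite) \<ge> 2 \<Longrightarrow> \<exists>j. j \<noteq> (i::'v)"
proof (rule ccontr)
  assume "CARD('v) \<ge> 2" "\<nexists>j. j \<noteq> i"
  then have "(UNIV :: 'v set) = {i}" by auto
  then have "CARD('v) = card {i}" by (rule arg_cong)
  with \<open>CARD('v) \<ge> 2\<close> show False by simp
qed

lemma card_Compl_singleton_D:
  assumes "card (J :: 'v::finite set) = CARD('v) - 1"
  shows "\<exists>i. J = UNIV - {i}"
proof -
  have "card (- J) = 1"
    using assms finite_UNIV_card_ge_0[where 'a = 'v] by (simp add: Compl_eq_Diff_UNIV card_Diff_subset)
  then obtain i where "- J = {i}" by (auto simp: card_1_singleton_iff)
  then show ?thesis by (metis Compl_eq_Diff_UNIV double_compl)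
qed

lemma Compl_remove_pair: "- (UNIV - {i, j}) = {i, j}"
  "insert i (UNIV - {i, j}) = UNIV - {j}" "insert j (UNIV - {i, j}) = UNIV - {i}" if "i \<noteq> j"
  using that by auto

text \<open>At \<open>UNIV - {i, j}\<close> only two summands remain. With v_i the coefficients at
  \<open>UNIV - {i}\<close>, signed by \<open>wsign i UNIV\<close>, a cycle satisfies x_j v_i = x_i
  v_j; the next two lemmas express \<open>eta\<close> and \<open>kappa\<close> in the same
  terms.\<close>

lemma kos_top:
  fixes u :: "'v::{finite,linorder} bas \<Rightarrow>\<^sub>0 ('v, 'k::comm_ring_1) mpol"
  assumes "kos u = 0" "i \<noteq> j"
  shows "var j * (wsign i UNIV * lookup u (UNIV - {i}, \<mu>)) = var i * (wsign j UNIV * lookup u (UNIV - {j}, \<mu>))"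
proof -
  have "wsign i (UNIV - {i, j}) * (var i * lookup u (UNIV - {j}, \<mu>)) +
     wsign j (UNIV - {i, j}) * (var j * lookup u (UNIV - {i}, \<mu>)) = lookup (kos u) (UNIV - {i, j}, \<mu>)"
    unfolding lookup_kos Compl_remove_pair[OF assms(2)]
    using assms(2) by (simp add: Compl_remove_pair[OF assms(2)])
  then show ?thesis using wsign_pair_iff[of i UNIV j "var i * lookup u (UNIV - {j}, \<mu>)" "var j * lookup u
      (UNIV - {i}, \<mu>)"] assms
    by (simp add: algebra_simps)
qed

lemma eta_top:
  fixes u :: "'v::{finite,linorder} bas \<Rightarrow>\<^sub>0 'r::comm_ring_1"
  assumes "eta u = 0" "i \<noteq> j"
  shows "wsign i UNIV * lookup u (UNIV - {i}, \<mu> + single j 1) =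
    wsign j UNIV * lookup u (UNIV - {j}, \<mu> + single i 1)"
proof -
  have "wsign i (UNIV - {i, j}) * lookup u (UNIV - {j}, \<mu> + single i 1) +
     wsign j (UNIV - {i, j}) * lookup u (UNIV - {i}, \<mu> + single j 1) = lookup (eta u) (UNIV - {i, j}, \<mu>)"
    unfolding lookup_eta Compl_remove_pair[OF assms(2)]
    using assms(2) by (simp add: Compl_remove_pair[OF assms(2)])
  then show ?thesis
    using wsign_pair_iff[of i UNIV j "lookup u (UNIV - {j}, \<mu> + single i 1)" "lookup u (UNIV - {i}, \<mu>
        + single j 1)"] assms
    by simp
qed

lemma kappa_top:
  fixes u :: "'v::{finite,linorder} bas \<Rightarrow>\<^sub>0 'r::comm_ring_1"
  assumes "kappa u = 0" "i \<noteq> j"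
  shows "wsign i UNIV * (if lookup \<mu> j > 0 then lookup u (UNIV - {i}, \<mu> - single j 1) else 0) =
    wsign j UNIV * (if lookup \<mu> i > 0 then lookup u (UNIV - {j}, \<mu> - single i 1) else 0)"
    (is "_ * ?a = _ * ?b")
proof -
  have "wsign i (UNIV - {i, j}) * ?b + wsign j (UNIV - {i, j}) * ?a = lookup (kappa u) (UNIV - {i, j}, \<mu>)"
    unfolding lookup_kappa Compl_remove_pair[OF assms(2)]
    using assms(2) by (simp add: Compl_remove_pair[OF assms(2)])
  then show ?thesis
    using wsign_pair_iff[of i UNIV j ?b ?a] assms by simp
qed

lemma var_mult_cancel: "var i * p = 0 \<Longrightarrow> p = 0" for p :: "('v, 'k::comm_ring_1) mpol"
proof (rule poly_mapping_eqI)
  fix \<alpha> assume "var i * p = 0"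
  then have "lookup (var i * p) (\<alpha> + single i 1) = 0" by simp
  then show "lookup p \<alpha> = lookup 0 \<alpha>" by (simp add: lookup_var_mult lookup_add lookup_single del: One_nat_def)
qed

lemma var_mult_inject: "var i * p = var i * q \<Longrightarrow> p = q" for p :: "('v, 'k::comm_ring_1) mpol"
  using var_mult_cancel[of i "p - q"] by (simp add: right_diff_distrib)

text \<open>Distinct variables are coprime: a monomial of \<open>p\<close> without x_i would yield
  one of x_j \<open>p\<close> without x_i.\<close>

lemma var_divides:
  fixes p :: "('v, 'k::comm_ring_1) mpol"
  assumes "var j * p = var i * r" "i \<noteq> j"
  shows "\<exists>q. p = var i * q"
proof
  define q where "q = Poly_Mapping.map_key (\<lambda>\<gamma>. \<gamma> + single i 1) p"
  have q: "lookup q \<gamma> = lookup p (\<gamma> + single i 1)" for \<gamma>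
    unfolding q_def by (subst map_key.rep_eq) (auto simp: inj_def)
  show "p = var i * q"
  proof (rule poly_mapping_eqI)
    fix \<alpha>
    have "lookup p \<alpha> = 0" if "lookup \<alpha> i = 0"
    proof -
      have "lookup p \<alpha> = lookup (var j * p) (\<alpha> + single j 1)"
        by (simp add: lookup_var_mult lookup_add lookup_single del: One_nat_def)
      also have "\<dots> = 0" unfolding assms(1) using that assms(2) by
          (simp add: lookup_var_mult lookup_add lookup_single)
      finally show ?thesis .
    qed
    then show "lookup p \<alpha> = lookup (var i * q) \<alpha>"
      by (simp add: lookup_var_mult q mon_split del: One_nat_def)
  qed
qed

text \<open>Induction on the exponent of x_i in mu. With e_i the exponent vector of x_i,
  \<open>kappa\<close> turns v_i at mu into v_j at mu - e_i + e_j, and \<open>kos\<close> trades the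
  index j back for i. The exponent of x_i is smaller there, so x_i v_i = 0.\<close>

lemma L_kernel_top:
  fixes u :: "'v::{finite,linorder} bas \<Rightarrow>\<^sub>0 ('v, 'k::comm_ring_1) mpol"
  assumes card: "CARD('v) \<ge> 2" and u: "u \<in> bideg (CARD('v) - 1) b" "kappa u = 0" "kos u = 0"
  shows "u = 0"
proof -
  define v where "v i \<mu> = wsign i UNIV * lookup u (UNIV - {i}, \<mu>)" for i \<mu>
  have v0: "v i \<mu> = 0" for i \<mu>
  proof -
    obtain j where ij: "i \<noteq> j" using ex_other[OF card, of i] by metis
    show ?thesis
    proof (induction "lookup \<mu> i" arbitrary: \<mu>)
      case 0
      have "v i \<mu> = 0" using kappa_top[OF u(2) ij, of "\<mu> + single j 1"] 0 ij
        by (simp add: v_def lookup_add lookup_single del: One_nat_def)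
      then show ?case .
    next
      case (Suc k)
      let ?\<nu> = "\<mu> - single i 1"
      have pos: "lookup \<mu> i > 0" using Suc(2) by simp
      have "lookup (?\<nu> + single j 1) i = k"
        using Suc(2) ij by (simp add: lookup_add lookup_minus lookup_single flip: Suc(2))
      then have IH: "v i (?\<nu> + single j 1) = 0" using Suc(1) by simp
      have "v i \<mu> = v j (?\<nu> + single j 1)"
      proof -
        have "\<mu> + single j 1 - single i 1 = ?\<nu> + single j 1"
          using pos ij by (auto intro!: poly_mapping_eqI simp: lookup_add lookup_minus lookup_single when_def)
        then show ?thesis
          using kappa_top[OF u(2) ij, of "\<mu> + single j 1"] Suc(2)[symmetric]
          by (simp add: v_def lookup_add lookup_single del: One_nat_def)
      qed
      then have "var i * v i \<mu> = var j * v i (?\<nu> + single j 1)"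
        using kos_top[OF u(3) ij] by (simp add: v_def)
      with IH show ?case using var_mult_cancel by simp
    qed
  qed
  show ?thesis
  proof (rule bas_eqI)
    fix J \<mu>
    show "lookup u (J, \<mu>) = lookup 0 (J, \<mu>)"
      using v0 bidegD[OF u(1), of J \<mu>] card_Compl_singleton_D[of J] by (auto simp: v_def)
  qed
qed

text \<open>The hypothesis says that \<open>q\<close> divided by the monomial of its index does not
  vary. By coprimality one variable splits off, its cofactor \<open>r\<close> does not depend on the
  variable chosen, and \<open>r\<close> satisfies the hypothesis again.\<close>

lemma monomial_multiple:
  fixes q :: "'v::{finite,linorder} mon \<Rightarrow> ('v, 'k::comm_ring_1) mpol"
  assumes card: "CARD('v) \<ge> 2"
    and q: "\<And>i j \<nu>. i \<noteq> j \<Longrightarrow>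
      var i * q (\<nu> + single j 1) = var j * q (\<nu> + single i 1)"
  shows "\<exists>p. \<forall>\<mu>. mdeg \<mu> = b \<longrightarrow> q \<mu> = monom \<mu> * p"
  using q
proof (induction b arbitrary: q)
  case 0
  then show ?case by (auto simp: mdeg_eq_0_iff)
next
  case (Suc b)
  obtain i0 :: 'v where True by auto
  obtain i1 where i1: "i1 \<noteq> i0" using ex_other[OF card] by blast
  have "\<exists>r. q (\<nu> + single i0 1) = var i0 * r" for \<nu>
    using var_divides[OF Suc(2)[OF i1]] i1 by auto
  then obtain r where r0: "q (\<nu> + single i0 1) = var i0 * r \<nu>" for \<nu> by metis
  have r: "q (\<nu> + single j 1) = var j * r \<nu>" for \<nu> j
  proof (cases "j = i0")
    case False
    then have "var i0 * q (\<nu> + single j 1) = var i0 * (var j * r \<nu>)"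
      using Suc(2)[of i0 j \<nu>] r0 by (simp add: ac_simps)
    then show ?thesis by (rule var_mult_inject)
  qed (simp add: r0 del: One_nat_def)
  have "var i * r (\<nu> + single j 1) = var j * r (\<nu> + single i 1)" for i j \<nu>
    using r[of "\<nu> + single j 1" i] r[of "\<nu> + single i 1" j]
    by (simp add: ac_simps)
  then obtain p where p: "\<And>\<mu>. mdeg \<mu> = b \<Longrightarrow> r \<mu> = monom \<mu> * p" using Suc(1)[of r] by blast
  show ?case
  proof (intro exI allI impI)
    fix \<mu> :: "'v mon" assume \<mu>: "mdeg \<mu> = Suc b"
    then obtain i where i: "lookup \<mu> i > 0" using mdeg_Suc_D by blast
    have "q \<mu> = var i * (monom (\<mu> - single i 1) * p)"
      using r[of "\<mu> - single i 1" i] p \<mu> mdeg_minus_single[OF i] mon_split[OF i] by simp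
    also have "\<dots> = monom \<mu> * p"
      using monom_add[of "\<mu> - single i 1" "single i 1", where 'b = 'k] mon_split[OF i]
      by (simp add: var_def ac_simps)
    finally show "q \<mu> = monom \<mu> * p" .
  qed
qed

definition top_syzygy :: "nat \<Rightarrow> ('v::{finite,linorder} bas \<Rightarrow>\<^sub>0 ('v, 'k::comm_ring_1) mpol)" where
  "top_syzygy n = (\<Sum>m\<in>monomials n. smul (monom m) (eta (single (UNIV, m) 1)))"

lemma K_top_single: "K_top n c (single (UNIV, 0) p) = smul (const c * p) (top_syzygy n)"
  by (simp add: K_top_def top_syzygy_def smul_smul mult.commute)

lemma lookup_top_syzygy:
  "lookup (top_syzygy n) (J, \<mu>) =
    (\<Sum>i\<in>-J. wsign i J * (if insert i J = UNIV \<and> Suc (mdeg \<mu>) = n then monom (\<mu> + single i 1) else 0))"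
proof -
  have "lookup (top_syzygy n) (J, \<mu>) = (\<Sum>m\<in>monomials n. \<Sum>i\<in>-J.
      if m = \<mu> + single i 1 then wsign i J * (if insert i J = UNIV then monom m else 0) else 0)"
    unfolding top_syzygy_def lookup_sum lookup_smul lookup_eta sum_distrib_left
    by (intro sum.cong refl) (auto simp: lookup_single when_def ac_simps simp del: One_nat_def)
  also have "\<dots> = (\<Sum>i\<in>-J. \<Sum>m\<in>monomials n.
      if m = \<mu> + single i 1 then wsign i J * (if insert i J = UNIV then monom m else 0) else 0)"
    by (rule sum.swap)
  also have "\<dots> = (\<Sum>i\<in>-J. wsign i J * (if insert i J = UNIV \<and> Suc (mdeg \<mu>) = n then monom (\<mu>
      + single i 1) else 0))"
    unfolding sum.delta[OF finite_monomials]
    by (intro sum.cong refl) (auto simp: monomials_def simp del: One_nat_def)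
  finally show ?thesis .
qed

lemma lookup_top_syzygy_top:
  "lookup (top_syzygy n) (UNIV - {i}, \<mu>) =
    (if Suc (mdeg \<mu>) = n then wsign i UNIV * (var i * monom \<mu>) else 0)"
proof -
  have "- (UNIV - {i}) = {i}" by auto
  then show ?thesis unfolding lookup_top_syzygy
    by (simp add: insert_absorb monom_add var_def mult.commute del: One_nat_def)
qed

lemma eta_sum: "eta (sum g S) = (\<Sum>m\<in>S. eta (g m))"
  by (simp add: eta_def lin_ext_sum)

lemma eta_top_syzygy: "eta (top_syzygy n) = 0"
  by (simp add: top_syzygy_def eta_sum eta_smul eta_eta)

lemma top_syzygy_bideg:
  "(top_syzygy (Suc b) :: 'v::{finite,linorder} bas \<Rightarrow>\<^sub>0 ('v, 'k::comm_ring_1) mpol) \<in> bideg (CARD('v) - 1) b"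
  unfolding bideg_iff
proof (intro allI impI)
  fix J :: "'v set" and \<mu> assume "lookup (top_syzygy (Suc b) :: ('v, 'k) bpol) (J, \<mu>) \<noteq> 0"
  then obtain i where "i \<notin> J" "insert i J = UNIV" "mdeg \<mu> = b"
    unfolding lookup_top_syzygy by (auto elim!: sum.not_neutral_contains_not_neutral split: if_splits)
  moreover from this have "J = UNIV - {i}" by auto
  ultimately show "card J = CARD('v) - 1 \<and> mdeg \<mu> = b" by (simp add: card_Diff_singleton)
qed

lemma kos_top_syzygy: "kos (top_syzygy (Suc b)) = 0"
proof -
  \<comment> \<open>\<open>eta\<close> of the sum over degree \<open>Suc b\<close> is also
    \<open>kos\<close> of the analogous sum over degree \<open>b\<close>, since the monomial of mu +
    e_i is x_i times that of mu. Then \<open>kos_kos\<close> applies.\<close>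
  define E :: "'a bas \<Rightarrow>\<^sub>0 ('a, 'b) mpol" where "E = (\<Sum>\<mu>\<in>monomials b. single (UNIV, \<mu>) (monom \<mu>))"
  have E: "lookup E (J, \<mu>) = (if J = UNIV \<and> mdeg \<mu> = b then monom \<mu> else 0)" for J \<mu>
  proof -
    have "lookup E (J, \<mu>) = (\<Sum>m\<in>monomials b. if m = \<mu> then (if J = UNIV then monom \<mu> else 0) else 0)"
      unfolding E_def lookup_sum by (intro sum.cong refl) (auto simp: lookup_single when_def)
    also have "\<dots> = (if J = UNIV \<and> mdeg \<mu> = b then monom \<mu> else 0)"
      unfolding sum.delta[OF finite_monomials] by (auto simp: monomials_def)
    finally show ?thesis .
  qed
  have "top_syzygy (Suc b) = kos E"
  proof (rule bas_eqI)
    fix J and \<mu> :: "'a mon"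
    show "lookup (top_syzygy (Suc b)) (J, \<mu>) = lookup (kos E) (J, \<mu>)"
      unfolding lookup_top_syzygy lookup_kos E
      by (intro sum.cong refl) (auto simp: monom_add var_def mult.commute simp del: One_nat_def)
  qed
  then show ?thesis by (simp add: kos_kos)
qed

text \<open>The Koszul relations give v_i = x_i q by coprimality. The \<open>eta\<close> relations
  are then the hypothesis of \<open>monomial_multiple\<close>, so v_i at mu is x_i times the
  monomial of mu times a fixed \<open>p\<close>.\<close>

lemma K_kernel_top:
  fixes u :: "'v::{finite,linorder} bas \<Rightarrow>\<^sub>0 ('v, 'k::comm_ring_1) mpol"
  assumes card: "CARD('v) \<ge> 2" and u: "u \<in> bideg (CARD('v) - 1) b" "eta u = 0" "kos u = 0"
  shows "\<exists>p. u = smul p (top_syzygy (Suc b))"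
proof -
  define v where "v i \<mu> = wsign i UNIV * lookup u (UNIV - {i}, \<mu>)" for i \<mu>
  have v_kos: "var j * v i \<mu> = var i * v j \<mu>" if "i \<noteq> j" for i j \<mu>
    using kos_top[OF u(3) that] by (simp add: v_def)
  have v_eta: "v i (\<mu> + single j 1) = v j (\<mu> + single i 1)" if "i \<noteq> j" for i j \<mu>
    using eta_top[OF u(2) that] by (simp add: v_def)
  obtain i0 :: 'v where True by auto
  obtain i1 where i1: "i1 \<noteq> i0" using ex_other[OF card] by blast
  have "\<exists>r. v i0 \<mu> = var i0 * r" for \<mu>
    using var_divides[OF v_kos[of i0 i1]] i1 by auto
  then obtain q where q0: "v i0 \<mu> = var i0 * q \<mu>" for \<mu> by metis
  have q: "v j \<mu> = var j * q \<mu>" for \<mu> j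
  proof (cases "j = i0")
    case False
    then have "var i0 * v j \<mu> = var i0 * (var j * q \<mu>)"
      using v_kos[of i0 j \<mu>] q0 by (simp add: ac_simps)
    then show ?thesis by (rule var_mult_inject)
  qed (simp add: q0)
  have "var i * q (\<nu> + single j 1) = var j * q (\<nu> + single i 1)" if "i \<noteq> j" for i j \<nu>
    using v_eta[OF that] by (simp add: q)
  then obtain p where p: "\<And>\<mu>. mdeg \<mu> = b \<Longrightarrow> q \<mu> = monom \<mu> * p" using monomial_multiple[OF card, of q] by blast
  have "u = smul p (top_syzygy (Suc b))"
  proof (rule bas_eqI)
    fix J \<mu>
    show "lookup u (J, \<mu>) = lookup (smul p (top_syzygy (Suc b))) (J, \<mu>)"
    proof (cases "card J = CARD('v) - 1 \<and> mdeg \<mu> = b")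
      case True
      then obtain i where J: "J = UNIV - {i}" using card_Compl_singleton_D by blast
      have "lookup u (J, \<mu>) = wsign i UNIV * v i \<mu>" by (simp add: v_def J)
      then show ?thesis using True p[of \<mu>] by (simp add: J lookup_top_syzygy_top q ac_simps)
    next
      case False
      then show ?thesis using bidegD[OF u(1), of J \<mu>] bidegD[OF bideg_smul[OF top_syzygy_bideg], of p b J \<mu>]
          by metis
    qed
  qed
  then show ?thesis by blast
qed

lemma smul_top_syzygy_eq_0:
  assumes "smul p (top_syzygy (Suc b) :: 'v::{finite,linorder} bas \<Rightarrow>\<^sub>0 ('v, 'k::comm_ring_1) mpol) = 0"
  shows "p = 0"
proof -
  obtain i :: 'v where True by auto
  \<comment> \<open>The coefficient of \<open>top_syzygy\<close> at this index is a monomial up to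
    sign, hence no zero divisor.\<close>
  define \<mu> where "\<mu> = single i b"
  have "lookup (smul p (top_syzygy (Suc b))) (UNIV - {i}, \<mu>) = 0" using assms by simp
  then have "monom (\<mu> + single i 1) * p = 0"
    by (simp add: lookup_top_syzygy_top \<mu>_def var_def ac_simps flip: monom_add)
      (metis mult.left_commute wsign_cancel)
  then have *: "lookup (monom (\<mu> + single i 1) * p) (\<mu> + single i 1 + \<alpha>) = 0" for \<alpha> by simp
  show ?thesis
    by (rule poly_mapping_eqI) (use * lookup_single_mult_add[of "\<mu>
        + single i 1" 1 p] in \<open>simp add: Defs.monom_def\<close>)
qed

lemma bideg_top_iff:
  "u \<in> bideg (CARD('v)) 0 \<longleftrightarrow> (\<exists>p. u = single (UNIV, 0) p)"
  for u :: "'v::{finite,linorder} bas \<Rightarrow>\<^sub>0 'r::comm_ring_1"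
proof
  assume u: "u \<in> bideg (CARD('v)) 0"
  have "u = single (UNIV, 0) (lookup u (UNIV, 0))"
  proof (rule bas_eqI)
    fix J :: "'v set" and \<mu>
    show "lookup u (J, \<mu>) = lookup (single (UNIV, 0) (lookup u (UNIV, 0))) (J, \<mu>)"
    proof (cases "J = UNIV \<and> \<mu> = 0")
      case False
      then have "\<not> (card J = CARD('v) \<and> mdeg \<mu> = 0)"
        by (auto simp: mdeg_eq_0_iff dest: card_eq_UNIV_imp_eq_UNIV[OF finite])
      then have "lookup u (J, \<mu>) = 0" using bidegD[OF u] by blast
      then show ?thesis using False by (auto simp: lookup_single when_def)
    qed simp
  qed
  then show "\<exists>p. u = single (UNIV, 0) p" ..
qed (auto simp: bideg_def split: if_splits)

lemma bideg_0_0_iff: "u \<in> bideg 0 0 \<longleftrightarrow> (\<exists>p. u = single ({}, 0) p)"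
  for u :: "'v::{finite,linorder} bas \<Rightarrow>\<^sub>0 'r::comm_ring_1"
proof
  assume u: "u \<in> bideg 0 0"
  have "u = single ({}, 0) (lookup u ({}, 0))"
  proof (rule bas_eqI)
    fix J :: "'v set" and \<mu>
    show "lookup u (J, \<mu>) = lookup (single ({}, 0) (lookup u ({}, 0))) (J, \<mu>)"
      using bidegD[OF u, of J \<mu>] by (cases "J = {} \<and> \<mu> = 0") (auto simp: lookup_single when_def mdeg_eq_0_iff)
  qed
  then show "\<exists>p. u = single ({}, 0) p" ..
qed (auto simp: bideg_def split: if_splits)

text \<open>The complement of \<open>UNIV - {i}\<close> is a singleton, so there \<open>eta\<close>
  only shifts a coefficient. Together with \<open>top_degree_kappa_inj\<close> this excludes
  non-zero linear cycles of the skeleton in degree d - 1.\<close>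

lemma top_degree_eta_inj:
  fixes w :: "'v::{finite,linorder} bas \<Rightarrow>\<^sub>0 'r::comm_ring_1"
  assumes "w \<in> bideg (CARD('v)) (Suc b)" "eta w = 0"
  shows "w = 0"
proof (rule bas_eqI)
  fix J \<mu>
  show "lookup w (J, \<mu>) = lookup 0 (J, \<mu>)"
  proof (cases "card J = CARD('v) \<and> mdeg \<mu> = Suc b")
    case True
    then have J: "J = UNIV" by (simp add: card_eq_UNIV_imp_eq_UNIV)
    obtain i where i: "lookup \<mu> i > 0" using True mdeg_Suc_D by blast
    have "- (UNIV - {i}) = {i}" by auto
    then have "lookup (eta w) (UNIV - {i}, \<mu> - single i 1) = wsign i UNIV * lookup w (UNIV, \<mu>)"
      unfolding lookup_eta using mon_split[OF i] by (simp add: insert_absorb)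
    then show ?thesis using assms(2) J by simp
  qed (use bidegD[OF assms(1), of J \<mu>] in auto)
qed

lemma top_degree_kappa_inj:
  fixes w :: "'v::{finite,linorder} bas \<Rightarrow>\<^sub>0 'r::comm_ring_1"
  assumes "w \<in> bideg (CARD('v)) b" "kappa w = 0"
  shows "w = 0"
proof (rule bas_eqI)
  fix J \<mu>
  show "lookup w (J, \<mu>) = lookup 0 (J, \<mu>)"
  proof (cases "card J = CARD('v)")
    case True
    then have J: "J = UNIV" by (simp add: card_eq_UNIV_imp_eq_UNIV)
    obtain i :: 'v where True by auto
    have "- (UNIV - {i}) = {i}" by auto
    then have "lookup (kappa w) (UNIV - {i}, \<mu> + single i 1) = wsign i UNIV * lookup w (UNIV, \<mu>)"
      unfolding lookup_kappa by (simp add: insert_absorb lookup_add lookup_single del: One_nat_def)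
    then show ?thesis using assms(2) J by simp
  qed (use bidegD[OF assms(1), of J \<mu>] in auto)
qed

text \<open>Supplies the linear cycles that force F to be linear up to degree d - 1.\<close>

lemma ex_Lmod_nonzero:
  assumes "a < CARD('v)" "b > 0"
  shows "\<exists>w :: 'v::{finite,linorder} bas \<Rightarrow>\<^sub>0 'k::comm_ring_1. w \<in> bideg a b \<and> kappa w = 0 \<and> w \<noteq> 0"
proof -
  obtain J :: "'v set" where J: "card J = Suc a"
    using assms(1) by (metis Suc_leI obtain_subset_with_card_n)
  then obtain i where i: "i \<in> J" by fastforce
  \<comment> \<open>A power of a single variable x_i with \<open>i\<close> in \<open>J\<close>: at
    \<open>(J - {i}, single i b)\<close> only the index \<open>i\<close> can contribute to
    \<open>kappa w0\<close>.\<close>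
  define w0 where "w0 = single (J, single i (b - 1)) (1::'k)"
  have "w0 \<in> bideg (Suc a) (b - 1)" by (simp add: w0_def bideg_def J)
  then have "kappa w0 \<in> bideg a b" using kappa_bideg[of w0 a "b - 1"] assms(2) by simp
  moreover have "kappa w0 \<noteq> 0"
  proof
    assume "kappa w0 = 0"
    then have "0 = lookup (kappa w0) (J - {i}, single i b)" by simp
    also have "\<dots> = (\<Sum>l\<in>-(J - {i}). if l = i then wsign i (J - {i}) else 0)"
      unfolding lookup_kappa w0_def
      by (intro sum.cong refl) (use assms(2) i in \<open>auto simp: lookup_single when_def single_diff[symmetric]
          insert_absorb\<close>)
    also have "\<dots> = wsign i J" using i by (simp add: sum.delta)
    finally show False using wsign_square[of i J, where 'a = 'k] by simp
  qed
  ultimately show ?thesis by (intro exI[of _ "kappa w0"]) (simp add: kappa_kappa)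
qed

subsection \<open>Systems of linear equations and the Leibniz determinant\<close>

text \<open>Conjugation with the enumeration \<open>e\<close> matches the permutations and keeps
  their signs. This gives access to the theory of matrices.\<close>

lemma leibniz_det_eq_det:
  assumes e: "bij_betw e {0..<N} M"
  shows "leibniz_det M a = det (mat N N (\<lambda>(i, j). a (e i) (e j)))"
proof -
  let ?A = "{0..<N}" and ?f = "inv_into {0..<N} e"
  have inj: "inj_on e ?A" and img: "e ` ?A = M" using e by (auto simp: bij_betw_def)
  have f: "bij_betw ?f M ?A" using e by (rule bij_betw_inv_into)
  have "leibniz_det M a = (\<Sum>p | p permutes ?A. of_int (sign p) * (\<Prod>i\<in>?A. a (e i) (e (p i))))"
    unfolding leibniz_det_def
  proof (rule sum.reindex_bij_witness[of _ "map_permutation ?A e" "map_permutation M ?f"])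
    fix \<pi> assume "\<pi> \<in> {\<pi>. \<pi> permutes M}"
    then have \<pi>: "\<pi> permutes M" by simp
    show inverse: "map_permutation ?A e (map_permutation M ?f \<pi>) = \<pi>"
      by (rule map_permutation_compose_inv[OF f \<pi>]) (use f_inv_into_f[of _ e ?A] img in auto)
    show p: "map_permutation M ?f \<pi> \<in> {p. p permutes ?A}"
      using map_permutation_permutes[OF f \<pi>] by simp
    let ?p = "map_permutation M ?f \<pi>"
    have "sign ?p = sign \<pi>"
      by (rule sign_map_permutation) (use f \<pi> in \<open>auto simp: bij_betw_def bij_betw_finite[OF e, symmetric]\<close>)
    moreover have "(\<Prod>m\<in>M. a m (\<pi> m)) = (\<Prod>i\<in>?A. a (e i) (\<pi> (e i)))"
      by (rule prod.reindex_bij_betw[OF e, symmetric])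
    moreover have "\<pi> (e i) = e (?p i)" if "i \<in> ?A" for i
      using map_permutation_apply[OF inj that, of ?p] inverse by simp
    ultimately show "of_int (sign ?p) * (\<Prod>i\<in>?A. a (e i) (e (?p i))) = of_int (sign \<pi>) * (\<Prod>m\<in>M. a m (\<pi> m))"
      by simp
  next
    fix p assume "p \<in> {p. p permutes ?A}"
    then have p: "p permutes ?A" by simp
    show "map_permutation M ?f (map_permutation ?A e p) = p"
      by (rule map_permutation_compose_inv[OF e p]) (simp add: inv_into_f_f[OF inj])
    show "map_permutation ?A e p \<in> {\<pi>. \<pi> permutes M}"
      using map_permutation_permutes[OF e p] by simp
  qed
  also have "\<dots> = det (mat N N (\<lambda>(i, j). a (e i) (e j)))"
    unfolding det_def by (auto intro!: sum.cong prod.cong simp: permutes_in_image)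
  finally show ?thesis .
qed

lemma leibniz_det_nonzero:
  fixes a :: "'i \<Rightarrow> 'i \<Rightarrow> 'k::field"
  assumes fin: "finite M"
    and ker: "\<And>v. (\<And>i. i \<in> M \<Longrightarrow> (\<Sum>j\<in>M. a i j * v j) = 0) \<Longrightarrow> (\<And>j. j \<in> M \<Longrightarrow> v j = 0)"
  shows "leibniz_det M a \<noteq> 0" and "\<exists>v. \<forall>i\<in>M. (\<Sum>j\<in>M. a i j * v j) = w i"
proof -
  obtain e where e: "bij_betw e {0..<card M} M" using ex_bij_betw_nat_finite[OF fin] by blast
  define N where "N = card M"
  define A where "A = mat N N (\<lambda>(i, j). a (e i) (e j))"
  let ?f = "inv_into {0..<N} e"
  have A: "A \<in> carrier_mat N N" by (simp add: A_def)
  have ef: "e (?f i) = i" "?f i < N" if "i \<in> M" for i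
    using that e bij_betw_inv_into[OF e] f_inv_into_f[of i e "{0..<N}"] by (auto simp: bij_betw_def N_def)
  have eM: "e i \<in> M" "?f (e i) = i" if "i < N" for i
    using that e by (auto simp: bij_betw_def N_def inv_into_f_f)
  have prod: "(A *\<^sub>v v) $ i = (\<Sum>j\<in>M. a (e i) j * v $ ?f j)" if "v \<in> carrier_vec N" "i < N" for v i
  proof -
    have "(A *\<^sub>v v) $ i = (\<Sum>j\<in>{0..<N}. a (e i) (e j) * v $ ?f (e j))"
      using that A by (simp add: A_def scalar_prod_def eM)
    also have "\<dots> = (\<Sum>j\<in>M. a (e i) j * v $ ?f j)"
      using sum.reindex_bij_betw[OF e, of "\<lambda>j. a (e i) j * v $ ?f j"] by (simp add: N_def)
    finally show ?thesis .
  qed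
  have det: "det A \<noteq> 0"
  proof
    assume "det A = 0"
    then obtain v where v: "v \<in> carrier_vec N" "v \<noteq> 0\<^sub>v N" "A *\<^sub>v v = 0\<^sub>v N"
      using det_0_iff_vec_prod_zero[OF A] by auto
    have "(\<Sum>j\<in>M. a i j * v $ ?f j) = 0" if "i \<in> M" for i
      using prod[OF v(1) ef(2)[OF that]] v(3) ef[OF that] by simp
    then have "v $ ?f j = 0" if "j \<in> M" for j using ker[of "\<lambda>j. v $ ?f j"] that by blast
    then have "v $ i = 0" if "i < N" for i using eM[OF that] by metis
    then have "v = 0\<^sub>v N" using v(1) by (intro eq_vecI) auto
    with v(2) show False ..
  qed
  then show "leibniz_det M a \<noteq> 0"
    using leibniz_det_eq_det[OF e, of a] by (simp add: A_def N_def)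
  obtain B where B: "B \<in> carrier_mat N N" "A * B = 1\<^sub>m N"
    using det_non_zero_imp_unit[OF A det, of undefined] by (auto simp: Units_def ring_mat_def)
  define v where "v = B *\<^sub>v vec N (\<lambda>i. w (e i))"
  have v: "v \<in> carrier_vec N" using B by (simp add: v_def)
  have "A *\<^sub>v v = vec N (\<lambda>i. w (e i))"
    using A B by (simp add: v_def flip: assoc_mult_mat_vec)
  then have "(\<Sum>j\<in>M. a i j * v $ ?f j) = w i" if "i \<in> M" for i
    using prod[OF v ef(2)[OF that]] ef[OF that] by simp
  then show "\<exists>v. \<forall>i\<in>M. (\<Sum>j\<in>M. a i j * v j) = w i"
    by (intro exI[of _ "\<lambda>j. v $ ?f j"]) simp
qed

subsection \<open>Macaulay inverse systems\<close>

text \<open>The component of \<open>p\<phi>\<close> in \<open>D\<^sub>0 = k\<close>.\<close>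

definition pairing :: "('w mon \<Rightarrow>\<^sub>0 'k::comm_ring_1) \<Rightarrow> ('w, 'k) mpol \<Rightarrow> 'k" where
  "pairing \<phi> p = lookup (lin_ext (\<lambda>\<alpha>. single () (lookup \<phi> \<alpha>)) p) ()"

lemma pairing_add: "pairing \<phi> (p + q) = pairing \<phi> p + pairing \<phi> q"
  by (simp add: pairing_def lin_ext_add lookup_add)

lemma pairing_0 [simp]: "pairing \<phi> 0 = 0"
  by (simp add: pairing_def)

lemma pairing_sum: "pairing \<phi> (sum g S) = (\<Sum>i\<in>S. pairing \<phi> (g i))"
  by (simp add: pairing_def lin_ext_sum lookup_sum)

lemma pairing_single [simp]: "pairing \<phi> (single \<alpha> c) = c * lookup \<phi> \<alpha>"
  by (simp add: pairing_def)

lemma const_mult_eq_smul: "const c * p = smul c p"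
  by (rule poly_mapping_eqI) simp

lemma pairing_const_mult: "pairing \<phi> (const c * p) = c * pairing \<phi> p"
  by (simp add: const_mult_eq_smul pairing_def lin_ext_smul)

lemma pairing_expand: "pairing \<phi> (q * p) = (\<Sum>\<alpha>\<in>keys p. lookup p \<alpha> * pairing \<phi> (q * monom \<alpha>))"
proof -
  have "q * p = (\<Sum>\<alpha>\<in>keys p. const (lookup p \<alpha>) * (q * monom \<alpha>))"
  proof -
    have "q * p = q * (\<Sum>\<alpha>\<in>keys p. const (lookup p \<alpha>) * monom \<alpha>)" by (simp only: mpol_expand[symmetric])
    then show ?thesis by (simp add: sum_distrib_left ac_simps)
  qed
  then show ?thesis by (simp add: pairing_sum pairing_const_mult)
qed

lemma pairing_mult_monom:
  "pairing \<phi> (p * monom \<beta>) = (\<Sum>\<alpha>\<in>keys p. lookup p \<alpha> * lookup \<phi> (\<alpha> + \<beta>))"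
  unfolding mult.commute[of p] pairing_expand[of \<phi> "monom \<beta>" p] monom_add[symmetric]
  by (simp add: Defs.monom_def add.commute)

text \<open>Contraction is adjoint to multiplication, so everything about \<open>contract\<close>
  reduces to the functional \<open>pairing\<close>.\<close>

lemma lookup_contract:
  fixes p :: "('w, 'k::comm_ring_1) mpol"
  shows "lookup (contract p \<phi>) \<beta> = pairing \<phi> (p * monom \<beta>)"
proof -
  have "lookup (lin_ext (\<lambda>\<gamma>. if mdvd \<alpha> \<gamma> then single (\<gamma> - \<alpha>) 1 else 0) \<phi>) \<beta> = lookup \<phi> (\<alpha> + \<beta>)" for \<alpha>
  proof -
    have "mdvd \<alpha> (\<alpha> + \<beta>)" "\<alpha> + \<beta> - \<alpha> = \<beta>" by (auto simp: mdvd_def lookup_add)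
    then have *: "mdvd \<alpha> \<gamma> \<and> \<gamma> - \<alpha> = \<beta> \<longleftrightarrow> \<gamma> = \<alpha> + \<beta>" for \<gamma>
      using mdvd_add_diff[of \<alpha> \<gamma>] by auto
    have "lookup (if mdvd \<alpha> \<gamma> then single (\<gamma> - \<alpha>) 1 else 0) \<beta> = (if \<gamma> = \<alpha> + \<beta> then 1 else (0::'k))" for \<gamma>
      using *[of \<gamma>] by (auto simp: lookup_single when_def)
    then have "lookup (lin_ext (\<lambda>\<gamma>. if mdvd \<alpha> \<gamma> then single (\<gamma> - \<alpha>) 1 else 0) \<phi>) \<beta>
      = (\<Sum>\<gamma>\<in>keys \<phi>. if \<gamma> = \<alpha> + \<beta> then lookup \<phi> \<gamma> else 0)"
      unfolding lookup_lin_ext by (intro sum.cong refl) simp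
    also have "\<dots> = lookup \<phi> (\<alpha> + \<beta>)" by (simp add: sum.delta in_keys_iff)
    finally show ?thesis .
  qed
  then show ?thesis by (simp add: contract_def lookup_sum pairing_mult_monom)
qed

lemma contract_eq_0_iff: "contract p \<phi> = 0 \<longleftrightarrow> (\<forall>\<beta>. pairing \<phi> (p * monom \<beta>) = 0)"
  by (auto simp: poly_mapping_eq_iff fun_eq_iff lookup_contract)

text \<open>\<open>nondegenerate\<close> says that I has no non-zero form of degree n - 1. As this
  is half the degree of phi, the pairing on forms of degree n - 1 becomes perfect.\<close>

locale inverse_system =
  fixes n :: nat and \<phi> :: "'v::{finite,linorder} option mon \<Rightarrow>\<^sub>0 'k::field"
  assumes n_ge_2: "n \<ge> 2"
    and phi_homog: "homog (int (2 * n - 2)) \<phi>"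
    and nondegenerate: "homog (int (n - 1)) p \<Longrightarrow> contract p \<phi> = 0 \<Longrightarrow> p = 0"
begin

definition ann :: "('v option, 'k) mpol set" where
  "ann = {p. contract p \<phi> = 0}"

lemma ann_iff_monom: "p \<in> ann \<longleftrightarrow> (\<forall>\<beta>. pairing \<phi> (p * monom \<beta>) = 0)"
  by (simp add: ann_def contract_eq_0_iff)

lemma ann_iff: "p \<in> ann \<longleftrightarrow> (\<forall>q. pairing \<phi> (p * q) = 0)"
  unfolding ann_iff_monom
proof (intro iffI allI)
  fix q assume "\<forall>\<beta>. pairing \<phi> (p * monom \<beta>) = 0"
  then show "pairing \<phi> (p * q) = 0" by (subst pairing_expand) simp
qed blast

lemma ann_mult_right: "p \<in> ann \<Longrightarrow> p * q \<in> ann"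
  by (simp add: ann_iff mult.assoc)

lemma pairing_degree:
  assumes "homog (int k) p" "k + mdeg \<beta> \<noteq> 2 * n - 2"
  shows "pairing \<phi> (p * monom \<beta>) = 0"
  unfolding pairing_mult_monom
proof (rule sum.neutral, rule ballI)
  fix \<alpha> assume "\<alpha> \<in> keys p"
  then have "mdeg \<alpha> = k" using assms(1) by (simp add: homog_def)
  then show "lookup p \<alpha> * lookup \<phi> (\<alpha> + \<beta>) = 0"
    using phi_homog assms(2) by (simp add: homog_iff)
qed

lemma ann_I:
  assumes "homog (int k) p" "k \<le> 2 * n - 2"
    and "\<And>\<beta>. mdeg \<beta> = 2 * n - 2 - k \<Longrightarrow> pairing \<phi> (p * monom \<beta>) = 0"
  shows "p \<in> ann"
  unfolding ann_iff_monom
proof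
  fix \<beta> show "pairing \<phi> (p * monom \<beta>) = 0"
    using assms(2,3) pairing_degree[OF assms(1), of \<beta>] by (cases "k + mdeg \<beta> = 2 * n - 2") auto
qed

lemma half_degree: "2 * n - 2 - (n - 1) = n - 1" "n - 1 \<le> 2 * n - 2" "2 * n - 2 - n = n - 2" "n \<le> 2 * n - 2"
  using n_ge_2 by auto

lemma pairing_monomial_sum:
  "pairing \<phi> ((\<Sum>j\<in>S. single j (v j)) * monom i) = (\<Sum>j\<in>S. lookup \<phi> (i + j) * v j)"
  unfolding sum_distrib_right pairing_sum Defs.monom_def mult_single pairing_single
  by (intro sum.cong refl) (simp add: ac_simps)

lemma homog_monomial_sum: "homog (int k) (\<Sum>j\<in>monomials k. single j (v j))"
  unfolding homog_iff lookup_sum by (auto simp: monomials_def lookup_single when_def intro!: sum.neutral)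

text \<open>A kernel vector, read as a form of degree n - 1, annihilates phi, because
  \<open>ann_I\<close> tests it only against monomials of the complementary degree, again n -
  1.\<close>

lemma hankel_kernel:
  assumes "\<And>i. i \<in> monomials (n - 1) \<Longrightarrow> (\<Sum>j\<in>monomials (n - 1). lookup \<phi> (i + j) * v j) = 0"
    and j: "j \<in> monomials (n - 1)"
  shows "v j = 0"
proof -
  define p where "p = (\<Sum>j\<in>monomials (n - 1). single j (v j))"
  have hom: "homog (int (n - 1)) p" unfolding p_def by (rule homog_monomial_sum)
  have "p \<in> ann"
    by (rule ann_I[OF hom]) (use assms(1) in \<open>auto simp: half_degree p_def pairing_monomial_sum monomials_def\<close>)
  then have "p = 0" using nondegenerate[OF hom] by (simp add: ann_def)
  then have "lookup p j = 0" by simp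
  moreover have "lookup p j = v j"
    unfolding p_def lookup_sum using j by (simp add: lookup_single when_def finite_monomials)
  ultimately show ?thesis by simp
qed

lemma macaulay_const_nonzero: "macaulay_const n \<phi> \<noteq> 0"
proof -
  have *: "lookup (contract (monom m * monom m') \<phi>) 0 = lookup \<phi> (m + m')" for m m'
    by (simp add: lookup_contract flip: monom_add) (simp add: Defs.monom_def)
  show ?thesis unfolding macaulay_const_def *
    by (rule leibniz_det_nonzero(1)[OF finite_monomials]) (rule hankel_kernel)
qed

lemma hankel_solve:
  obtains b where "homog (int (n - 1)) b" "\<And>\<beta>. mdeg \<beta> = n - 1 \<Longrightarrow> pairing \<phi> (b * monom \<beta>) = \<theta> \<beta>"
proof -
  obtain v where v: "\<forall>i\<in>monomials (n - 1). (\<Sum>j\<in>monomials (n - 1). lookup \<phi> (i + j) * v j) = \<theta> i"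
    using leibniz_det_nonzero(2)[OF finite_monomials, of "n - 1" "\<lambda>i j. lookup \<phi> (i + j)" \<theta>] hankel_kernel
    by blast
  show ?thesis
    by (rule that[OF homog_monomial_sum[of "n - 1" v]]) (use v in \<open>simp add: pairing_monomial_sum
        monomials_def\<close>)
qed

text \<open>For \<open>g = m + x\<^sub>1 b\<close> in the annihilator, with \<open>m\<close> free of \<open>x\<^sub>1\<close>, this is the
  restriction of \<open>b\<phi>\<close> to the divided powers in the remaining variables. The pairs
  \<open>(b\<phi>, m)\<close> split the first module of the reduced resolution.\<close>

definition tau :: "('v option, 'k) mpol \<Rightarrow> 'v mon \<Rightarrow> 'k" where
  "tau g \<beta> = pairing \<phi> (quot_x1 g * monom (emb \<beta>))"

lemma homog_quot_x1: "homog (int (Suc k)) g \<Longrightarrow> homog (int k) (quot_x1 g)"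
  by (simp add: homog_iff)

lemma homog_quot_x1_n: "homog (int n) g \<Longrightarrow> homog (int (n - 1)) (quot_x1 g)"
  using homog_quot_x1[of "n - 1" g] n_ge_2 by simp

lemma tau_degree: "homog (int n) g \<Longrightarrow> mdeg \<beta> \<noteq> n - 1 \<Longrightarrow> tau g \<beta> = 0"
  unfolding tau_def by (rule pairing_degree[OF homog_quot_x1_n]) (use n_ge_2 in auto)

lemma tau_add: "tau (f + g) \<beta> = tau f \<beta> + tau g \<beta>"
  by (simp add: tau_def quot_x1_add distrib_right pairing_add)

lemma tau_const_mult: "tau (const a * g) \<beta> = a * tau g \<beta>"
  by (simp add: tau_def quot_x1_const_mult mult.assoc pairing_const_mult)

lemma tau_0 [simp]: "tau 0 \<beta> = 0"
  by (simp add: tau_def)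

lemma tau_sum: "tau (sum f S) \<beta> = (\<Sum>i\<in>S. tau (f i) \<beta>)"
  by (induction S rule: infinite_finite_induct) (auto simp: tau_add)

lemma pairing_incl:
  "pairing \<phi> (incl p * quot_x1 g * monom (emb \<nu>)) = (\<Sum>\<alpha>\<in>keys p. lookup p \<alpha> * tau g (\<alpha> + \<nu>))"
proof -
  have incl: "incl p = (\<Sum>\<alpha>\<in>keys p. const (lookup p \<alpha>) * monom (emb \<alpha>))"
    by (simp add: incl_def const_monom)
  have "incl p * quot_x1 g * monom (emb \<nu>)
    = (\<Sum>\<alpha>\<in>keys p. const (lookup p \<alpha>) * (quot_x1 g * monom (emb (\<alpha> + \<nu>))))"
    unfolding incl sum_distrib_right by (intro sum.cong refl) (simp add: emb_add monom_add ac_simps)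
  then show ?thesis by (simp add: pairing_sum pairing_const_mult tau_def)
qed

text \<open>Monomials divisible by x_1 are tested through the product x_1 b, all others by the
  second hypothesis.\<close>

lemma ann_from_x1:
  assumes x1b: "var None * b \<in> ann" and b: "\<And>\<beta>. pairing \<phi> (b * monom (emb \<beta>)) = 0"
  shows "b \<in> ann"
  unfolding ann_iff_monom
proof
  fix \<gamma>
  show "pairing \<phi> (b * monom \<gamma>) = 0"
  proof (cases "lookup \<gamma> None > 0")
    case True
    then have "monom \<gamma> = monom (\<gamma> - single None 1) * (var None :: ('v option, 'k) mpol)"
      unfolding var_def by (metis mon_split monom_add)
    then have "b * monom \<gamma> = var None * b * monom (\<gamma> - single None 1)"
      by (simp add: ac_simps)
    then show ?thesis using x1b unfolding ann_iff by metis
  next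
    case False
    then have "emb (Poly_Mapping.map_key Some \<gamma>) = \<gamma>" by (simp add: emb_map_key)
    then show ?thesis using b[of "Poly_Mapping.map_key Some \<gamma>"] by simp
  qed
qed

text \<open>Without x_1-free part g is x_1 b, so \<open>ann_from_x1\<close> puts b into the
  annihilator, which is 0 in degree n - 1.\<close>

lemma tau_injective:
  assumes g: "g \<in> ann" "homog (int n) g" "mod_x1 g = 0" and tau: "\<And>\<beta>. mdeg \<beta> = n - 1 \<Longrightarrow> tau g \<beta> = 0"
  shows "g = 0"
proof -
  let ?b = "quot_x1 g"
  have gb: "g = var None * ?b" by (rule mod_x1_eq_0_D[OF g(3)])
  have hom: "homog (int (n - 1)) ?b" by (rule homog_quot_x1_n[OF g(2)])
  have "?b \<in> ann"
  proof (rule ann_from_x1)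
    show "var None * ?b \<in> ann" using g(1) gb by simp
    show "pairing \<phi> (?b * monom (emb \<beta>)) = 0" for \<beta>
      using tau[of \<beta>] tau_degree[OF g(2), of \<beta>] unfolding tau_def by blast
  qed
  then have "?b = 0" using nondegenerate[OF hom] by (simp add: ann_def)
  then show ?thesis using gb by simp
qed

lemma tau_surjective:
  fixes m :: "('v, 'k) mpol"
  assumes m: "homog (int n) m"
  obtains g where "g \<in> ann" "homog (int n) g" "mod_x1 g = m" "\<And>\<beta>. mdeg \<beta> = n - 1 \<Longrightarrow> tau g \<beta> = \<theta> \<beta>"
proof -
  \<comment> \<open>On monomials without x_1 the pairing is prescribed by \<open>\<theta>\<close>.
    On x_1 times a monomial it is forced: \<open>incl m + var None * b\<close> has to pair to 0 with
    that monomial.\<close>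
  obtain b where b: "homog (int (n - 1)) b" "\<And>\<gamma>. mdeg \<gamma> = n - 1 \<Longrightarrow> pairing \<phi> (b * monom \<gamma>) =
      (if lookup \<gamma> None = 0 then \<theta> (Poly_Mapping.map_key Some \<gamma>)
       else - pairing \<phi> (incl m * monom (\<gamma> - single None 1)))"
    using hankel_solve[of "\<lambda>\<gamma>. if lookup \<gamma> None = 0 then \<theta> (Poly_Mapping.map_key Some \<gamma>)
       else - pairing \<phi> (incl m * monom (\<gamma> - single None 1))"] by metis
  define g where "g = incl m + var None * b"
  have gm: "mod_x1 g = m"
    by (simp add: g_def rhom.add[OF rhom_mod_x1] rhom.mult[OF rhom_mod_x1])
  have gq: "quot_x1 g = b" by (simp add: g_def quot_x1_add)
  have hom: "homog (int n) g"
    unfolding homog_iff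
  proof (intro allI impI)
    fix \<alpha> :: "'v option mon" assume \<alpha>: "int (mdeg \<alpha>) \<noteq> int n"
    show "lookup g \<alpha> = 0"
    proof (cases "lookup \<alpha> None = 0")
      case True
      then have "mdeg (Poly_Mapping.map_key Some \<alpha>) = mdeg \<alpha>" by (metis emb_map_key mdeg_emb)
      then show ?thesis using m \<alpha> True by (simp add: g_def lookup_add lookup_incl lookup_var_mult homog_iff)
    next
      case False
      then have "mdeg (\<alpha> - single None 1) = mdeg \<alpha> - 1"
        by (intro mdeg_minus_single) simp
      then have "mdeg (\<alpha> - single None 1) \<noteq> n - 1" using \<alpha> n_ge_2 by linarith
      then show ?thesis using b(1) False
        by (simp add: g_def lookup_add lookup_incl lookup_var_mult homog_iff del: One_nat_def)
    qed
  qed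
  have "g \<in> ann"
  proof (rule ann_I[OF hom half_degree(4)])
    fix \<gamma> :: "'v option mon" assume "mdeg \<gamma> = 2 * n - 2 - n"
    then have \<gamma>: "mdeg (\<gamma> + single None 1) = n - 1" using n_ge_2 by simp
    have "pairing \<phi> (g * monom \<gamma>) = pairing \<phi> (incl m * monom \<gamma>) + pairing \<phi> (b * monom (\<gamma> + single None 1))"
      by (simp add: g_def monom_add var_def algebra_simps flip: pairing_add)
    also have "\<dots> = 0"
      unfolding b(2)[OF \<gamma>] by (simp add: lookup_add lookup_single del: One_nat_def)
    finally show "pairing \<phi> (g * monom \<gamma>) = 0" .
  qed
  moreover have "tau g \<beta> = \<theta> \<beta>" if "mdeg \<beta> = n - 1" for \<beta>
    using b(2)[of "emb \<beta>"] that by (simp add: tau_def gq)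
  ultimately show ?thesis using that hom gm by blast
qed

end

subsection \<open>Extending scalars from the ground field\<close>

text \<open>By the base change lemmas these are the modules of the skeleton over any ring. They
  occur both over the field and over the polynomial ring.\<close>

definition K_ker :: "nat \<Rightarrow> nat \<Rightarrow> ('v::{finite,linorder} bas \<Rightarrow>\<^sub>0 'r::comm_ring_1) set" where
  "K_ker a b = {f \<in> bideg a b. eta f = 0}"

definition L_ker :: "nat \<Rightarrow> nat \<Rightarrow> ('v::{finite,linorder} bas \<Rightarrow>\<^sub>0 'r::comm_ring_1) set" where
  "L_ker a b = {f \<in> bideg a b. kappa f = 0}"

lemma subspace_K_ker: "smul_module.subspace (K_ker a b)"
  by (auto simp: K_ker_def smul_module.subspace_def bideg_add bideg_smul eta_add eta_smul)

lemma subspace_L_ker: "smul_module.subspace (L_ker a b)"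
  by (auto simp: L_ker_def smul_module.subspace_def bideg_add bideg_smul kappa_add kappa_smul)

lemma (in rhom) map_0_eq: "pm_map h 0 = 0"
  by (rule poly_mapping_eqI) simp

lemma (in rhom) map_smul_diff: "pm_map h (f - smul a g) = pm_map h f - smul (h a) (pm_map h g)"
  by (rule poly_mapping_eqI) (simp add: lookup_minus diff mult)

lemma (in rhom) map_K_ker: "f \<in> K_ker a b \<Longrightarrow> pm_map h f \<in> K_ker a b"
  by (simp add: K_ker_def bideg_map eta_map map_0_eq)

lemma (in rhom) map_L_ker: "f \<in> L_ker a b \<Longrightarrow> pm_map h f \<in> L_ker a b"
  by (simp add: L_ker_def bideg_map kappa_map map_0_eq)

abbreviation cst :: "('i \<Rightarrow>\<^sub>0 'k::comm_ring_1) \<Rightarrow> ('i \<Rightarrow>\<^sub>0 ('v, 'k) mpol)" where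
  "cst \<equiv> pm_map const"

abbreviation const_term :: "('i \<Rightarrow>\<^sub>0 ('v, 'k::comm_ring_1) mpol) \<Rightarrow> ('i \<Rightarrow>\<^sub>0 'k)" where
  "const_term \<equiv> pm_map (\<lambda>p. lookup p 0)"

lemma const_term_cst: "const_term (cst y) = y"
  by (rule poly_mapping_eqI) (simp add: rhom.lookup[OF rhom_lookup_0] rhom.lookup[OF rhom_const])

lemma kos_K_ker: "u \<in> K_ker (Suc a) b \<Longrightarrow> kos u \<in> K_ker a b"
  by (simp add: K_ker_def kos_bideg eta_kos)

lemma kos_L_ker: "u \<in> L_ker (Suc a) b \<Longrightarrow> kos u \<in> L_ker a b"
  by (simp add: L_ker_def kos_bideg kappa_kos)

text \<open>A matrix of constants acting on vectors of polynomials. It acts on the coefficients of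
  each monomial separately, which reduces injectivity to the field.\<close>

definition ext_scalars :: "(nat \<Rightarrow> ('i \<Rightarrow>\<^sub>0 'k::comm_ring_1)) \<Rightarrow> (nat \<Rightarrow>\<^sub>0 ('v, 'k) mpol) \<Rightarrow> ('i \<Rightarrow>\<^sub>0
    ('v, 'k) mpol)" where
  "ext_scalars g = lin_ext (\<lambda>j. cst (g j))"

lemma ext_scalars_add: "ext_scalars g (u + v) = ext_scalars g u + ext_scalars g v"
  and ext_scalars_smul: "ext_scalars g (smul a u) = smul a (ext_scalars g u)"
  and ext_scalars_0 [simp]: "ext_scalars g 0 = 0"
  by (simp_all add: ext_scalars_def lin_ext_add lin_ext_smul)

lemma ext_scalars_cst: "ext_scalars g (cst y) = cst (lin_ext g y)"
  unfolding ext_scalars_def by (rule rhom.map_lin_ext[OF rhom_const, symmetric])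

lemma const_term_ext_scalars: "const_term (ext_scalars g v) = lin_ext g (const_term v)"
  unfolding ext_scalars_def rhom.map_lin_ext[OF rhom_lookup_0] const_term_cst ..

lemma lookup_mult_const: "lookup (p * const c) \<alpha> = lookup p \<alpha> * c"
  using lookup_const_mult[of c p \<alpha>] by (simp add: mult.commute)

lemma lookup_ext_scalars:
  "lookup (lookup (ext_scalars g v) b) \<alpha> = (\<Sum>j\<in>keys v. lookup (lookup v j) \<alpha> * lookup (g j) b)"
  by (simp add: ext_scalars_def lookup_lin_ext lookup_sum rhom.lookup[OF rhom_const] lookup_mult_const)

lemma keys_coeff_map: "keys (pm_map (\<lambda>p. lookup p \<alpha>) v) \<subseteq> keys v"
  by (auto simp: in_keys_iff lookup_pmap)

lemma coeff_ext_scalars: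
  "pm_map (\<lambda>p. lookup p \<alpha>) (ext_scalars g v) = lin_ext g (pm_map (\<lambda>p. lookup p \<alpha>) v)"
  by (rule poly_mapping_eqI)
    (simp add: lookup_pmap lookup_ext_scalars lookup_lin_ext_superset[OF finite_keys keys_coeff_map])

lemma free_mod_iff: "v \<in> free_mod b \<longleftrightarrow> (\<forall>i. lookup v i \<noteq> 0 \<longrightarrow> i < b)"
  by (auto simp: free_mod_def in_keys_iff)

lemma free_mod_0 [simp]: "0 \<in> free_mod b"
  by (simp add: free_mod_iff)

lemma free_mod_add: "u \<in> free_mod b \<Longrightarrow> v \<in> free_mod b \<Longrightarrow> u + v \<in> free_mod b"
  by (auto simp: free_mod_iff lookup_add) (metis add_0)

lemma free_mod_smul: "u \<in> free_mod b \<Longrightarrow> smul a u \<in> free_mod b"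
  unfolding free_mod_iff lookup_smul by (metis mult_zero_right)

lemma free_mod_diff: "u \<in> free_mod b \<Longrightarrow> v \<in> free_mod b \<Longrightarrow> u - v \<in> free_mod b"
  by (auto simp: free_mod_iff lookup_minus) (metis diff_zero)

lemma subspace_free_mod: "smul_module.subspace (free_mod b)"
  by (simp add: smul_module.subspace_def free_mod_add free_mod_smul)

lemma free_mod_map: "h 0 = 0 \<Longrightarrow> v \<in> free_mod b \<Longrightarrow> pm_map h v \<in> free_mod b"
  unfolding free_mod_iff by (metis lookup_pmap)

lemma (in rhom) map_free_mod: "v \<in> free_mod b \<Longrightarrow> pm_map h v \<in> free_mod b"
  by (rule free_mod_map) simp

lemma free_mod_lin_ext: "v \<in> free_mod a \<Longrightarrow> (\<And>j. j < a \<Longrightarrow> g j \<in> free_mod b) \<Longrightarrow> lin_ext g v \<in> free_mod b"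
  by (rule lin_ext_in_subspace[OF subspace_free_mod]) (auto simp: free_mod_def)

lemma free_mod_single: "j < b \<Longrightarrow> single j a \<in> free_mod b"
  by (auto simp: free_mod_iff lookup_single when_def)

lemma free_mod_zero_rank: "v \<in> free_mod 0 \<longleftrightarrow> v = 0"
  by (auto simp: free_mod_iff poly_mapping_eq_iff fun_eq_iff)

lemma low_degree_mult:
  fixes p q :: "('v::finite, 'k::comm_ring_1) mpol"
  assumes "\<And>\<beta>. mdeg \<beta> \<le> k \<Longrightarrow> lookup q \<beta> = 0" "mdeg \<alpha> \<le> k"
  shows "lookup (p * q) \<alpha> = 0"
proof -
  have "p * q = (\<Sum>\<beta>\<in>keys p. const (lookup p \<beta>) * (monom \<beta> * q))"
  proof -
    have "p * q = (\<Sum>\<beta>\<in>keys p. const (lookup p \<beta>) * monom \<beta>) * q" by (simp only: mpol_expand[symmetric])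
    then show ?thesis by (simp add: sum_distrib_right mult.assoc)
  qed
  moreover have "lookup (monom \<beta> * q) \<alpha> = 0" for \<beta>
  proof (cases "mdvd \<beta> \<alpha>")
    case True
    then have "mdeg (\<alpha> - \<beta>) \<le> k" using assms(2) mdvd_add_diff[OF True] mdeg_add[of \<beta> "\<alpha> - \<beta>"] by simp
    then show ?thesis using assms(1) by (simp add: lookup_monom_mult)
  qed (simp add: lookup_monom_mult)
  ultimately show ?thesis by (simp add: lookup_sum)
qed

lemma lookup_mult_homog:
  fixes p q :: "('v::finite, 'k::comm_ring_1) mpol"
  assumes q: "homog (int k) q" and \<alpha>: "mdeg \<alpha> = k"
  shows "lookup (p * q) \<alpha> = lookup p 0 * lookup q \<alpha>"
proof -
  have "lookup ((p - const (lookup p 0)) * q) \<alpha> = 0"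
  proof -
    have "lookup (q * (p - const (lookup p 0))) \<alpha> = (\<Sum>\<beta>\<in>keys q. lookup q \<beta> * lookup (monom \<beta> * (p - const
        (lookup p 0))) \<alpha>)"
    proof -
      have "q * (p - const (lookup p 0)) = (\<Sum>\<beta>\<in>keys q. const (lookup q \<beta>) * monom \<beta>) * (p - const (lookup p 0))"
        by (simp only: mpol_expand[symmetric])
      then show ?thesis by (simp add: sum_distrib_right mult.assoc lookup_sum)
    qed
    also have "\<dots> = 0"
    proof (intro sum.neutral ballI)
      fix \<beta> assume "\<beta> \<in> keys q"
      then have "mdeg \<beta> = k" using q by (simp add: homog_def)
      then have "\<alpha> - \<beta> = 0" if "mdvd \<beta> \<alpha>"
        using mdvd_add_diff[OF that] mdeg_add[of \<beta> "\<alpha> - \<beta>"] \<alpha> by (simp add: mdeg_eq_0_iff)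
      then show "lookup q \<beta> * lookup (monom \<beta> * (p - const (lookup p 0))) \<alpha> = 0"
        by (simp add: lookup_monom_mult lookup_minus)
    qed
    finally show ?thesis by (simp add: mult.commute)
  qed
  then show ?thesis by (simp add: left_diff_distrib lookup_minus)
qed

lemma lookup_monomial_vector:
  "lookup (\<Sum>\<beta>\<in>monomials k. single ({}, \<beta>) (f \<beta>)) (J, \<mu>) = (if J = {} \<and> mdeg \<mu> = k then f \<mu> else 0)"
proof -
  have "lookup (\<Sum>\<beta>\<in>monomials k. single ({}, \<beta>) (f \<beta>)) (J, \<mu>)
      = (\<Sum>\<beta>\<in>monomials k. if \<beta> = \<mu> then (if J = {} then f \<mu> else 0) else 0)"
    unfolding lookup_sum by (intro sum.cong refl) (auto simp: lookup_single when_def)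
  also have "\<dots> = (if J = {} \<and> mdeg \<mu> = k then f \<mu> else 0)"
    unfolding sum.delta[OF finite_monomials] by (auto simp: monomials_def)
  finally show ?thesis .
qed

lemma single_sum: "single i (sum f S) = (\<Sum>j\<in>S. single i (f j))"
  by (induction S rule: infinite_finite_induct) (auto simp: single_add)

lemma L_bot_bideg:
  assumes "u \<in> bideg 0 b"
  shows "L_bot c u = single ({}, 0)
    (\<Sum>\<mu>\<in>monomials b. lookup u ({}, \<mu>) * (const c * monom \<mu>))"
proof -
  have "keys u \<subseteq> Pair {} ` monomials b" using assms by (auto simp: bideg_def monomials_def)
  then have "L_bot c u = (\<Sum>x\<in>Pair {} ` monomials b. smul (lookup u x)
      (case x of (J, \<mu>) \<Rightarrow> single ({}, 0) (const c * monom \<mu>)))"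
    unfolding L_bot_def by (intro lin_ext_superset) (simp_all add: finite_monomials)
  also have "\<dots> = (\<Sum>\<mu>\<in>monomials b. single ({}, 0) (lookup u ({}, \<mu>) * (const c * monom \<mu>)))"
    by (subst sum.reindex) (auto simp: inj_on_def)
  also have "\<dots> = single ({}, 0) (\<Sum>\<mu>\<in>monomials b. lookup u ({}, \<mu>) * (const c * monom \<mu>))"
    by (rule single_sum[symmetric])
  finally show ?thesis .
qed

lemma lookup_var_const: "lookup (var i * const x) \<alpha> = (if \<alpha> = single i 1 then x else 0)"
  by (auto simp add: var_def mult.commute[of _ "const x"] const_monom lookup_single when_def)

lemma lookup_kos_cst:
  "lookup (lookup (kos (cst w)) (J, \<mu>)) \<alpha> =
    (\<Sum>i\<in>-J. wsign i J * (if \<alpha> = single i 1 then lookup w (insert i J, \<mu>) else 0))"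
  unfolding lookup_kos lookup_sum lookup_wsign_mult rhom.lookup[OF rhom_const] lookup_var_const ..

lemma wsign_empty [simp]: "wsign i {} = 1"
  by (simp add: wsign_def)

lemma bideg_0_insert: "u \<in> bideg 0 b \<Longrightarrow> lookup u (insert i J, \<mu>) = 0"
  for u :: "'v::{finite,linorder} bas \<Rightarrow>\<^sub>0 'r::comm_ring_1"
  using bidegD[of u 0 b "insert i J" \<mu>] by auto

lemma kos_bideg_0: "u \<in> bideg 0 b \<Longrightarrow> kos u = 0"
  by (rule bas_eqI) (simp add: lookup_kos bideg_0_insert)

lemma K_ker_0: "K_ker 0 b = (bideg 0 b :: ('v::{finite,linorder} bas \<Rightarrow>\<^sub>0 'r::comm_ring_1) set)"
proof -
  have "eta u = 0" if "u \<in> bideg 0 b" for u :: "'v bas \<Rightarrow>\<^sub>0 'r"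
    by (rule bas_eqI) (simp add: lookup_eta bideg_0_insert[OF that])
  then show ?thesis by (auto simp: K_ker_def)
qed

lemma L_ker_0: "L_ker 0 b = (bideg 0 b :: ('v::{finite,linorder} bas \<Rightarrow>\<^sub>0 'r::comm_ring_1) set)"
proof -
  have "kappa u = 0" if "u \<in> bideg 0 b" for u :: "'v bas \<Rightarrow>\<^sub>0 'r"
    by (rule bas_eqI, unfold lookup_kappa bideg_0_insert[OF that]) simp
  then show ?thesis by (auto simp: L_ker_def)
qed

text \<open>\<open>L_bot\<close> multiplies a form by its coefficient. On the Koszul image of
  constants the product has the coefficients of \<open>kappa w\<close>, so the linear syzygies of
  the monomials of degree \<open>b\<close> form the kernel of \<open>kappa\<close>.\<close>

lemma L_bot_kos:
  fixes w :: "'v::{finite,linorder} bas \<Rightarrow>\<^sub>0 'k::comm_ring_1"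
  assumes "w \<in> bideg 1 b"
  shows "lookup (lookup (L_bot c (kos (cst w))) ({}, 0)) \<mu> = c * lookup (kappa w) ({}, \<mu>)"
proof -
  let ?u = "kos (cst w) :: ('v, 'k) bpol"
  have u: "?u \<in> bideg 0 b"
    using kos_bideg[of "cst w" 0 b] rhom.bideg_map[OF rhom_const assms] by simp
  have "lookup (lookup (L_bot c ?u) ({}, 0)) \<mu> =
      (\<Sum>\<nu>\<in>monomials b. c * lookup (monom \<nu> * lookup ?u ({}, \<nu>)) \<mu>)"
    unfolding L_bot_bideg[OF u] by (simp add: lookup_sum ac_simps flip: lookup_const_mult)
  also have "\<dots> = (\<Sum>\<nu>\<in>monomials b. \<Sum>i\<in>UNIV. if \<mu> = \<nu> + single i 1 then c * lookup w ({i}, \<nu>) else 0)"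
  proof (intro sum.cong refl)
    fix \<nu> :: "'v mon"
    have "lookup (monom \<nu> * lookup ?u ({}, \<nu>)) \<mu> = (\<Sum>i\<in>UNIV. if \<mu> = \<nu> + single i 1 then lookup w
        ({i}, \<nu>) else 0)"
    proof (cases "mdvd \<nu> \<mu>")
      case True
      then show ?thesis unfolding lookup_monom_mult lookup_kos_cst
        using mdvd_add_diff[OF True] by (auto intro!: sum.cong)
    next
      case False
      then have "\<mu> \<noteq> \<nu> + single i 1" for i by (auto simp: mdvd_def lookup_add)
      then show ?thesis unfolding lookup_monom_mult using False by (simp del: One_nat_def)
    qed
    then show "c * lookup (monom \<nu> * lookup ?u ({}, \<nu>)) \<mu> = (\<Sum>i\<in>UNIV. if \<mu> = \<nu>
        + single i 1 then c * lookup w ({i}, \<nu>) else 0)"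
      by (simp add: sum_distrib_left if_distrib cong: if_cong)
  qed
  also have "\<dots> = (\<Sum>i\<in>UNIV. \<Sum>\<nu>\<in>monomials b. if \<mu> = \<nu> + single i 1 then c * lookup w ({i}, \<nu>) else 0)"
    by (rule sum.swap)
  also have "\<dots> = (\<Sum>i\<in>UNIV. c * (if lookup \<mu> i > 0 then lookup w ({i}, \<mu> - single i 1) else 0))"
  proof (intro sum.cong refl)
    fix i
    have "(\<Sum>\<nu>\<in>monomials b. if \<mu> = \<nu> + single i 1 then c * lookup w ({i}, \<nu>) else 0)
      = (\<Sum>\<nu>\<in>monomials b. if \<nu> = \<mu> - single i 1 then
          c * (if lookup \<mu> i > 0 then lookup w ({i}, \<mu> - single i 1) else 0) else 0)"
      by (intro sum.cong refl) (auto simp: lookup_add mon_split simp del: One_nat_def)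
    also have "\<dots> = c * (if lookup \<mu> i > 0 then lookup w ({i}, \<mu> - single i 1) else 0)"
    proof -
      have "lookup w ({i}, \<mu> - single i 1) = 0" if "mdeg (\<mu> - single i 1) \<noteq> b"
        using bidegD[OF assms] that by blast
      then show ?thesis unfolding sum.delta[OF finite_monomials] by (simp add: monomials_def del: One_nat_def)
    qed
    finally show "(\<Sum>\<nu>\<in>monomials b. if \<mu> = \<nu> + single i 1 then c * lookup w ({i}, \<nu>) else 0)
      = c * (if lookup \<mu> i > 0 then lookup w ({i}, \<mu> - single i 1) else 0)" .
  qed
  also have "\<dots> = c * lookup (kappa w) ({}, \<mu>)"
    unfolding lookup_kappa by (simp add: sum_distrib_left)
  finally show ?thesis .
qed

text \<open>The counterpart of \<open>L_bot_kos\<close> for divided powers: the left side contracts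
  each divided power by its polynomial coefficient. \<open>S\<close> may be larger than the set of
  variables, to fit \<open>sum_ext_scalars_g1\<close>.\<close>

lemma sum_kos_eta:
  assumes "finite S" "\<And>i. single i 1 \<in> S"
  shows "(\<Sum>\<alpha>\<in>S. lookup (lookup (kos (cst w)) ({}, \<alpha> + \<nu>)) \<alpha>) = lookup (eta w) ({}, \<nu>)"
proof -
  have "(\<Sum>\<alpha>\<in>S. lookup (lookup (kos (cst w)) ({}, \<alpha> + \<nu>)) \<alpha>)
    = (\<Sum>\<alpha>\<in>S. \<Sum>i\<in>UNIV. if \<alpha> = single i 1 then lookup w ({i}, \<alpha> + \<nu>) else 0)"
    unfolding lookup_kos_cst by (simp add: if_distrib cong: if_cong del: One_nat_def)
  also have "\<dots> = (\<Sum>i\<in>UNIV. \<Sum>\<alpha>\<in>S. if \<alpha> = single i 1 then lookup w ({i}, \<alpha> + \<nu>) else 0)"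
    by (rule sum.swap)
  also have "\<dots> = lookup (eta w) ({}, \<nu>)"
    unfolding sum.delta[OF assms(1)] lookup_eta using assms(2) by (simp add: add.commute)
  finally show ?thesis .
qed

subsection \<open>The reduction of a Gorenstein-linear resolution\<close>

lemma fdiff_smul: "fdiff F r (smul a u) = smul a (fdiff F r u)"
  and fdiff_diff: "fdiff F r (u - v) = fdiff F r u - fdiff F r v"
  and fdiff_0 [simp]: "fdiff F r 0 = 0"
  by (simp_all add: fdiff_def lin_ext_smul lin_ext_minus)

lemma minimal_const_term:
  assumes "minimal_complex F" "r \<ge> 1" "v \<in> free_mod (rank F r)"
  shows "lookup (lookup (fdiff F r v) i) 0 = 0"
proof -
  have "lookup (lookup (fdiff F r v) i) 0 = (\<Sum>j\<in>keys v. lookup (lookup v j) 0 * lookup (lookup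
      (dcol F r j) i) 0)"
    by (simp add: fdiff_def lookup_lin_ext lookup_sum rhom.mult[OF rhom_lookup_0])
  also have "\<dots> = 0"
    using assms by (intro sum.neutral) (auto simp: minimal_complex_def free_mod_def)
  finally show ?thesis .
qed

text \<open>What remains of the algebra is its ideal \<open>ann\<close>: by \<open>rank_0\<close>,
  \<open>image_1\<close> and \<open>exact\<close>, F resolves the quotient of S by it.\<close>

locale gorenstein_resolution = inverse_system n \<phi>
  for n and \<phi> :: "'v::{finite,linorder} option mon \<Rightarrow>\<^sub>0 'k::field" +
  fixes F :: "('v option, 'k) mpol free_complex"
  assumes card_ge_2: "CARD('v) \<ge> 2"
    and ann_least: "m < n \<Longrightarrow> p \<in> ann \<Longrightarrow> homog (int m) p \<Longrightarrow> p = 0"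
    and ann_nonzero: "\<exists>p\<in>ann. homog (int n) p \<and> p \<noteq> 0"
    and rank_0: "rank F 0 = 1" and twist_0: "twists F 0 ! 0 = 0"
    and complex: "homogeneous_complex F"
    and minimal: "minimal_complex F"
    and image_1: "{v \<in> free_mod 1. lookup v 0 \<in> ann} = fdiff F 1 ` free_mod (rank F 1)"
    and exact: "r \<ge> 1 \<Longrightarrow> {v \<in> free_mod (rank F r). fdiff F r v = 0} = fdiff F (Suc r) ` free_mod (rank F
        (Suc r))"
    and gor_linear: "gorenstein_linear F"
begin

abbreviation "FM r \<equiv> free_mod (rank F r)"

definition rcol :: "nat \<Rightarrow> nat \<Rightarrow> (nat \<Rightarrow>\<^sub>0 ('v, 'k) mpol)" where
  "rcol r j = pm_map mod_x1 (dcol F r j)"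

definition rdiff :: "nat \<Rightarrow> (nat \<Rightarrow>\<^sub>0 ('v, 'k) mpol) \<Rightarrow> (nat \<Rightarrow>\<^sub>0 ('v, 'k) mpol)" where
  "rdiff r = lin_ext (rcol r)"

lemma rdiff_add: "rdiff r (u + v) = rdiff r u + rdiff r v"
  and rdiff_smul: "rdiff r (smul a u) = smul a (rdiff r u)"
  and rdiff_0 [simp]: "rdiff r 0 = 0"
  by (simp_all add: rdiff_def lin_ext_add lin_ext_smul)

lemma lookup_rcol: "lookup (rcol r j) i = mod_x1 (lookup (dcol F r j) i)"
  by (simp add: rcol_def rhom.lookup[OF rhom_mod_x1])

lemma map_fdiff: "pm_map mod_x1 (fdiff F r v) = rdiff r (pm_map mod_x1 v)"
  by (simp add: fdiff_def rdiff_def rcol_def[abs_def] rhom.map_lin_ext[OF rhom_mod_x1])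

lemma map_mod_incl: "pm_map mod_x1 (pm_map incl v) = v"
  by (rule poly_mapping_eqI) (simp add: rhom.lookup[OF rhom_mod_x1] rhom.lookup[OF rhom_incl])

lemma dcol_free: "r \<ge> 1 \<Longrightarrow> j < rank F r \<Longrightarrow> dcol F r j \<in> FM (r - 1)"
  using complex by (simp add: homogeneous_complex_def)

lemma dcol_homog:
  "r \<ge> 1 \<Longrightarrow> j < rank F r \<Longrightarrow> i < rank F (r - 1) \<Longrightarrow>
    homog (twists F r ! j - twists F (r - 1) ! i) (lookup (dcol F r j) i)"
  using complex by (simp add: homogeneous_complex_def)

lemma rcol_free: "r \<ge> 1 \<Longrightarrow> j < rank F r \<Longrightarrow> rcol r j \<in> FM (r - 1)"
  unfolding rcol_def by (rule rhom.map_free_mod[OF rhom_mod_x1 dcol_free])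

lemma rcol_homog:
  "r \<ge> 1 \<Longrightarrow> j < rank F r \<Longrightarrow> i < rank F (r - 1) \<Longrightarrow>
    homog (twists F r ! j - twists F (r - 1) ! i) (lookup (rcol r j) i)"
  using dcol_homog by (simp add: homog_iff lookup_rcol)

lemma fdiff_free: "r \<ge> 1 \<Longrightarrow> v \<in> FM r \<Longrightarrow> fdiff F r v \<in> FM (r - 1)"
  unfolding fdiff_def by (erule free_mod_lin_ext) (rule dcol_free)

lemma rdiff_free: "r \<ge> 1 \<Longrightarrow> v \<in> FM r \<Longrightarrow> rdiff r v \<in> FM (r - 1)"
  unfolding rdiff_def by (erule free_mod_lin_ext) (rule rcol_free)

lemma fdiff_fdiff: "r \<ge> 1 \<Longrightarrow> v \<in> FM (Suc r) \<Longrightarrow> fdiff F r (fdiff F (Suc r) v) = 0"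
  using complex by (simp add: homogeneous_complex_def)

lemma rdiff_rdiff: 
  assumes "r \<ge> 1" "v \<in> FM (Suc r)"
  shows "rdiff r (rdiff (Suc r) v) = 0"
proof -
  have "pm_map incl v \<in> FM (Suc r)"
    using rhom.map_free_mod[OF rhom_incl assms(2)] .
  then have "pm_map mod_x1 (fdiff F r (fdiff F (Suc r) (pm_map incl v))) = 0"
    by (simp add: fdiff_fdiff[OF assms(1)] rhom.map_0_eq[OF rhom_mod_x1])
  then show ?thesis by (simp add: map_fdiff map_mod_incl)
qed

lemma map_mod_0_D:
  fixes y :: "nat \<Rightarrow>\<^sub>0 ('v option, 'k) mpol"
  assumes "pm_map mod_x1 y = 0"
  shows "y = smul (var None) (pm_map quot_x1 y)"
proof (rule poly_mapping_eqI)
  fix i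
  have "mod_x1 (lookup y i) = 0" using assms rhom.lookup[OF rhom_mod_x1, of y i] by simp
  then show "lookup y i = lookup (smul (var None) (pm_map quot_x1 y)) i"
    by (simp add: lookup_pmap mod_x1_eq_0_D[symmetric])
qed

lemma smul_x1_cancel: "smul (var None) y = 0 \<Longrightarrow> y = 0" for y :: "nat \<Rightarrow>\<^sub>0 ('v option, 'k) mpol"
  by (rule poly_mapping_eqI) (metis lookup_smul lookup_zero x1_mult_cancel)

text \<open>A diagram chase. A lift \<open>v'\<close> of \<open>v\<close> has boundary x_1
  \<open>w\<close>; cancelling x_1 shows that \<open>w\<close> is a cycle, hence the boundary of
  some \<open>u\<close>. Then \<open>v'\<close> - x_1 \<open>u\<close> is a cycle of F that still
  reduces to \<open>v\<close>. Exactness in degree \<open>r - 1\<close> is used, hence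
  \<open>r \<ge> 2\<close>.\<close>

lemma rdiff_exact:
  assumes r: "r \<ge> 2" and v: "v \<in> FM r" "rdiff r v = 0"
  shows "\<exists>z \<in> FM (Suc r). rdiff (Suc r) z = v"
proof -
  define v' where "v' = pm_map incl v"
  have v': "v' \<in> FM r" unfolding v'_def by (rule rhom.map_free_mod[OF rhom_incl v(1)])
  define w where "w = pm_map quot_x1 (fdiff F r v')"
  have "pm_map mod_x1 (fdiff F r v') = 0" unfolding map_fdiff v'_def map_mod_incl by (rule v(2))
  then have w: "fdiff F r v' = smul (var None) w" unfolding w_def by (rule map_mod_0_D)
  have wf: "w \<in> FM (r - 1)"
    unfolding w_def by (rule free_mod_map[where h = quot_x1, OF _ fdiff_free]) (use r v' in auto)
  have "fdiff F (r - 1) (fdiff F r v') = 0"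
    using fdiff_fdiff[of "r - 1" v'] r v' by (simp add: Suc_diff_Suc numeral_2_eq_2)
  then have "fdiff F (r - 1) w = 0" unfolding w fdiff_smul by (rule smul_x1_cancel)
  then have "w \<in> fdiff F (Suc (r - 1)) ` FM (Suc (r - 1))"
  proof -
    have "1 \<le> r - 1" using r by simp
    from exact[OF this] wf \<open>fdiff F (r - 1) w = 0\<close> show ?thesis by blast
  qed
  then obtain u where u: "u \<in> FM r" "w = fdiff F r u" using r by auto
  have "fdiff F r (v' - smul (var None) u) = 0" by (simp add: fdiff_diff fdiff_smul w u(2))
  then have "v' - smul (var None) u \<in> fdiff F (Suc r) ` FM (Suc r)"
    using exact[of r] r free_mod_diff[OF v' free_mod_smul[OF u(1)]] by auto
  then obtain z where z: "z \<in> FM (Suc r)" "fdiff F (Suc r) z = v' - smul (var None) u" by auto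
  have "rdiff (Suc r) (pm_map mod_x1 z) = v"
    unfolding map_fdiff[symmetric] z(2) by (simp add: rhom.map_smul_diff[OF rhom_mod_x1] v'_def map_mod_incl)
  then show ?thesis using rhom.map_free_mod[OF rhom_mod_x1 z(1)] by blast
qed

lemma const_term_rdiff:
  assumes "r \<ge> 1" "v \<in> FM r"
  shows "lookup (lookup (rdiff r v) i) 0 = 0"
proof -
  have "rdiff r v = pm_map mod_x1 (fdiff F r (pm_map incl v))"
    by (simp add: map_fdiff map_mod_incl)
  then show ?thesis
    using minimal_const_term[OF minimal assms(1) rhom.map_free_mod[OF rhom_incl assms(2)]]
    by (simp add: rhom.lookup[OF rhom_mod_x1])
qed

text \<open>Minimality in the form used below: boundaries have no constant terms.\<close>

lemma cst_eq_rdiff: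
  assumes "cst y = rdiff r z" "r \<ge> 1" "z \<in> FM r"
  shows "y = 0"
  by (rule poly_mapping_eqI)
    (metis assms const_term_rdiff lookup_const lookup_zero rhom.lookup[OF rhom_const])

abbreviation "c \<equiv> macaulay_const n \<phi>"

lemma c_nonzero: "c \<noteq> 0"
  by (rule macaulay_const_nonzero)

lemma const_c_inverse: "const c * const (inverse c) = (1 :: ('v, 'k) mpol)"
  using c_nonzero by (simp add: rhom.one[OF rhom_const] flip: rhom.mult[OF rhom_const])

lemma smul_c_cancel: "smul (const c) u = smul (const c) v \<Longrightarrow> u = v" for u v :: "'i \<Rightarrow>\<^sub>0 ('v, 'k) mpol"
proof -
  assume "smul (const c) u = smul (const c) v"
  then have "smul (const (inverse c)) (smul (const c) u) = smul (const (inverse c)) (smul (const c) v)" by simp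
  moreover have "const (inverse c) * const c = (1 :: ('v, 'k) mpol)"
    using const_c_inverse by (simp add: mult.commute)
  ultimately show "u = v" by (simp add: smul_smul)
qed

lemma smul_c_eq_0: "smul (const c) u = 0 \<Longrightarrow> u = 0" for u :: "'i \<Rightarrow>\<^sub>0 ('v, 'k) mpol"
  using smul_c_cancel[of u 0] by simp

text \<open>The module in homological degree \<open>r\<close>, \<open>1 \<le> r < d\<close>, of either complex is obtained from a vector space
  over the field; \<open>split_iso r g h\<close> says that the vectors \<open>(g j, h j)\<close> are the images of the
  standard basis under an isomorphism of these spaces.\<close>

definition split_iso :: "nat \<Rightarrow> (nat \<Rightarrow> ('v bas \<Rightarrow>\<^sub>0 'k)) \<Rightarrow> (nat \<Rightarrow> ('v bas \<Rightarrow>\<^sub>0 'k)) \<Rightarrow> bool" where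
  "split_iso r g h \<longleftrightarrow>
    (\<forall>j<rank F r. g j \<in> K_ker (r - 1) (n - 1) \<and> h j \<in> L_ker (r - 1) n) \<and>
    (\<forall>y\<in>FM r. lin_ext g y = 0 \<and> lin_ext h y = 0 \<longrightarrow> y = 0) \<and>
    (\<forall>w1\<in>K_ker (r - 1) (n - 1). \<forall>w2\<in>L_ker (r - 1) n.
      \<exists>y\<in>FM r. lin_ext g y = w1 \<and> lin_ext h y = w2)"

definition chain_maps :: "nat \<Rightarrow> (nat \<Rightarrow> ('v bas \<Rightarrow>\<^sub>0 'k)) \<Rightarrow> (nat \<Rightarrow> ('v bas \<Rightarrow>\<^sub>0 'k)) \<Rightarrow> (nat \<Rightarrow>
    ('v bas \<Rightarrow>\<^sub>0 'k)) \<Rightarrow> (nat \<Rightarrow> ('v bas \<Rightarrow>\<^sub>0 'k)) \<Rightarrow> bool" where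
  "chain_maps r g h g' h' \<longleftrightarrow> (\<forall>v\<in>FM r.
     ext_scalars g (rdiff r v) = smul (const c) (kos (ext_scalars g' v)) \<and>
     ext_scalars h (rdiff r v) = smul (const c) (kos (ext_scalars h' v)))"

lemma split_iso_mem:
  assumes "split_iso r g h" "v \<in> FM r"
  shows "ext_scalars g v \<in> K_ker (r - 1) (n - 1)" "ext_scalars h v \<in> L_ker (r - 1) n"
proof -
  have "g j \<in> K_ker (r - 1) (n - 1)" "h j \<in> L_ker (r - 1) n" if "j \<in> keys v" for j
    using assms that by (auto simp: split_iso_def free_mod_def)
  then show "ext_scalars g v \<in> K_ker (r - 1) (n - 1)" "ext_scalars h v \<in> L_ker (r - 1) n"
    unfolding ext_scalars_def
    by (auto intro!: lin_ext_in_subspace[OF subspace_K_ker] lin_ext_in_subspace[OF subspace_L_ker]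
        rhom.map_K_ker[OF rhom_const] rhom.map_L_ker[OF rhom_const])
qed

lemma split_iso_inj:
  assumes iso: "split_iso r g h" and v: "v \<in> FM r" and 0: "ext_scalars g v = 0" "ext_scalars h v = 0"
  shows "v = 0"
proof (rule poly_mapping_eqI, rule poly_mapping_eqI)
  fix j \<alpha>
  let ?y = "pm_map (\<lambda>p. lookup p \<alpha>) v"
  have "?y \<in> FM r" by (rule free_mod_map[OF _ v]) simp
  moreover have "lin_ext g ?y = 0" "lin_ext h ?y = 0"
    unfolding coeff_ext_scalars[symmetric] 0 by (auto intro!: poly_mapping_eqI simp: lookup_pmap)
  ultimately have "?y = 0" using iso by (simp add: split_iso_def)
  then have "lookup ?y j = 0" by simp
  then show "lookup (lookup v j) \<alpha> = lookup (lookup 0 j) \<alpha>" by (simp add: lookup_pmap)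
qed

lemma map_of_int_cst:
  fixes z :: "'i \<Rightarrow>\<^sub>0 int"
  shows "pm_map of_int z = (cst (pm_map of_int z :: 'i \<Rightarrow>\<^sub>0 'k) :: 'i \<Rightarrow>\<^sub>0 ('v, 'k) mpol)"
  by (rule poly_mapping_eqI)
    (simp add: rhom.lookup[OF rhom_of_int] rhom.lookup[OF rhom_const], simp add: const_def)

lemma Lmod_ker: "base_change (Lmod a n) = L_ker a n"
  using base_change_Lmod[of a n] n_ge_2 by (simp add: L_ker_def)

lemma Kmod_ker: "base_change (Kmod a (n - 1)) = (K_ker a (n - 1) :: ('v bas \<Rightarrow>\<^sub>0 'r::comm_ring_1) set)"
  using base_change_Kmod[where 'v = 'v and a = a and b = "n - 1"] n_ge_2 by (simp add: K_ker_def)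

lemma Kmod_field: "z \<in> Kmod a b \<Longrightarrow> pm_map of_int z \<in> K_ker a b"
  by (rule rhom.map_K_ker[OF rhom_of_int]) (simp add: K_ker_def Kmod_def)

lemma Lmod_field: "z \<in> Lmod a b \<Longrightarrow> pm_map of_int z \<in> L_ker a b"
  by (rule rhom.map_L_ker[OF rhom_of_int]) (simp add: L_ker_def Lmod_def)

lemma zero_in_K_ker [simp]: "0 \<in> K_ker a b" and zero_in_L_ker [simp]: "0 \<in> L_ker a b"
  by (simp_all add: K_ker_def L_ker_def)

text \<open>Over the polynomial ring both kernels are spanned by images of integral vectors, and
  these are reached already over the field. The submodules \<open>S1\<close> and \<open>S2\<close>
  allow the two spans to be treated one at a time.\<close>

lemma split_iso_surj:
  fixes u1 u2 :: "('v, 'k) bpol"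
  assumes iso: "split_iso r g h" and u: "u1 \<in> K_ker (r - 1) (n - 1)" "u2 \<in> L_ker (r - 1) n"
  shows "\<exists>v\<in>FM r. ext_scalars g v = u1 \<and> ext_scalars h v = u2"
proof -
  have surj: "\<exists>v\<in>FM r :: (nat \<Rightarrow>\<^sub>0 ('v, 'k) mpol) set. ext_scalars g v = cst w1 \<and> ext_scalars h v = cst w2"
    if w: "w1 \<in> K_ker (r - 1) (n - 1)" "w2 \<in> L_ker (r - 1) n" for w1 w2
  proof -
    obtain y where y: "y \<in> FM r" "lin_ext g y = w1" "lin_ext h y = w2"
      using iso w unfolding split_iso_def by blast
    then show ?thesis using rhom.map_free_mod[OF rhom_const y(1)] by (metis ext_scalars_cst)
  qed
  define S1 where "S1 = {u. \<exists>v\<in>FM r :: (nat \<Rightarrow>\<^sub>0 ('v, 'k) mpol) set. ext_scalars g v = u \<and> ext_scalars h v = 0}"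
  define S2 where "S2 = {u. \<exists>v\<in>FM r :: (nat \<Rightarrow>\<^sub>0 ('v, 'k) mpol) set. ext_scalars g v = 0 \<and> ext_scalars h v = u}"
  have 1: "smul_module.subspace S1"
  proof (rule smul_module.subspaceI)
    show "0 \<in> S1" unfolding S1_def by (auto intro!: bexI[of _ 0])
    show "x + y \<in> S1" if "x \<in> S1" "y \<in> S1" for x y
    proof -
      obtain v w where "v \<in> FM r" "ext_scalars g v = x" "ext_scalars h v = 0"
        "w \<in> FM r" "ext_scalars g w = y" "ext_scalars h w = 0"
        using \<open>x \<in> S1\<close> \<open>y \<in> S1\<close> unfolding S1_def by blast
      then show ?thesis unfolding S1_def by (auto simp: ext_scalars_add intro!: bexI[of _ "v + w"] free_mod_add)
    qed
    show "smul a x \<in> S1" if "x \<in> S1" for a x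
    proof -
      obtain v where "v \<in> FM r" "ext_scalars g v = x" "ext_scalars h v = 0"
        using \<open>x \<in> S1\<close> unfolding S1_def by blast
      then show ?thesis unfolding S1_def by (auto simp: ext_scalars_smul intro!: bexI[of _
          "smul a v"] free_mod_smul)
    qed
  qed
  have 2: "smul_module.subspace S2"
  proof (rule smul_module.subspaceI)
    show "0 \<in> S2" unfolding S2_def by (auto intro!: bexI[of _ 0])
    show "x + y \<in> S2" if "x \<in> S2" "y \<in> S2" for x y
    proof -
      obtain v w where "v \<in> FM r" "ext_scalars g v = 0" "ext_scalars h v = x"
        "w \<in> FM r" "ext_scalars g w = 0" "ext_scalars h w = y"
        using \<open>x \<in> S2\<close> \<open>y \<in> S2\<close> unfolding S2_def by blast
      then show ?thesis unfolding S2_def by (auto simp: ext_scalars_add intro!: bexI[of _ "v + w"] free_mod_add)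
    qed
    show "smul a x \<in> S2" if "x \<in> S2" for a x
    proof -
      obtain v where "v \<in> FM r" "ext_scalars g v = 0" "ext_scalars h v = x"
        using \<open>x \<in> S2\<close> unfolding S2_def by blast
      then show ?thesis unfolding S2_def by (auto simp: ext_scalars_smul intro!: bexI[of _
          "smul a v"] free_mod_smul)
    qed
  qed
  have "base_change (Kmod (r - 1) (n - 1)) \<subseteq> S1"
  proof (rule base_change_subset[OF _ 1])
    fix z :: "'v bas \<Rightarrow>\<^sub>0 int" assume "z \<in> Kmod (r - 1) (n - 1)"
    from surj[OF Kmod_field[OF this], of 0] show "pm_map of_int z \<in> S1"
      unfolding S1_def mem_Collect_eq map_of_int_cst rhom.map_0_eq[OF rhom_const] by simp
  qed
  moreover have "base_change (Lmod (r - 1) n) \<subseteq> S2"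
  proof (rule base_change_subset[OF _ 2])
    fix z :: "'v bas \<Rightarrow>\<^sub>0 int" assume "z \<in> Lmod (r - 1) n"
    from surj[OF _ Lmod_field[OF this], of 0] show "pm_map of_int z \<in> S2"
      unfolding S2_def mem_Collect_eq map_of_int_cst rhom.map_0_eq[OF rhom_const] by simp
  qed
  ultimately have "u1 \<in> S1" "u2 \<in> S2" using u unfolding Kmod_ker Lmod_ker by auto
  then obtain v1 v2 where "v1 \<in> FM r" "ext_scalars g v1 = u1" "ext_scalars h v1 = 0"
    "v2 \<in> FM r" "ext_scalars g v2 = 0" "ext_scalars h v2 = u2"
    unfolding S1_def S2_def by blast
  then show ?thesis by (intro bexI[of _ "v1 + v2"]) (simp_all add: ext_scalars_add free_mod_add)
qed

text \<open>The two inputs of the induction step: columns of F go to Koszul images of constants, and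
  conversely (\<open>hits_linear\<close>) all such images come from F.\<close>

definition lifts_columns :: "nat \<Rightarrow> (nat \<Rightarrow> ('v bas \<Rightarrow>\<^sub>0 'k)) \<Rightarrow> (nat \<Rightarrow> ('v bas \<Rightarrow>\<^sub>0 'k)) \<Rightarrow> bool" where
  "lifts_columns r g h \<longleftrightarrow> (\<forall>j<rank F r. \<exists>w1\<in>K_ker (r - 1) (n - 1). \<exists>w2\<in>L_ker (r - 1) n.
     ext_scalars g (rcol r j) = smul (const c) (kos (cst w1)) \<and>
     ext_scalars h (rcol r j) = smul (const c) (kos (cst w2)))"

definition hits_linear :: "nat \<Rightarrow> (nat \<Rightarrow> ('v bas \<Rightarrow>\<^sub>0 'k)) \<Rightarrow> (nat \<Rightarrow> ('v bas \<Rightarrow>\<^sub>0 'k)) \<Rightarrow> bool" where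
  "hits_linear r g h \<longleftrightarrow> (\<forall>w1\<in>K_ker (r - 1) (n - 1). \<forall>w2\<in>L_ker (r - 1) n. \<exists>z\<in>FM r.
     ext_scalars g (rdiff r z) = smul (const c) (kos (cst w1)) \<and>
     ext_scalars h (rdiff r z) = smul (const c) (kos (cst w2)))"

lemma kos_cst_eq_const_term:
  fixes u :: "('v, 'k) bpol"
  assumes "u \<in> bideg (Suc a) b" "w \<in> bideg (Suc a) b" "kos u = kos (cst w)"
  shows "const_term u = w"
proof (rule bas_eqI)
  fix J \<mu>
  have "u - cst w \<in> bideg (Suc a) b"
    using bideg_add[OF assms(1) bideg_smul[OF rhom.bideg_map[OF rhom_const assms(2)], of "-1"]]
    by (simp add: bideg_iff lookup_add lookup_minus)
  moreover have "kos (u - cst w) = 0" by (simp add: kos_diff assms(3))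
  ultimately have "lookup (lookup (u - cst w) (J, \<mu>)) 0 = 0" by (rule kos_const_coeff)
  then show "lookup (const_term u) (J, \<mu>) = lookup w (J, \<mu>)"
    by (simp add: rhom.lookup[OF rhom_lookup_0] lookup_minus rhom.lookup[OF rhom_const])
qed

text \<open>The lifts of the columns are the new basis images. A vector of constants that they kill
  is a reduced cycle, so a boundary, so 0 by minimality. For surjectivity, the constant terms of a
  preimage given by \<open>hits_linear\<close> suffice, since \<open>kos\<close> determines
  them.\<close>

lemma split_iso_step:
  assumes r: "r \<ge> 2" and iso: "split_iso (r - 1) g h"
    and cols: "lifts_columns r g h" and hits: "hits_linear r g h"
  obtains g' h' where "split_iso r g' h'" "chain_maps r g h g' h'"
proof -
  obtain g' h' where gh': "\<And>j. j < rank F r \<Longrightarrow> g' j \<in> K_ker (r - 1) (n - 1) \<and> h' j \<in> L_ker (r - 1) n \<and>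
     ext_scalars g (rcol r j) = smul (const c) (kos (cst (g' j))) \<and>
     ext_scalars h (rcol r j) = smul (const c) (kos (cst (h' j)))"
    using cols unfolding lifts_columns_def by metis
  have chain: "chain_maps r g h g' h'"
    unfolding chain_maps_def
  proof
    fix v :: "nat \<Rightarrow>\<^sub>0 ('v, 'k) mpol" assume v: "v \<in> FM r"
    have keys: "j < rank F r" if "j \<in> keys v" for j using v that by (auto simp: free_mod_def)
    have "ext_scalars g (rdiff r v) = lin_ext (\<lambda>j. ext_scalars g (rcol r j)) v"
      "ext_scalars h (rdiff r v) = lin_ext (\<lambda>j. ext_scalars h (rcol r j)) v"
      by (simp_all add: ext_scalars_def rdiff_def lin_ext_lin_ext)
    moreover have "smul (const c) (kos (ext_scalars g' v)) = lin_ext (\<lambda>j. smul (const c) (kos (cst (g' j)))) v"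
      "smul (const c) (kos (ext_scalars h' v)) = lin_ext (\<lambda>j. smul (const c) (kos (cst (h' j)))) v"
      by (simp_all add: ext_scalars_def kos_def lin_ext_lin_ext lin_ext_smul_fun)
    ultimately show "ext_scalars g (rdiff r v) = smul (const c) (kos (ext_scalars g' v)) \<and>
        ext_scalars h (rdiff r v) = smul (const c) (kos (ext_scalars h' v))"
      using gh' keys by (auto intro!: lin_ext_cong)
  qed
  have "split_iso r g' h'"
    unfolding split_iso_def
  proof (intro conjI ballI impI allI)
    fix y assume y: "y \<in> FM r" and 0: "lin_ext g' y = 0 \<and> lin_ext h' y = 0"
    have cy: "cst y \<in> FM r" by (rule rhom.map_free_mod[OF rhom_const y])
    have "ext_scalars g (rdiff r (cst y)) = 0" "ext_scalars h (rdiff r (cst y)) = 0"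
      using chain[unfolded chain_maps_def, THEN bspec, OF cy] 0
      by (simp_all add: ext_scalars_cst rhom.map_0_eq[OF rhom_const])
    then have "rdiff r (cst y) = 0"
      by (intro split_iso_inj[OF iso] rdiff_free) (use r cy in auto)
    then obtain z where "z \<in> FM (Suc r)" "cst y = rdiff (Suc r) z"
      using rdiff_exact[OF r cy] by metis
    then show "y = 0" by (intro cst_eq_rdiff) auto
  next
    fix w1 w2 :: "'v bas \<Rightarrow>\<^sub>0 'k"
    assume w: "w1 \<in> K_ker (r - 1) (n - 1)" "w2 \<in> L_ker (r - 1) n"
    obtain z where z: "z \<in> FM r"
      "ext_scalars g (rdiff r z) = smul (const c) (kos (cst w1))"
      "ext_scalars h (rdiff r z) = smul (const c) (kos (cst w2))"
      using hits w unfolding hits_linear_def by blast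
    have kos: "kos (ext_scalars g' z) = kos (cst w1)" "kos (ext_scalars h' z) = kos (cst w2)"
      using chain z unfolding chain_maps_def by (auto intro: smul_c_cancel)
    have Suc: "r - 1 = Suc (r - 2)" using r by simp
    have "g' j \<in> K_ker (r - 1) (n - 1)" "h' j \<in> L_ker (r - 1) n" if "j \<in> keys z" for j
      using gh'[of j] z(1) that by (auto simp: free_mod_def)
    then have "ext_scalars g' z \<in> K_ker (r - 1) (n - 1)" "ext_scalars h' z \<in> L_ker (r - 1) n"
      unfolding ext_scalars_def
      by (auto intro!: lin_ext_in_subspace[OF subspace_K_ker] lin_ext_in_subspace[OF subspace_L_ker]
        rhom.map_K_ker[OF rhom_const] rhom.map_L_ker[OF rhom_const])
    then have "const_term (ext_scalars g' z) = w1" "const_term (ext_scalars h' z) = w2"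
      using w kos unfolding K_ker_def L_ker_def Suc by (auto intro: kos_cst_eq_const_term)
    then show "\<exists>y\<in>FM r. lin_ext g' y = w1 \<and> lin_ext h' y = w2"
      unfolding const_term_ext_scalars
      using rhom.map_free_mod[OF rhom_lookup_0 z(1)] by blast
  qed (use gh' in auto)
  then show ?thesis using chain that by blast
qed

text \<open>Koszul images are cycles, so the vector of F corresponding to one is a reduced cycle by
  the chain map below it. It is a boundary by \<open>rdiff_exact\<close>, which requires
  \<open>r - 1 \<ge> 2\<close>.\<close>

lemma hits_linear_general:
  assumes r: "r \<ge> 3" and iso: "split_iso (r - 1) g h" and iso0: "split_iso (r - 2) g0 h0"
    and chain: "chain_maps (r - 1) g0 h0 g h"
  shows "hits_linear r g h"
  unfolding hits_linear_def
proof (intro ballI)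
  fix w1 w2 :: "'v bas \<Rightarrow>\<^sub>0 'k"
  assume w: "w1 \<in> K_ker (r - 1) (n - 1)" "w2 \<in> L_ker (r - 1) n"
  have Suc: "r - 1 = Suc (r - 1 - 1)" using r by simp
  have "smul (const c) (kos (cst w1)) \<in> K_ker (r - 1 - 1) (n - 1)"
    using rhom.map_K_ker[OF rhom_const w(1)] Suc
    by (metis kos_K_ker smul_module.subspace_scale subspace_K_ker)
  moreover have "smul (const c) (kos (cst w2)) \<in> L_ker (r - 1 - 1) n"
    using rhom.map_L_ker[OF rhom_const w(2)] Suc
    by (metis kos_L_ker smul_module.subspace_scale subspace_L_ker)
  ultimately obtain v where v: "v \<in> FM (r - 1)"
    "ext_scalars g v = smul (const c) (kos (cst w1))" "ext_scalars h v = smul (const c) (kos (cst w2))"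
    using split_iso_surj[OF iso] by blast
  have "ext_scalars g0 (rdiff (r - 1) v) = 0" "ext_scalars h0 (rdiff (r - 1) v) = 0"
    using chain v unfolding chain_maps_def by (simp_all add: kos_smul kos_kos)
  moreover have "rdiff (r - 1) v \<in> FM (r - 2)"
    using rdiff_free[of "r - 1" v] r v(1) by (simp add: numeral_2_eq_2)
  ultimately have "rdiff (r - 1) v = 0" using split_iso_inj[OF iso0] by blast
  moreover have "2 \<le> r - 1" using r by simp
  ultimately obtain z where "z \<in> FM (Suc (r - 1))" "rdiff (Suc (r - 1)) z = v"
    using rdiff_exact[of "r - 1" v] v(1) by blast
  then show "\<exists>z\<in>FM r. ext_scalars g (rdiff r z) = smul (const c) (kos (cst w1)) \<and>
     ext_scalars h (rdiff r z) = smul (const c) (kos (cst w2))"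
    using v r by (intro bexI[of _ z]) auto
qed

lemma ext_scalars_homog:
  assumes "\<And>i. homog k (lookup v i)"
  shows "homog k (lookup (ext_scalars g v) b)"
  using assms unfolding homog_iff by (auto simp: lookup_ext_scalars intro!: sum.neutral)

lemma rcol_lookup_homog:
  assumes "r \<ge> 1" "j < rank F r" "\<And>i. i < rank F (r - 1) \<Longrightarrow> twists F r ! j - twists F (r - 1) ! i = k"
  shows "homog k (lookup (rcol r j) i)"
proof (cases "i < rank F (r - 1)")
  case True
  then show ?thesis using rcol_homog[OF assms(1,2) True] assms(3) by simp
next
  case False
  then have "lookup (rcol r j) i = 0" using rcol_free[OF assms(1,2)] by (auto simp: free_mod_iff)
  then show ?thesis by (simp add: homog_iff)
qed

lemma kos_lift_c:
  fixes u :: "('v, 'k) bpol"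
  assumes u: "u \<in> bideg a b" "kos u = 0" and lin: "\<And>J \<mu>. homog 1 (lookup u (J, \<mu>))"
  obtains w where "w \<in> bideg (Suc a) b" "u = smul (const c) (kos (cst w))"
proof -
  let ?u = "smul (const (inverse c)) u"
  have "?u \<in> bideg a b" by (rule bideg_smul[OF u(1)])
  moreover have "kos ?u = 0" by (simp add: kos_smul u(2))
  moreover have "homog 1 (lookup ?u (J, \<mu>))" for J \<mu>
    using lin[of J \<mu>] by (simp add: homog_iff)
  ultimately obtain w where w: "w \<in> bideg (Suc a) b" "?u = kos (cst w)" by (rule kos_lift)
  have "u = smul (const c) ?u" by (simp add: smul_smul const_c_inverse)
  then show ?thesis using w that by metis
qed

text \<open>A column is a cycle with linear entries, so its image is a linear Koszul cycle and
  lifts. The lift lies in the right kernel: \<open>kos\<close> anticommutes with \<open>eta\<close>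
  and \<open>kappa\<close>, and it is injective on constants.\<close>

lemma lifts_columns_general:
  assumes r: "r \<ge> 3" and iso: "split_iso (r - 1) g h" and chain: "chain_maps (r - 1) g0 h0 g h"
    and lin: "\<And>i j. j < rank F r \<Longrightarrow> i < rank F (r - 1) \<Longrightarrow> twists F r ! j - twists F (r - 1) ! i = 1"
  shows "lifts_columns r g h"
  unfolding lifts_columns_def
proof (intro allI impI)
  fix j assume j: "j < rank F r"
  have col: "rcol r j \<in> FM (r - 1)" using rcol_free[OF _ j] r by simp
  have "rdiff (r - 1) (rdiff (Suc (r - 1)) (single j 1)) = 0"
    by (rule rdiff_rdiff) (use r j in \<open>auto intro: free_mod_single\<close>)
  then have zero: "rdiff (r - 1) (rcol r j) = 0" using r by (simp add: rdiff_def)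
  have kos: "kos (ext_scalars g (rcol r j)) = 0" "kos (ext_scalars h (rcol r j)) = 0"
  proof -
    have "smul (const c) (kos (ext_scalars g (rcol r j))) = 0" "smul (const c) (kos (ext_scalars h
        (rcol r j))) = 0"
      using chain[unfolded chain_maps_def, THEN bspec, OF col] unfolding zero by simp_all
    then show "kos (ext_scalars g (rcol r j)) = 0" "kos (ext_scalars h (rcol r j)) = 0"
      by (auto dest: smul_c_eq_0)
  qed
  note mem = split_iso_mem[OF iso col]
  have hom: "homog 1 (lookup (rcol r j) i)" for i
    by (rule rcol_lookup_homog[OF _ j lin[OF j]]) (use r in auto)
  \<comment> \<open>Exhibits the exterior degree of \<open>eta w1\<close> and
    \<open>kappa w2\<close> as a successor, as \<open>kos_map_const_inj\<close> demands. For
    \<open>r = 2\<close> this degree is 0, and \<open>lifts_columns_2\<close> argues with the ideal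
    instead.\<close>
  define a where "a = r - 3"
  have a: "r - 1 - 1 = Suc a" "r - 1 = Suc (Suc a)" using r by (auto simp: a_def)
  obtain w1 where w1: "w1 \<in> bideg (Suc (Suc a)) (n - 1)" "ext_scalars g (rcol r j) = smul (const c) (kos
      (cst w1))"
    using mem(1) unfolding K_ker_def a
    by (auto intro: kos_lift_c[OF _ kos(1) ext_scalars_homog[OF hom]])
  obtain w2 where w2: "w2 \<in> bideg (Suc (Suc a)) n" "ext_scalars h (rcol r j) = smul (const c) (kos (cst w2))"
    using mem(2) unfolding L_ker_def a
    by (auto intro: kos_lift_c[OF _ kos(2) ext_scalars_homog[OF hom]])
  have "eta w1 = 0"
  proof (rule kos_map_const_inj)
    show "eta w1 \<in> bideg (Suc a) (n - 2)" using eta_bideg[of w1 "Suc a" "n - 2"] w1(1) n_ge_2 by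
        (simp add: Suc_diff_Suc numeral_2_eq_2)
    have "smul (const c) (eta (kos (cst w1))) = 0" using mem(1) by (simp add: K_ker_def w1(2) eta_smul)
    then have "eta (kos (cst w1) :: ('v, 'k) bpol) = 0" by (rule smul_c_eq_0)
    then show "kos (cst (eta w1)) = (0 :: ('v, 'k) bpol)" by (simp add: eta_kos rhom.eta_map[OF rhom_const])
  qed
  moreover have "kappa w2 = 0"
  proof (rule kos_map_const_inj)
    show "kappa w2 \<in> bideg (Suc a) (Suc n)" by (rule kappa_bideg[OF w2(1)])
    have "smul (const c) (kappa (kos (cst w2))) = 0" using mem(2) by (simp add: L_ker_def w2(2) kappa_smul)
    then have "kappa (kos (cst w2) :: ('v, 'k) bpol) = 0" by (rule smul_c_eq_0)
    then show "kos (cst (kappa w2)) = (0 :: ('v, 'k) bpol)" by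
        (simp add: kappa_kos rhom.kappa_map[OF rhom_const])
  qed
  ultimately show "\<exists>w1\<in>K_ker (r - 1) (n - 1). \<exists>w2\<in>L_ker (r - 1) n.
     ext_scalars g (rcol r j) = smul (const c) (kos (cst w1)) \<and>
     ext_scalars h (rcol r j) = smul (const c) (kos (cst w2))"
    using w1 w2 unfolding a K_ker_def L_ker_def by blast
qed

text \<open>Were all entries of the differential of degree at least 2, no boundary could have a
  linear term; but the Koszul image of a non-zero vector of constants has one.\<close>

lemma hits_linear_twist:
  assumes r: "r \<ge> 2" "r \<le> CARD('v)" and hits: "hits_linear r g h"
  shows "\<exists>j<rank F r. \<exists>i<rank F (r - 1). twists F r ! j - twists F (r - 1) ! i \<le> 1"
proof (rule ccontr)
  assume contra: "\<not> ?thesis"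
  have "\<exists>w2 :: 'v bas \<Rightarrow>\<^sub>0 'k. w2 \<in> bideg (r - 1) n \<and> kappa w2 = 0 \<and> w2 \<noteq> 0"
    by (rule ex_Lmod_nonzero) (use r n_ge_2 in auto)
  then obtain w2 :: "'v bas \<Rightarrow>\<^sub>0 'k" where w2: "w2 \<in> bideg (r - 1) n" "kappa w2 = 0" "w2 \<noteq> 0" by blast
  obtain z where z: "z \<in> FM r" "ext_scalars h (rdiff r z) = smul (const c) (kos (cst w2))"
    using hits w2 unfolding hits_linear_def by (metis (mono_tags, lifting) L_ker_def mem_Collect_eq
        zero_in_K_ker)
  have low: "lookup (lookup (rcol r j) i) \<alpha> = 0" if "j < rank F r" "mdeg \<alpha> \<le> 1" for i j \<alpha>
  proof (cases "i < rank F (r - 1)")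
    case True
    with contra that have "twists F r ! j - twists F (r - 1) ! i > 1" by (metis not_le)
    then show ?thesis using rcol_homog[of r j i] r that True by (auto simp: homog_iff)
  next
    case False
    then have "lookup (rcol r j) i = 0" using rcol_free[of r j] r that by (auto simp: free_mod_iff)
    then show ?thesis by simp
  qed
  have "lookup (lookup (rdiff r z) i) \<alpha> = 0" if "mdeg \<alpha> \<le> 1" for i \<alpha>
    unfolding rdiff_def lookup_lin_ext lookup_sum
  proof (intro sum.neutral ballI)
    fix j assume "j \<in> keys z"
    then have "j < rank F r" using z(1) by (auto simp: free_mod_def)
    then show "lookup (lookup z j * lookup (rcol r j) i) \<alpha> = 0"
      using low that by (intro low_degree_mult[of 1])
  qed
  then have zero: "lookup (lookup (ext_scalars h (rdiff r z)) b) \<alpha> = 0" if "mdeg \<alpha> \<le> 1" for b \<alpha>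
    using that by (simp add: lookup_ext_scalars)
  obtain J \<mu> where J: "lookup w2 (J, \<mu>) \<noteq> 0" using w2(3) by (metis bas_eqI lookup_zero)
  then have "card J = r - 1" using bidegD[OF w2(1)] by blast
  with r obtain i where i: "i \<in> J" by fastforce
  have "lookup (lookup (kos (cst w2)) (J - {i}, \<mu>)) (single i 1) = wsign i (J - {i}) * lookup w2 (J, \<mu>)"
    using i unfolding lookup_lookup_kos_linear by (simp add: rhom.lookup[OF rhom_const] insert_absorb)
  moreover have "c * lookup (lookup (kos (cst w2)) (J - {i}, \<mu>)) (single i 1) = 0"
    using zero[of "single i 1" "(J - {i}, \<mu>)"] unfolding z(2) by simp
  ultimately show False using c_nonzero J by simp
qed

end

subsection \<open>The first two modules of the reduced resolution\<close>

context gorenstein_resolution begin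

definition gen :: "nat \<Rightarrow> ('v option, 'k) mpol" where
  "gen j = lookup (dcol F 1 j) 0"

lemma free_mod_1_eqI: "u \<in> free_mod 1 \<Longrightarrow> v \<in> free_mod 1 \<Longrightarrow> lookup u 0 = lookup v 0 \<Longrightarrow> u = v"
  unfolding free_mod_iff by (metis less_one poly_mapping_eqI)

lemma fdiff_1_free: "v \<in> FM 1 \<Longrightarrow> fdiff F 1 v \<in> free_mod 1"
  using fdiff_free[of 1 v] by (simp add: rank_0)

lemma lookup_fdiff_1: "lookup (fdiff F 1 v) 0 = (\<Sum>j\<in>keys v. lookup v j * gen j)"
  by (simp add: fdiff_def lookup_lin_ext gen_def)

lemma lookup_fdiff_1_in_ann: "v \<in> FM 1 \<Longrightarrow> lookup (fdiff F 1 v) 0 \<in> ann"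
  using image_1 by blast

lemma gen_ann: "j < rank F 1 \<Longrightarrow> gen j \<in> ann"
  using lookup_fdiff_1_in_ann[of "single j 1"] free_mod_single[of j "rank F 1" 1]
  by (simp add: lookup_fdiff_1 del: One_nat_def)

lemma ann_generated:
  assumes "p \<in> ann"
  obtains v where "v \<in> FM 1" "lookup (fdiff F 1 v) 0 = p"
proof -
  have "single 0 p \<in> {v \<in> free_mod 1. lookup v 0 \<in> ann}"
    using assms by (simp add: free_mod_single)
  then obtain v where "v \<in> FM 1" "single 0 p = fdiff F 1 v"
    unfolding image_1 by auto
  then show ?thesis using that by (metis lookup_single_eq)
qed

lemma fdiff_1_eq_0:
  assumes "v \<in> FM 1" "lookup (fdiff F 1 v) 0 = 0"
  obtains z where "z \<in> FM 2" "v = fdiff F 2 z"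
proof -
  have "fdiff F 1 v = 0" by (rule free_mod_1_eqI[OF fdiff_1_free]) (use assms in simp_all)
  then have "v \<in> fdiff F (Suc 1) ` FM (Suc 1)" using exact[of 1] assms(1) by auto
  then show ?thesis using that by (auto simp: numeral_2_eq_2)
qed

text \<open>The integer of \<open>gorenstein_linear\<close> is replaced by the initial degree n of
  the ideal. For \<open>t = 1\<close> the only twist is twice that integer minus 1, so the two need
  not agree; hence the guard \<open>t \<ge> 2\<close>.\<close>

definition shape :: "nat \<Rightarrow> bool" where
  "shape t \<longleftrightarrow> (\<forall>r. 1 \<le> r \<and> r < t \<longrightarrow> (\<forall>j<rank F r. twists F r ! j = int n + int r - 1)) \<and>
    (t \<ge> 2 \<longrightarrow> (\<forall>j<rank F t. twists F t ! j = 2 * int n + int t - 2)) \<and>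
    (\<forall>r>t. rank F r = 0)"

text \<open>Generators of lower degree vanish by \<open>ann_least\<close>; generators of higher
  degree would leave no non-zero form of degree n in the ideal.\<close>

lemma gen_degree:
  assumes N: "\<And>j. j < rank F 1 \<Longrightarrow> twists F 1 ! j = N"
  shows "N = int n"
proof -
  have hom: "homog N (gen j)" if "j < rank F 1" for j
    using dcol_homog[of 1 j 0] N that by (simp add: rank_0 twist_0 gen_def)
  obtain p where p: "p \<in> ann" "homog (int n) p" "p \<noteq> 0" using ann_nonzero by blast
  obtain v where v: "v \<in> FM 1" "lookup (fdiff F 1 v) 0 = p" using ann_generated[OF p(1)] .
  have keys: "j < rank F 1" if "j \<in> keys v" for j using v(1) that by (auto simp: free_mod_def)
  have sum: "p = (\<Sum>j\<in>keys v. lookup v j * gen j)" unfolding v(2)[symmetric] lookup_fdiff_1 ..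
  consider "N < int n" | "N = int n" | "N > int n" by linarith
  then show ?thesis
  proof cases
    case 1
    have "gen j = 0" if "j < rank F 1" for j
    proof (cases "N \<ge> 0")
      case True
      then show ?thesis using ann_least[of "nat N" "gen j"] hom[OF that] gen_ann[OF that] 1 by simp
    next
      case False
      then show ?thesis using hom[OF that] by (intro poly_mapping_eqI) (auto simp: homog_iff)
    qed
    then have "p = 0" unfolding sum using keys by simp
    with p show ?thesis by simp
  next
    case 3
    have "lookup p \<alpha> = 0" if "mdeg \<alpha> = n" for \<alpha>
      unfolding sum lookup_sum
    proof (intro sum.neutral ballI)
      fix j assume "j \<in> keys v"
      then have "lookup (gen j) \<beta> = 0" if "mdeg \<beta> \<le> n" for \<beta>
        using hom[OF keys] 3 that by (auto simp: homog_iff)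
      then show "lookup (lookup v j * gen j) \<alpha> = 0"
        using that by (intro low_degree_mult[of n]) auto
    qed
    then have "p = 0" using p(2) by (intro poly_mapping_eqI) (auto simp: homog_iff)
    with p show ?thesis by simp
  qed
qed

lemma ex_shape: "(\<forall>j<rank F 1. twists F 1 ! j = int n) \<and> (\<exists>t\<ge>1. shape t)"
proof -
  obtain n' t s where t: "t \<ge> 1"
    and tw: "\<And>r. 1 \<le> r \<and> r < t \<Longrightarrow> twists F r = replicate (s r) (n' + int r - 1)"
      "twists F t = replicate (s t) (2 * n' + int t - 2)" "\<And>r. r > t \<Longrightarrow> twists F r = []"
    using gor_linear unfolding gorenstein_linear_def by blast
  have rk: "rank F r = s r" if "1 \<le> r" "r \<le> t" for r
    using tw(1)[of r] tw(2) that by (cases "r = t") (auto simp: rank_def)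
  have rk0: "rank F r = 0" if "r > t" for r using tw(3)[OF that] by (simp add: rank_def)
  have tw': "twists F r ! j = n' + int r - 1" if "1 \<le> r \<and> r < t" "j < rank F r" for r j
    using tw(1)[OF that(1)] that rk[of r] by simp
  have twt: "twists F t ! j = 2 * n' + int t - 2" if "j < rank F t" for j
    using tw(2) that rk[of t] t by simp
  show ?thesis
  proof (cases "t = 1")
    case True
    have "2 * n' - 1 = int n"
      by (rule gen_degree) (use twt True in simp)
    then have "twists F 1 ! j = int n" if "j < rank F 1" for j using twt that True by simp
    moreover have "shape 1" using rk0 True by (simp add: shape_def)
    ultimately show ?thesis by auto
  next
    case False
    then have t1: "1 < t" using t by simp
    have "n' = int n" by (rule gen_degree) (use tw'[of 1] t1 in simp)
    then have "shape t" "\<forall>j<rank F 1. twists F 1 ! j = int n"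
      using tw' twt rk0 t1 by (auto simp: shape_def)
    then show ?thesis using t by blast
  qed
qed

lemma gen_homog: "j < rank F 1 \<Longrightarrow> homog (int n) (gen j)"
  using dcol_homog[of 1 j 0] ex_shape by (simp add: rank_0 twist_0 gen_def)

text \<open>At the last place the twist jumps by 2n + t - 2 - (n + t - 2) = n, which is at least
  2.\<close>

lemma shape_linear:
  assumes t: "shape t" "t \<ge> 1" and r: "r \<ge> 2"
    and ex: "\<exists>j<rank F r. \<exists>i<rank F (r - 1). twists F r ! j - twists F (r - 1) ! i \<le> 1"
  shows "r < t"
proof (rule ccontr)
  assume "\<not> r < t"
  then consider "r = t" | "r > t" by linarith
  then show False
  proof cases
    case 1
    obtain i j where ij: "j < rank F r" "i < rank F (r - 1)" "twists F r ! j - twists F (r - 1) ! i \<le> 1"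
        using ex by blast
    moreover have "twists F r ! j = 2 * int n + int r - 2" using t r 1 ij by (auto simp: shape_def)
    moreover have "twists F (r - 1) ! i = int n + int (r - 1) - 1" using t r 1 ij by (simp add: shape_def)
    ultimately show False using n_ge_2 r by simp
  next
    case 2
    then have "rank F r = 0" using t by (simp add: shape_def)
    then show False using ex by simp
  qed
qed

lemma shape_diff:
  assumes t: "shape t" "r < t" and r: "r \<ge> 2" and ij: "j < rank F r" "i < rank F (r - 1)"
  shows "twists F r ! j - twists F (r - 1) ! i = 1"
proof -
  have "twists F r ! j = int n + int r - 1" using t r ij by (simp add: shape_def)
  moreover have "twists F (r - 1) ! i = int n + int (r - 1) - 1"
  proof -
    have "1 \<le> r - 1 \<and> r - 1 < t" using r t(2) by arith
    with t(1) ij(2) show ?thesis unfolding shape_def by blast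
  qed
  ultimately show ?thesis using r by simp
qed

definition g1 :: "nat \<Rightarrow> ('v bas \<Rightarrow>\<^sub>0 'k)" where
  "g1 j = (\<Sum>\<beta>\<in>monomials (n - 1). single ({}, \<beta>) (tau (gen j) \<beta>))"

text \<open>The factor \<open>inverse c\<close> makes up for the \<open>c\<close> in
  \<open>L_bot\<close>.\<close>

definition h1 :: "nat \<Rightarrow> ('v bas \<Rightarrow>\<^sub>0 'k)" where
  "h1 j = (\<Sum>\<mu>\<in>monomials n. single ({}, \<mu>) (inverse c * lookup (gen j) (emb \<mu>)))"

lemma lookup_g1: "j < rank F 1 \<Longrightarrow> lookup (g1 j) ({}, \<beta>) = tau (gen j) \<beta>"
  unfolding g1_def lookup_monomial_vector using tau_degree[OF gen_homog] by auto

lemma lookup_h1: "j < rank F 1 \<Longrightarrow> lookup (h1 j) ({}, \<mu>) = inverse c * lookup (gen j) (emb \<mu>)"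
  unfolding h1_def lookup_monomial_vector using gen_homog[of j] by (auto simp: homog_iff)

lemma g1_bideg: "g1 j \<in> bideg 0 (n - 1)" and h1_bideg: "h1 j \<in> bideg 0 n"
  unfolding g1_def h1_def bideg_iff lookup_monomial_vector by auto

definition comb :: "(nat \<Rightarrow>\<^sub>0 'k) \<Rightarrow> ('v option, 'k) mpol" where
  "comb y = (\<Sum>j\<in>keys y. const (lookup y j) * gen j)"

lemma lookup_fdiff_1_cst: "lookup (fdiff F 1 (cst y)) 0 = comb y"
  unfolding fdiff_def lookup_lin_ext_superset[OF finite_keys rhom.keys[OF rhom_const]]
  by (simp add: comb_def gen_def rhom.lookup[OF rhom_const])

lemma lin_ext_g1: "y \<in> FM 1 \<Longrightarrow> lookup (lin_ext g1 y) ({}, \<beta>) = tau (comb y) \<beta>"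
  unfolding comb_def tau_sum lookup_lin_ext
  by (intro sum.cong refl) (auto simp: tau_const_mult free_mod_def lookup_g1)

lemma lin_ext_h1: "y \<in> FM 1 \<Longrightarrow> lookup (lin_ext h1 y) ({}, \<mu>) = inverse c * lookup (comb y) (emb \<mu>)"
  unfolding comb_def lookup_sum lookup_lin_ext sum_distrib_left
  by (intro sum.cong refl) (auto simp: free_mod_def lookup_h1)

lemma comb_homog: "y \<in> FM 1 \<Longrightarrow> homog (int n) (comb y)"
  using gen_homog unfolding homog_iff comb_def lookup_sum by (auto simp: free_mod_def intro!: sum.neutral)

text \<open>Injectivity: by \<open>tau_injective\<close> a killed vector is a constant relation
  between the generators, which minimality excludes. Surjectivity: \<open>tau_surjective\<close>
  yields a form of degree n in the ideal, which must be written with constant coefficients.\<close>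

lemma split_iso_1: "split_iso 1 g1 h1"
  unfolding split_iso_def
proof (intro conjI allI impI ballI)
  fix j show "g1 j \<in> K_ker (1 - 1) (n - 1)" "h1 j \<in> L_ker (1 - 1) n"
    by (simp_all add: K_ker_0 L_ker_0 g1_bideg h1_bideg del: One_nat_def)
next
  fix y assume y: "y \<in> FM 1" and 0: "lin_ext g1 y = 0 \<and> lin_ext h1 y = 0"
  have cy: "cst y \<in> FM 1" by (rule rhom.map_free_mod[OF rhom_const y])
  have "comb y = 0"
  proof (rule tau_injective)
    show "comb y \<in> ann" using lookup_fdiff_1_in_ann[OF cy] unfolding lookup_fdiff_1_cst .
    show "homog (int n) (comb y)" by (rule comb_homog[OF y])
    show "mod_x1 (comb y) = 0" using lin_ext_h1[OF y] 0 c_nonzero by (intro poly_mapping_eqI) simp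
    show "tau (comb y) \<beta> = 0" for \<beta> using lin_ext_g1[OF y, of \<beta>] 0 by simp
  qed
  then obtain z where z: "z \<in> FM 2" "cst y = fdiff F 2 z"
    using fdiff_1_eq_0[OF cy] by (metis lookup_fdiff_1_cst)
  show "y = 0"
  proof (rule poly_mapping_eqI)
    fix i show "lookup y i = lookup 0 i"
      using minimal_const_term[OF minimal _ z(1), of i] unfolding z(2)[symmetric] by
          (simp add: rhom.lookup[OF rhom_const])
  qed
next
  fix w1 w2 :: "'v bas \<Rightarrow>\<^sub>0 'k" assume "w1 \<in> K_ker (1 - 1) (n - 1)" "w2 \<in> L_ker (1 - 1) n"
  then have w: "w1 \<in> bideg 0 (n - 1)" "w2 \<in> bideg 0 n" by (simp_all add: K_ker_0 L_ker_0)
  define m where "m = (\<Sum>\<mu>\<in>monomials n. single \<mu> (c * lookup w2 ({}, \<mu>)))"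
  have m: "lookup m \<mu> = c * lookup w2 ({}, \<mu>)" for \<mu>
  proof -
    have "lookup m \<mu> = (\<Sum>\<nu>\<in>monomials n. if \<nu> = \<mu> then c * lookup w2 ({}, \<mu>) else 0)"
      unfolding m_def lookup_sum by (intro sum.cong refl) (auto simp: lookup_single when_def)
    then show ?thesis
      unfolding sum.delta[OF finite_monomials] using bidegD[OF w(2), of "{}" \<mu>] by (auto simp: monomials_def)
  qed
  have "homog (int n) m" using bidegD[OF w(2)] by (auto simp: homog_iff m)
  then obtain p where p: "p \<in> ann" "homog (int n) p" "mod_x1 p = m"
    "\<And>\<beta>. mdeg \<beta> = n - 1 \<Longrightarrow> tau p \<beta> = lookup w1 ({}, \<beta>)"
    using tau_surjective[of m "\<lambda>\<beta>. lookup w1 ({}, \<beta>)"] by blast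
  obtain v where v: "v \<in> FM 1" "lookup (fdiff F 1 v) 0 = p" using ann_generated[OF p(1)] .
  define y where "y = const_term v"
  have y: "y \<in> FM 1" unfolding y_def by (rule rhom.map_free_mod[OF rhom_lookup_0 v(1)])
  \<comment> \<open>\<open>p\<close> has the degree of the generators, so only the constant terms of
    the coefficients \<open>v\<close> contribute.\<close>
  have "comb y = p"
  proof (rule poly_mapping_eqI)
    fix \<alpha>
    show "lookup (comb y) \<alpha> = lookup p \<alpha>"
    proof (cases "mdeg \<alpha> = n")
      case True
      have "lookup (comb y) \<alpha> = (\<Sum>j\<in>keys v. lookup y j * lookup (gen j) \<alpha>)"
        unfolding comb_def lookup_sum lookup_const_mult
        by (rule sum.mono_neutral_left) (auto simp: y_def in_keys_iff rhom.lookup[OF rhom_lookup_0])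
      also have "\<dots> = lookup p \<alpha>"
        unfolding v(2)[symmetric] lookup_fdiff_1 lookup_sum
      proof (intro sum.cong refl)
        fix j assume "j \<in> keys v"
        then have "homog (int n) (gen j)" using v(1) gen_homog by (auto simp: free_mod_def)
        then show "lookup y j * lookup (gen j) \<alpha> = lookup (lookup v j * gen j) \<alpha>"
          using True by (simp add: lookup_mult_homog y_def rhom.lookup[OF rhom_lookup_0])
      qed
      finally show ?thesis .
    qed (use comb_homog[OF y] p(2) in \<open>simp add: homog_iff\<close>)
  qed
  have "lin_ext g1 y = w1"
  proof (rule bas_eqI)
    fix J \<mu>
    show "lookup (lin_ext g1 y) (J, \<mu>) = lookup w1 (J, \<mu>)"
    proof (cases "J = {}")
      case True
      show ?thesis
      proof (cases "mdeg \<mu> = n - 1")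
        case True
        then show ?thesis using lin_ext_g1[OF y] p(4) \<open>J = {}\<close> \<open>comb y = p\<close> by simp
      next
        case False
        then show ?thesis using lin_ext_g1[OF y] tau_degree[OF p(2)] \<open>J = {}\<close> \<open>comb y
            = p\<close> bidegD[OF w(1), of J \<mu>] by auto
      qed
    next
      case False
      then have "lookup w1 (J, \<mu>) = 0" "lookup (g1 j) (J, \<mu>) = 0" for j
        using bidegD[OF w(1), of J \<mu>] bidegD[OF g1_bideg, of j J \<mu>] by auto
      then show ?thesis by (simp add: lookup_lin_ext)
    qed
  qed
  moreover have "lin_ext h1 y = w2"
  proof (rule bas_eqI)
    fix J \<mu>
    show "lookup (lin_ext h1 y) (J, \<mu>) = lookup w2 (J, \<mu>)"
    proof (cases "J = {}")
      case True
      have "lookup p (emb \<mu>) = c * lookup w2 ({}, \<mu>)" using p(3) m[of \<mu>] by auto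
      then show ?thesis using lin_ext_h1[OF y] True \<open>comb y = p\<close> c_nonzero by simp
    next
      case False
      then have "lookup w2 (J, \<mu>) = 0" "lookup (h1 j) (J, \<mu>) = 0" for j
        using bidegD[OF w(2), of J \<mu>] bidegD[OF h1_bideg, of j J \<mu>] by auto
      then show ?thesis by (simp add: lookup_lin_ext)
    qed
  qed
  ultimately show "\<exists>y\<in>FM 1. lin_ext g1 y = w1 \<and> lin_ext h1 y = w2" using y by blast
qed

text \<open>Both sides are the coefficient at \<open>\<nu>\<close> of the restriction of sum l_j
  (b_j phi), where l_j are the entries of \<open>v\<close> and b_j the quotients of the generators
  by x_1.\<close>

lemma sum_ext_scalars_g1:
  assumes v: "v \<in> FM 1" and S: "finite S" "\<And>j. keys (lookup v j) \<subseteq> S"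
  shows "(\<Sum>\<alpha>\<in>S. lookup (lookup (ext_scalars g1 v) ({}, \<alpha> + \<nu>)) \<alpha>) =
    (\<Sum>j\<in>keys v. pairing \<phi> (incl (lookup v j) * quot_x1 (gen j) * monom (emb \<nu>)))"
proof -
  have "(\<Sum>\<alpha>\<in>S. lookup (lookup (ext_scalars g1 v) ({}, \<alpha> + \<nu>)) \<alpha>) =
     (\<Sum>j\<in>keys v. \<Sum>\<alpha>\<in>S. lookup (lookup v j) \<alpha> * lookup (g1 j) ({}, \<alpha> + \<nu>))"
    unfolding lookup_ext_scalars by (rule sum.swap)
  also have "\<dots> = (\<Sum>j\<in>keys v. pairing \<phi> (incl (lookup v j) * quot_x1 (gen j) * monom (emb \<nu>)))"
  proof (intro sum.cong refl)
    fix j assume "j \<in> keys v"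
    then have j: "j < rank F 1" using v by (auto simp: free_mod_def)
    show "(\<Sum>\<alpha>\<in>S. lookup (lookup v j) \<alpha> * lookup (g1 j) ({}, \<alpha> + \<nu>)) =
        pairing \<phi> (incl (lookup v j) * quot_x1 (gen j) * monom (emb \<nu>))"
      unfolding pairing_incl lookup_g1[OF j]
      by (rule sum.mono_neutral_right) (use S in \<open>auto simp: in_keys_iff\<close>)
  qed
  finally show ?thesis .
qed

text \<open>The commuting square at the bottom: the sum on the right is the reduced first
  differential of F.\<close>

lemma L_bot_ext_scalars_h1:
  assumes v: "v \<in> FM 1"
  shows "L_bot c (ext_scalars h1 v) = single ({}, 0) (\<Sum>j\<in>keys v. lookup v j * mod_x1 (gen j))"
proof -
  have b: "ext_scalars h1 v \<in> bideg 0 n"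
    using split_iso_mem(2)[OF split_iso_1 v] by (simp add: L_ker_0)
  have gen: "mod_x1 (gen j) = (\<Sum>\<mu>\<in>monomials n. const (lookup (gen j) (emb \<mu>)) * monom \<mu>)" if
      "j < rank F 1" for j
  proof -
    have "keys (mod_x1 (gen j)) \<subseteq> monomials n"
      using gen_homog[OF that] by (auto simp: homog_iff in_keys_iff monomials_def) (metis mdeg_emb)
    then have "(\<Sum>\<mu>\<in>keys (mod_x1 (gen j)). const (lookup (mod_x1 (gen j)) \<mu>) * monom \<mu>)
        = (\<Sum>\<mu>\<in>monomials n. const (lookup (mod_x1 (gen j)) \<mu>) * monom \<mu>)"
      by (rule sum.mono_neutral_left[OF finite_monomials]) (auto simp: in_keys_iff rhom.zero[OF rhom_const])
    then show ?thesis using mpol_expand[of "mod_x1 (gen j)"] by simp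
  qed
  have cc: "const c * const (inverse c * a) = (const a :: ('v, 'k) mpol)" for a
  proof -
    have "c * (inverse c * a) = a" using c_nonzero by simp
    then show ?thesis unfolding rhom.mult[OF rhom_const, symmetric] by (rule arg_cong)
  qed
  have "(\<Sum>\<mu>\<in>monomials n. lookup (ext_scalars h1 v) ({}, \<mu>) * (const c * monom \<mu>))
    = (\<Sum>\<mu>\<in>monomials n. \<Sum>j\<in>keys v. lookup v j * (const (lookup (gen j) (emb \<mu>)) * monom \<mu>))"
  proof (intro sum.cong refl)
    fix \<mu> :: "'v mon"
    have "lookup (ext_scalars h1 v) ({}, \<mu>) * (const c * monom \<mu>) =
       (\<Sum>j\<in>keys v. lookup v j * ((const c * const (lookup (h1 j) ({}, \<mu>))) * monom \<mu>))"
      unfolding ext_scalars_def lookup_lin_ext sum_distrib_right rhom.lookup[OF rhom_const]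
      by (intro sum.cong refl) (simp add: ac_simps)
    also have "\<dots> = (\<Sum>j\<in>keys v. lookup v j * (const (lookup (gen j) (emb \<mu>)) * monom \<mu>))"
    proof (intro sum.cong refl)
      fix j assume "j \<in> keys v"
      then have "j < rank F 1" using v by (auto simp: free_mod_def)
      then show "lookup v j * ((const c * const (lookup (h1 j) ({}, \<mu>))) * monom \<mu>) =
          lookup v j * (const (lookup (gen j) (emb \<mu>)) * monom \<mu>)"
        by (simp only: lookup_h1 cc)
    qed
    finally show "lookup (ext_scalars h1 v) ({}, \<mu>) * (const c * monom \<mu>) = (\<Sum>j\<in>keys v. lookup v j * (const
        (lookup (gen j) (emb \<mu>)) * monom \<mu>))" .
  qed
  also have "\<dots> = (\<Sum>j\<in>keys v. \<Sum>\<mu>\<in>monomials n. lookup v j * (const (lookup (gen j) (emb \<mu>)) * monom \<mu>))"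
    by (rule sum.swap)
  also have "\<dots> = (\<Sum>j\<in>keys v. lookup v j * mod_x1 (gen j))"
    using v gen by (intro sum.cong refl) (auto simp: free_mod_def sum_distrib_left)
  finally show ?thesis unfolding L_bot_bideg[OF b] by simp
qed

lemma L_bot_smul: "L_bot a (smul p u) = smul p (L_bot a u)"
  by (simp add: L_bot_def lin_ext_smul)

text \<open>One set on which \<open>sum_ext_scalars_g1\<close> and \<open>sum_kos_eta\<close> can
  both be evaluated.\<close>

lemma finite_support:
  fixes v :: "nat \<Rightarrow>\<^sub>0 ('v, 'k) mpol"
  obtains S where "finite S" "\<And>j. keys (lookup v j) \<subseteq> S" "\<And>i. single i 1 \<in> S"
proof (rule that[of "(\<Union>j\<in>keys v. keys (lookup v j)) \<union> range (\<lambda>i. single i 1)"])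
  show "keys (lookup v j) \<subseteq> (\<Union>j\<in>keys v. keys (lookup v j)) \<union> range (\<lambda>i. single i 1)" for j
    by (cases "j \<in> keys v") (auto simp: in_keys_iff)
qed auto

text \<open>\<open>rdiff_exact\<close> does not apply in degree 1. The vector of F_1 corresponding
  to \<open>w1\<close> and \<open>w2\<close> is therefore lifted to S and corrected by a multiple of
  x_1 until it is a syzygy.\<close>

lemma hits_linear_2: "hits_linear 2 g1 h1"
  unfolding hits_linear_def
proof (intro ballI)
  fix w1 w2 :: "'v bas \<Rightarrow>\<^sub>0 'k"
  assume "w1 \<in> K_ker (2 - 1) (n - 1)" "w2 \<in> L_ker (2 - 1) n"
  then have w1: "w1 \<in> bideg 1 (n - 1)" "eta w1 = 0" and w2: "w2 \<in> bideg 1 n" "kappa w2 = 0"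
    by (simp_all add: K_ker_def L_ker_def)
  have "smul (const c) (kos (cst w1)) \<in> (K_ker (1 - 1) (n - 1) :: (('v, 'k) bpol) set)"
    "smul (const c) (kos (cst w2)) \<in> (L_ker (1 - 1) n :: (('v, 'k) bpol) set)"
    using kos_bideg[OF rhom.bideg_map[OF rhom_const w1(1), unfolded One_nat_def]]
      kos_bideg[OF rhom.bideg_map[OF rhom_const w2(1), unfolded One_nat_def]]
    by (simp_all add: K_ker_0 L_ker_0 bideg_smul)
  then obtain v where v: "v \<in> FM 1" "ext_scalars g1 v = smul (const c) (kos (cst w1))"
    "ext_scalars h1 v = smul (const c) (kos (cst w2))"
    using split_iso_surj[OF split_iso_1] by blast
  define v' where "v' = pm_map incl v"
  have v': "v' \<in> FM 1" unfolding v'_def by (rule rhom.map_free_mod[OF rhom_incl v(1)])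
  define y where "y = lookup (fdiff F 1 v') 0"
  have y_ann: "y \<in> ann" unfolding y_def by (rule lookup_fdiff_1_in_ann[OF v'])
  have y: "y = (\<Sum>j\<in>keys v. incl (lookup v j) * gen j)"
    unfolding y_def fdiff_def v'_def lookup_lin_ext_superset[OF finite_keys rhom.keys[OF rhom_incl]]
    by (simp add: rhom.lookup[OF rhom_incl] gen_def)
  \<comment> \<open>\<open>L_bot\<close> computes the x_1-free part of \<open>y\<close>, so
    \<open>kappa w2 = 0\<close> kills it. Below, \<open>eta w1 = 0\<close> puts the cofactor of x_1
    into the annihilator.\<close>
  have "mod_x1 y = (\<Sum>j\<in>keys v. lookup v j * mod_x1 (gen j))"
    by (simp add: y rhom.sum[OF rhom_mod_x1] rhom.mult[OF rhom_mod_x1])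
  also have "\<dots> = lookup (L_bot c (ext_scalars h1 v)) ({}, 0)"
    unfolding L_bot_ext_scalars_h1[OF v(1)] by simp
  also have "\<dots> = const c * lookup (L_bot c (kos (cst w2))) ({}, 0)"
    unfolding v(3) L_bot_smul by simp
  also have "\<dots> = 0"
    by (rule poly_mapping_eqI) (simp add: L_bot_kos[OF w2(1)] w2(2))
  finally have yb: "y = var None * quot_x1 y" by (rule mod_x1_eq_0_D)
  have qy: "quot_x1 y = (\<Sum>j\<in>keys v. incl (lookup v j) * quot_x1 (gen j))"
    unfolding y quot_x1_sum quot_x1_mult by simp
  have "quot_x1 y \<in> ann"
  proof (rule ann_from_x1)
    show "var None * quot_x1 y \<in> ann" using y_ann yb by simp
    fix \<nu>
    obtain S where S: "finite S" "\<And>j. keys (lookup v j) \<subseteq> S" "\<And>i. single i 1 \<in> S"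
      using finite_support[of v] by blast
    have "pairing \<phi> (quot_x1 y * monom (emb \<nu>)) = (\<Sum>\<alpha>\<in>S. lookup (lookup (ext_scalars g1 v) ({}, \<alpha> + \<nu>)) \<alpha>)"
      unfolding sum_ext_scalars_g1[OF v(1) S(1,2)] qy by (simp add: sum_distrib_right pairing_sum)
    also have "\<dots> = c * (\<Sum>\<alpha>\<in>S. lookup (lookup (kos (cst w1)) ({}, \<alpha> + \<nu>)) \<alpha>)"
      unfolding v(2) by (simp add: sum_distrib_left)
    also have "\<dots> = 0" unfolding sum_kos_eta[OF S(1,3)] w1(2) by simp
    finally show "pairing \<phi> (quot_x1 y * monom (emb \<nu>)) = 0" .
  qed
  \<comment> \<open>As \<open>y\<close> is x_1 times an element of the ideal, subtracting x_1
    \<open>p\<close> makes \<open>v'\<close> a syzygy and leaves its reduction unchanged.\<close>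
  then obtain p where p: "p \<in> FM 1" "lookup (fdiff F 1 p) 0 = quot_x1 y" by (rule ann_generated)
  have "lookup (fdiff F 1 (v' - smul (var None) p)) 0 = 0"
    unfolding fdiff_diff fdiff_smul lookup_minus lookup_smul p(2) y_def[symmetric] using yb by simp
  then obtain z where z: "z \<in> FM 2" "v' - smul (var None) p = fdiff F 2 z"
    using fdiff_1_eq_0[OF free_mod_diff[OF v' free_mod_smul[OF p(1)]]] by blast
  have "rdiff 2 (pm_map mod_x1 z) = v"
    unfolding map_fdiff[symmetric] z(2)[symmetric] by (simp add: rhom.map_smul_diff[OF rhom_mod_x1] v'_def
        map_mod_incl)
  then show "\<exists>z\<in>FM 2. ext_scalars g1 (rdiff 2 z) = smul (const c) (kos (cst w1)) \<and>
     ext_scalars h1 (rdiff 2 z) = smul (const c) (kos (cst w2))"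
    using v rhom.map_free_mod[OF rhom_mod_x1 z(1)] by (intro bexI[of _ "pm_map mod_x1 z"]) auto
qed

text \<open>In exterior degree 0 every vector is a Koszul cycle, so lifts exist at once. That they
  lie in the kernels is read off from the syzygy itself: its reduction modulo x_1 gives
  \<open>kappa w2 = 0\<close>, its quotient by x_1 gives \<open>eta w1 = 0\<close>.\<close>

lemma lifts_columns_2:
  assumes lin: "\<And>i j. j < rank F 2 \<Longrightarrow> i < rank F (2 - 1) \<Longrightarrow> twists F 2 ! j - twists F (2 - 1) ! i = 1"
  shows "lifts_columns 2 g1 h1"
  unfolding lifts_columns_def
proof (intro allI impI)
  fix j assume j: "j < rank F 2"
  have col: "rcol 2 j \<in> FM 1" using rcol_free[OF _ j] by simp
  have dcol: "dcol F 2 j \<in> FM 1" using dcol_free[OF _ j] by simp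
  have "fdiff F 1 (fdiff F (Suc 1) (single j 1)) = 0"
    by (rule fdiff_fdiff) (use j in \<open>auto simp: numeral_2_eq_2 intro: free_mod_single\<close>)
  then have zero: "fdiff F 1 (dcol F 2 j) = 0" by (simp add: fdiff_def numeral_2_eq_2)
  then have syz: "(\<Sum>k\<in>keys (dcol F 2 j). lookup (dcol F 2 j) k * gen k) = 0"
    unfolding lookup_fdiff_1[symmetric] by simp
  have keys: "keys (rcol 2 j) \<subseteq> keys (dcol F 2 j)"
    unfolding rcol_def by (rule rhom.keys[OF rhom_mod_x1])
  have hom: "homog 1 (lookup (rcol 2 j) i)" for i
    by (rule rcol_lookup_homog[OF _ j lin[OF j]]) auto
  have mem: "ext_scalars g1 (rcol 2 j) \<in> bideg 0 (n - 1)" "ext_scalars h1 (rcol 2 j) \<in> bideg 0 n"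
    using split_iso_mem[OF split_iso_1 col] by (simp_all add: K_ker_0 L_ker_0)
  obtain w1 where w1: "w1 \<in> bideg (Suc 0) (n - 1)" "ext_scalars g1 (rcol 2 j) = smul (const c) (kos (cst w1))"
    by (rule kos_lift_c[OF mem(1) kos_bideg_0[OF mem(1)] ext_scalars_homog[OF hom]])
  obtain w2 where w2: "w2 \<in> bideg (Suc 0) n" "ext_scalars h1 (rcol 2 j) = smul (const c) (kos (cst w2))"
    by (rule kos_lift_c[OF mem(2) kos_bideg_0[OF mem(2)] ext_scalars_homog[OF hom]])
  \<comment> \<open>Apply \<open>quot_x1_mult\<close> to the syzygy: the summands containing
    \<open>gen k\<close> itself pair to 0, since the generators annihilate phi.\<close>
  have pair0: "(\<Sum>k\<in>keys (rcol 2 j). pairing \<phi> (incl (lookup (rcol 2 j) k) * quot_x1 (gen k) * monom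
      (emb \<nu>))) = 0" for \<nu>
  proof -
    let ?D = "dcol F 2 j"
    have "(\<Sum>k\<in>keys (rcol 2 j). pairing \<phi> (incl (lookup (rcol 2 j) k) * quot_x1 (gen k) * monom (emb \<nu>)))
      = (\<Sum>k\<in>keys ?D. pairing \<phi> (incl (lookup (rcol 2 j) k) * quot_x1 (gen k) * monom (emb \<nu>)))"
      by (rule sum.mono_neutral_left) (use keys in \<open>auto simp: in_keys_iff rhom.zero[OF rhom_incl]\<close>)
    also have "\<dots> = (\<Sum>k\<in>keys ?D. pairing \<phi> (incl (lookup (rcol 2 j) k) * quot_x1 (gen k) * monom (emb \<nu>))
        + pairing \<phi> (quot_x1 (lookup ?D k) * gen k * monom (emb \<nu>)))"
    proof (intro sum.cong refl)
      fix k assume "k \<in> keys ?D"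
      then have "gen k \<in> ann" using dcol gen_ann by (auto simp: free_mod_def)
      then have "gen k * (quot_x1 (lookup ?D k) * monom (emb \<nu>)) \<in> ann" by (rule ann_mult_right)
      then have "pairing \<phi> (quot_x1 (lookup ?D k) * gen k * monom (emb \<nu>)) = 0"
        using \<open>gen k \<in> ann\<close> unfolding ann_iff by (metis mult.assoc mult.commute)
      then show "pairing \<phi> (incl (lookup (rcol 2 j) k) * quot_x1 (gen k) * monom (emb \<nu>)) =
        pairing \<phi> (incl (lookup (rcol 2 j) k) * quot_x1 (gen k) * monom (emb \<nu>))
        + pairing \<phi> (quot_x1 (lookup ?D k) * gen k * monom (emb \<nu>))" by simp
    qed
    also have "\<dots> = pairing \<phi> (quot_x1 (\<Sum>k\<in>keys ?D. lookup ?D k * gen k) * monom (emb \<nu>))"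
      unfolding quot_x1_sum quot_x1_mult by (simp add: sum_distrib_right distrib_right pairing_sum
          pairing_add lookup_rcol)
    finally show ?thesis unfolding syz by simp
  qed
  have "eta w1 = 0"
  proof (rule bas_eqI)
    fix J \<nu>
    have b: "eta w1 \<in> bideg 0 (n - 2)"
      using eta_bideg[of w1 0 "n - 2"] w1(1) n_ge_2 by (simp add: Suc_diff_Suc numeral_2_eq_2)
    show "lookup (eta w1) (J, \<nu>) = lookup 0 (J, \<nu>)"
    proof (cases "J = {}")
      case True
      obtain S where S: "finite S" "\<And>k. keys (lookup (rcol 2 j) k) \<subseteq> S" "\<And>i. single i 1 \<in> S"
        using finite_support[of "rcol 2 j"] by blast
      have "c * lookup (eta w1) ({}, \<nu>) = (\<Sum>\<alpha>\<in>S. lookup (lookup (ext_scalars g1 (rcol 2 j)) ({}, \<alpha> + \<nu>)) \<alpha>)"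
        unfolding w1(2) by (simp add: sum_kos_eta[OF S(1,3)] flip: sum_distrib_left)
      also have "\<dots> = 0" unfolding sum_ext_scalars_g1[OF col S(1,2)] by (rule pair0)
      finally show ?thesis using True c_nonzero by simp
    qed (use bidegD[OF b, of J \<nu>] in auto)
  qed
  moreover have "kappa w2 = 0"
  proof (rule bas_eqI)
    fix J \<mu>
    have b: "kappa w2 \<in> bideg 0 (Suc n)" by (rule kappa_bideg[OF w2(1)])
    show "lookup (kappa w2) (J, \<mu>) = lookup 0 (J, \<mu>)"
    proof (cases "J = {}")
      case True
      \<comment> \<open>One factor \<open>c\<close> stems from \<open>L_bot\<close>, the other from
        the lift of the column.\<close>
      have "c * (c * lookup (kappa w2) ({}, \<mu>)) = c * lookup (lookup (L_bot c (kos (cst w2))) ({}, 0)) \<mu>"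
        using L_bot_kos[of w2 n c \<mu>] w2(1) by simp
      also have "\<dots> = lookup (lookup (L_bot c (ext_scalars h1 (rcol 2 j))) ({}, 0)) \<mu>"
        unfolding w2(2) L_bot_smul by simp
      also have "lookup (L_bot c (ext_scalars h1 (rcol 2 j))) ({}, 0) = (\<Sum>k\<in>keys (rcol 2 j). lookup
          (rcol 2 j) k * mod_x1 (gen k))"
        unfolding L_bot_ext_scalars_h1[OF col] by simp
      also have "\<dots> = (\<Sum>k\<in>keys (dcol F 2 j). lookup (rcol 2 j) k * mod_x1 (gen k))"
        by (rule sum.mono_neutral_left) (use keys in \<open>auto simp: in_keys_iff\<close>)
      also have "\<dots> = mod_x1 (\<Sum>k\<in>keys (dcol F 2 j). lookup (dcol F 2 j) k * gen k)"
        by (simp add: rhom.sum[OF rhom_mod_x1] rhom.mult[OF rhom_mod_x1] lookup_rcol)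
      also have "lookup \<dots> \<mu> = 0" unfolding syz by (simp add: rhom.zero[OF rhom_mod_x1])
      finally show ?thesis using True c_nonzero by simp
    qed (use bidegD[OF b, of J \<mu>] in auto)
  qed
  ultimately show "\<exists>w1\<in>K_ker (2 - 1) (n - 1). \<exists>w2\<in>L_ker (2 - 1) n.
     ext_scalars g1 (rcol 2 j) = smul (const c) (kos (cst w1)) \<and>
     ext_scalars h1 (rcol 2 j) = smul (const c) (kos (cst w2))"
    using w1 w2 unfolding K_ker_def L_ker_def by (auto intro!: bexI[of _ w1] bexI[of _ w2])
qed

end

subsection \<open>The isomorphism with the skeleton\<close>

context gorenstein_resolution begin

text \<open>The start is fixed because \<open>hits_linear_2\<close>, \<open>lifts_columns_2\<close>
  and the bottom square concern \<open>g1\<close> and \<open>h1\<close>.\<close>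

definition split_isos :: "nat \<Rightarrow> (nat \<Rightarrow> nat \<Rightarrow> ('v bas \<Rightarrow>\<^sub>0 'k)) \<Rightarrow> (nat \<Rightarrow> nat \<Rightarrow> ('v bas \<Rightarrow>\<^sub>0 'k)) \<Rightarrow> bool" where
  "split_isos R G H \<longleftrightarrow> G 1 = g1 \<and> H 1 = h1 \<and>
    (\<forall>r. 1 \<le> r \<and> r \<le> R \<longrightarrow> split_iso r (G r) (H r)) \<and>
    (\<forall>r. 2 \<le> r \<and> r \<le> R \<longrightarrow> chain_maps r (G (r - 1)) (H (r - 1)) (G r) (H r))"

lemma split_isos_hits:
  assumes GH: "split_isos R G H" and R: "1 \<le> R"
  shows "hits_linear (Suc R) (G R) (H R)"
proof (cases "R = 1")
  case True
  then show ?thesis using GH hits_linear_2 by (simp add: split_isos_def numeral_2_eq_2)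
next
  case False
  then show ?thesis
    using GH R by (intro hits_linear_general[of _ _ _ "G (R - 1)" "H (R - 1)"]) (auto simp: split_isos_def)
qed

lemma split_isos_lifts:
  assumes GH: "split_isos R G H" and R: "1 \<le> R" and t: "shape t" "Suc R < t"
  shows "lifts_columns (Suc R) (G R) (H R)"
proof -
  have lin: "twists F (Suc R) ! j - twists F (Suc R - 1) ! i = 1" if "j < rank F (Suc R)" "i < rank F
      (Suc R - 1)" for i j
    by (rule shape_diff[OF t _ that]) (use R in simp)
  show ?thesis
  proof (cases "R = 1")
    case True
    then show ?thesis using GH lifts_columns_2 lin by (simp add: split_isos_def numeral_2_eq_2)
  next
    case False
    then show ?thesis
      using GH R lin by (intro lifts_columns_general[of _ _ _ "G (R - 1)" "H (R - 1)"])
          (auto simp: split_isos_def)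
  qed
qed

text \<open>The linear cycles found so far force a jump of the twists by at most 1 at the next
  place, so F cannot end there. This bounds the unknown length \<open>t\<close> from below as the
  induction proceeds.\<close>

lemma split_isos_shape:
  assumes GH: "split_isos R G H" and R: "1 \<le> R" "R < CARD('v)" and t: "shape t" "t \<ge> 1"
  shows "Suc R < t"
  by (rule shape_linear[OF t], use R in simp, rule hits_linear_twist[OF _ _ split_isos_hits[OF GH R(1)]])
      (use R in auto)

lemma ex_split_isos: "1 \<le> R \<Longrightarrow> R \<le> CARD('v) \<Longrightarrow> \<exists>G H. split_isos R G H"
proof (induction R rule: dec_induct)
  case base
  show ?case
    using split_iso_1 by (intro exI[of _ "\<lambda>_. g1"] exI[of _ "\<lambda>_. h1"]) (auto simp: split_isos_def le_Suc_eq)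
next
  case (step R)
  then obtain G H where GH: "split_isos R G H" by auto
  obtain t where t: "t \<ge> 1" "shape t" using ex_shape by blast
  have "Suc R < t" using split_isos_shape[OF GH _ _ t(2,1)] step by simp
  then have lifts: "lifts_columns (Suc R) (G R) (H R)" using split_isos_lifts[OF GH _ t(2)] step by simp
  have "split_iso (Suc R - 1) (G R) (H R)" using GH step by (simp add: split_isos_def)
  then obtain g h where gh: "split_iso (Suc R) g h" "chain_maps (Suc R) (G R) (H R) g h"
    using split_iso_step[OF _ _ lifts split_isos_hits[OF GH]] step by
        (metis Suc_le_mono numeral_2_eq_2 One_nat_def)
  have "split_isos (Suc R) (G(Suc R := g)) (H(Suc R := h))"
    unfolding split_isos_def
  proof (intro conjI allI impI)
    show "(G(Suc R := g)) 1 = g1" "(H(Suc R := h)) 1 = h1" using GH step by (auto simp: split_isos_def)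
    fix r
    show "split_iso r ((G(Suc R := g)) r) ((H(Suc R := h)) r)" if "1 \<le> r \<and> r \<le> Suc R"
      using GH gh that by (cases "r = Suc R") (auto simp: split_isos_def)
    show "chain_maps r ((G(Suc R := g)) (r - 1)) ((H(Suc R := h)) (r - 1)) ((G(Suc R := g)) r)
        ((H(Suc R := h)) r)"
      if "2 \<le> r \<and> r \<le> Suc R"
      using GH gh that by (cases "r = Suc R") (auto simp: split_isos_def)
  qed
  then show ?case by blast
qed

section \<open>The last differential and the length of F\<close>

lemma top_syzygy_K_ker: "(top_syzygy n :: ('v, 'k) bpol) \<in> K_ker (CARD('v) - 1) (n - 1)"
  using top_syzygy_bideg[of "n - 1", where 'v = 'v] n_ge_2 by (simp add: K_ker_def eta_top_syzygy)

lemma kos_top_syzygy_n: "kos (top_syzygy n) = 0"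
  using kos_top_syzygy[of "n - 1"] n_ge_2 by simp

context
  fixes G H assumes GH: "split_isos (CARD('v)) G H"
begin

lemma iso_top: "split_iso (CARD('v)) (G (CARD('v))) (H (CARD('v)))"
  using GH card_ge_2 by (simp add: split_isos_def)

lemma cycle_iff:
  assumes v: "v \<in> FM (CARD('v))"
  shows "rdiff (CARD('v)) v = 0 \<longleftrightarrow>
    kos (ext_scalars (G (CARD('v))) v) = (0 :: ('v, 'k) bpol) \<and> kos (ext_scalars (H (CARD('v))) v) = (0 ::
        ('v, 'k) bpol)"
proof -
  let ?m = "CARD('v)"
  have iso: "split_iso (?m - 1) (G (?m - 1)) (H (?m - 1))"
    and chain: "chain_maps ?m (G (?m - 1)) (H (?m - 1)) (G ?m) (H ?m)"
    using GH card_ge_2 by (auto simp: split_isos_def)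
  note c = chain[unfolded chain_maps_def, THEN bspec, OF v]
  show ?thesis
  proof
    assume 0: "rdiff ?m v = 0"
    have "smul (const c) (kos (ext_scalars (G ?m) v)) = 0" "smul (const c) (kos (ext_scalars (H ?m) v)) = 0"
      using c unfolding 0 by simp_all
    then show "kos (ext_scalars (G ?m) v) = 0 \<and> kos (ext_scalars (H ?m) v) = 0" by (auto dest: smul_c_eq_0)
  next
    assume "kos (ext_scalars (G ?m) v) = 0 \<and> kos (ext_scalars (H ?m) v) = 0"
    then have "ext_scalars (G (?m - 1)) (rdiff ?m v) = 0" "ext_scalars (H (?m - 1)) (rdiff ?m v) = 0"
      using c by simp_all
    then show "rdiff ?m v = 0"
      by (rule split_iso_inj[OF iso rdiff_free[OF _ v], rotated]) (use card_ge_2 in simp)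
  qed
qed

lemma syzygy_preimage:
  obtains z where "z \<in> FM (Suc (CARD('v)))"
    "ext_scalars (G (CARD('v))) (rdiff (Suc (CARD('v))) z) = smul p (top_syzygy n)"
    "ext_scalars (H (CARD('v))) (rdiff (Suc (CARD('v))) z) = 0"
proof -
  let ?m = "CARD('v)"
  have "smul p (top_syzygy n) \<in> K_ker (?m - 1) (n - 1)"
    using top_syzygy_K_ker by (metis smul_module.subspace_scale subspace_K_ker)
  then obtain v where v: "v \<in> free_mod (rank F ?m)"
    "ext_scalars (G ?m) v = smul p (top_syzygy n)" "ext_scalars (H ?m) v = 0"
    using split_iso_surj[OF iso_top _ zero_in_L_ker] by blast
  have "rdiff ?m v = 0" unfolding cycle_iff[OF v(1)] v(2,3) by (simp add: kos_smul kos_top_syzygy_n)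
  then obtain z where "z \<in> FM (Suc ?m)" "rdiff (Suc ?m) z = v"
    using rdiff_exact[OF card_ge_2 v(1)] by blast
  then show ?thesis using that v by metis
qed

text \<open>Boundaries are cycles, and \<open>K_kernel_top\<close> and \<open>L_kernel_top\<close>
  describe all cycles here. The unit \<open>const c\<close> is split off to match
  \<open>K_top\<close>.\<close>

lemma boundary_multiple:
  assumes z: "z \<in> FM (Suc (CARD('v)))"
  shows "\<exists>p. ext_scalars (G (CARD('v))) (rdiff (Suc (CARD('v))) z) = smul (const c * p) (top_syzygy n)"
    and "ext_scalars (H (CARD('v))) (rdiff (Suc (CARD('v))) z) = (0 :: ('v, 'k) bpol)"
proof -
  let ?m = "CARD('v)" and ?v = "rdiff (Suc (CARD('v))) z"
  have v: "?v \<in> free_mod (rank F ?m)" using rdiff_free[OF _ z] by simp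
  have "rdiff ?m ?v = 0" by (rule rdiff_rdiff[OF _ z]) (use card_ge_2 in simp)
  then have kos: "kos (ext_scalars (G ?m) ?v) = (0 :: ('v, 'k) bpol)"
    "kos (ext_scalars (H ?m) ?v) = (0 :: ('v, 'k) bpol)" using cycle_iff[OF v] by auto
  note mem = split_iso_mem[OF iso_top v]
  show "ext_scalars (H ?m) ?v = 0"
    by (rule L_kernel_top[OF card_ge_2 _ _ kos(2)]) (use mem(2) in \<open>auto simp: L_ker_def\<close>)
  obtain p where p: "ext_scalars (G ?m) ?v = smul p (top_syzygy (Suc (n - 1)))"
    using K_kernel_top[OF card_ge_2 _ _ kos(1)] mem(1) unfolding K_ker_def by blast
  have eq: "const c * (const (inverse c) * p) = p"
    unfolding mult.assoc[symmetric] const_c_inverse by simp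
  then show "\<exists>p. ext_scalars (G ?m) ?v = smul (const c * p) (top_syzygy n)"
  proof -
    have "Suc (n - 1) = n" using n_ge_2 by simp
    then show ?thesis by (intro exI[of _ "const (inverse c) * p"]) (simp only: p eq)
  qed
qed

text \<open>If degree d were not the last, its columns would be linear, and their lifts would vanish
  by injectivity of \<open>eta\<close> and \<open>kappa\<close> in top exterior degree. A zero
  column makes a basis vector a boundary, against minimality; so the module would be 0.\<close>

lemma rank_above: "r > Suc (CARD('v)) \<Longrightarrow> rank F r = 0"
proof -
  let ?m = "CARD('v)"
  assume r: "r > Suc ?m"
  obtain t where t: "t \<ge> 1" "shape t" using ex_shape by blast
  have "\<not> Suc ?m < t"
  proof
    assume "Suc ?m < t"
    then have lifts: "lifts_columns (Suc ?m) (G ?m) (H ?m)"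
      using split_isos_lifts[OF GH _ t(2)] card_ge_2 by simp
    have no_basis: False if j: "j < rank F (Suc ?m)" for j
    proof -
      obtain w1 w2 where w: "w1 \<in> K_ker ?m (n - 1)" "w2 \<in> L_ker ?m n"
        "ext_scalars (G ?m) (rcol (Suc ?m) j) = smul (const c) (kos (cst w1) :: ('v, 'k) bpol)"
        "ext_scalars (H ?m) (rcol (Suc ?m) j) = smul (const c) (kos (cst w2) :: ('v, 'k) bpol)"
        using lifts j unfolding lifts_columns_def by (metis diff_Suc_1)
      have "w1 = 0" by (rule top_degree_eta_inj[of _ "n - 2"])
          (use w(1) n_ge_2 in \<open>auto simp: K_ker_def Suc_diff_Suc numeral_2_eq_2\<close>)
      moreover have "w2 = 0" by (rule top_degree_kappa_inj[of _ n]) (use w(2) in \<open>auto simp: L_ker_def\<close>)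
      ultimately have "rcol (Suc ?m) j = 0"
        using w by (intro split_iso_inj[OF iso_top]) (use rcol_free[OF _ j] in \<open>auto simp: rhom.map_0_eq[OF
            rhom_const]\<close>)
      then have "rdiff (Suc ?m) (single j 1) = 0" by (simp add: rdiff_def)
      then obtain z where z: "z \<in> FM (Suc (Suc ?m))" "rdiff (Suc (Suc ?m)) z = single j 1"
        using rdiff_exact[of "Suc ?m", OF _ free_mod_single[OF j]] card_ge_2 by auto
      have "cst (single j 1) = rdiff (Suc (Suc ?m)) z"
        by (simp add: z(2) rhom.one[OF rhom_const] rhom.zero[OF rhom_const])
      from cst_eq_rdiff[OF this _ z(1)] show False by (metis One_nat_def Suc_le_mono le0 lookup_single_eq
          lookup_zero zero_neq_one)
    qed
    \<comment> \<open>A zero module contradicts that the cycle \<open>top_syzygy\<close> is a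
      boundary.\<close>
    obtain z where z: "z \<in> FM (Suc ?m)"
      "ext_scalars (G ?m) (rdiff (Suc ?m) z) = smul 1 (top_syzygy n :: ('v, 'k) bpol)"
      using syzygy_preimage by metis
    have "rank F (Suc ?m) = 0" using no_basis by auto
    then have "z = 0" using z(1) by (simp add: free_mod_zero_rank)
    then have "smul 1 (top_syzygy (Suc (n - 1)) :: ('v, 'k) bpol) = 0" using z(2) n_ge_2 by simp
    then show False using smul_top_syzygy_eq_0 by fastforce
  qed
  then show ?thesis using t(2) r by (simp add: shape_def)
qed

text \<open>The coordinate of the boundary of \<open>z\<close> with respect to \<open>c\<close>
  times \<open>top_syzygy\<close>. It is unique because \<open>top_syzygy\<close> is torsion-free,
  and so it is linear in \<open>z\<close>.\<close>

definition top_map :: "(nat \<Rightarrow>\<^sub>0 ('v, 'k) mpol) \<Rightarrow> ('v, 'k) mpol" where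
  "top_map z = (SOME p. ext_scalars (G (CARD('v))) (rdiff (Suc (CARD('v))) z) = smul (const c * p)
      (top_syzygy n))"

lemma top_map:
  "z \<in> FM (Suc (CARD('v))) \<Longrightarrow>
    ext_scalars (G (CARD('v))) (rdiff (Suc (CARD('v))) z) = smul (const c * top_map z) (top_syzygy n)"
  unfolding top_map_def by (rule someI_ex[OF boundary_multiple(1)])

lemma const_c_cancel: "const c * p = const c * q \<Longrightarrow> p = (q :: ('v, 'k) mpol)"
  using c_nonzero by (intro poly_mapping_eqI) (metis lookup_const_mult mult_left_cancel)

lemma smul_top_syzygy_inject:
  assumes "smul p (top_syzygy n) = smul q (top_syzygy n :: ('v, 'k) bpol)"
  shows "p = q"
proof -
  have "smul (p - q) (top_syzygy (Suc (n - 1)) :: ('v, 'k) bpol) = 0"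
    using assms n_ge_2 by (simp add: smul_module.scale_left_diff_distrib)
  then show ?thesis using smul_top_syzygy_eq_0 by fastforce
qed

lemma top_map_unique:
  assumes "z \<in> FM (Suc (CARD('v)))"
    "ext_scalars (G (CARD('v))) (rdiff (Suc (CARD('v))) z) = smul (const c * p) (top_syzygy n)"
  shows "top_map z = p"
  by (rule const_c_cancel, rule smul_top_syzygy_inject) (use assms top_map[OF assms(1)] in simp)

lemma top_map_add:
  "u \<in> FM (Suc (CARD('v))) \<Longrightarrow> v \<in> FM (Suc (CARD('v))) \<Longrightarrow>
    top_map (u + v) = top_map u + top_map v"
  by (rule top_map_unique)
    (auto simp: free_mod_add rdiff_add ext_scalars_add top_map smul_add_left distrib_left)

lemma top_map_smul:
  "u \<in> FM (Suc (CARD('v))) \<Longrightarrow> top_map (smul a u) = a * top_map u"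
  by (rule top_map_unique)
    (auto simp: free_mod_smul rdiff_smul ext_scalars_smul top_map smul_smul ac_simps)

lemma top_map_inj:
  assumes "u \<in> FM (Suc (CARD('v)))" "top_map u = 0"
  shows "u = 0"
proof -
  have "rdiff (Suc (CARD('v))) u = 0"
    by (rule split_iso_inj[OF iso_top])
      (use rdiff_free[OF _ assms(1)] top_map[OF assms(1)] boundary_multiple(2)[OF assms(1)] assms(2) in auto)
  then obtain z where "z \<in> FM (Suc (Suc (CARD('v))))" "rdiff (Suc (Suc (CARD('v)))) z = u"
    using rdiff_exact[OF _ assms(1)] card_ge_2 by auto
  then show ?thesis using rank_above[of "Suc (Suc (CARD('v)))"] by (auto simp: free_mod_zero_rank)
qed

lemma top_map_bij: "bij_betw top_map (FM (Suc (CARD('v)))) UNIV"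
proof (rule bij_betw_imageI)
  show "inj_on top_map (FM (Suc (CARD('v))))"
  proof (rule inj_onI)
    fix u v assume uv: "u \<in> FM (Suc (CARD('v)))" "v \<in> FM (Suc (CARD('v)))" "top_map u = top_map v"
    have "top_map (u - v + v) = top_map (u - v) + top_map v"
      by (rule top_map_add[OF free_mod_diff[OF uv(1,2)] uv(2)])
    then have "top_map (u - v) = 0" using uv(3) by simp
    then have "u - v = 0" by (rule top_map_inj[OF free_mod_diff[OF uv(1,2)]])
    then show "u = v" by simp
  qed
  have "p \<in> top_map ` FM (Suc (CARD('v)))" for p
  proof -
    obtain z where z: "z \<in> FM (Suc (CARD('v)))"
      "ext_scalars (G (CARD('v))) (rdiff (Suc (CARD('v))) z) = smul (const c * p) (top_syzygy n)"
      using syzygy_preimage by metis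
    then show ?thesis using top_map_unique by blast
  qed
  then show "top_map ` FM (Suc (CARD('v))) = UNIV" by blast
qed

section \<open>Assembling the isomorphism\<close>

definition skel_map :: "nat \<Rightarrow> (nat \<Rightarrow>\<^sub>0 ('v, 'k) mpol) \<Rightarrow> (('v, 'k) bpol) \<times> (('v, 'k) bpol)" where
  "skel_map r v = (if r = 0 then (0, single ({}, 0) (lookup v 0))
     else if r \<le> CARD('v) then (ext_scalars (G r) v, ext_scalars (H r) v)
     else if r = Suc (CARD('v)) then (single (UNIV, 0) (top_map v), 0)
     else 0)"

lemma skeleton_Mod:
  "Mod (skeleton n c :: ((('v, 'k) bpol) \<times> (('v, 'k) bpol)) module_complex) r =
    (if r = 0 then {0} \<times> bideg 0 0
     else if r \<le> CARD('v) then K_ker (r - 1) (n - 1) \<times> L_ker (r - 1) n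
     else if r = Suc (CARD('v)) then bideg (CARD('v)) 0 \<times> {0}
     else {0} \<times> {0})"
  by (auto simp add: skeleton_def cone_of_zero_def KK_def LL_def base_change_bideg Lmod_ker
      Kmod_ker simp del: One_nat_def)

lemma skel_map_add:
  assumes "u \<in> FM r" "v \<in> FM r"
  shows "skel_map r (u + v) = skel_map r u + skel_map r v"
  using assms by (auto simp: skel_map_def lookup_add single_add ext_scalars_add top_map_add)

lemma skel_map_smul:
  assumes "u \<in> FM r"
  shows "skel_map r (smul a u) = (\<lambda>(x, y). (smul a x, smul a y)) (skel_map r u)"
  using assms by (auto simp: skel_map_def ext_scalars_smul top_map_smul zero_prod_def)

lemma skel_map_bij:
  "bij_betw (skel_map r) (FM r)
    (Mod (skeleton n c :: ((('v, 'k) bpol) \<times> (('v, 'k) bpol)) module_complex) r)"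
proof -
  consider "r = 0" | "1 \<le> r" "r \<le> CARD('v)" | "r = Suc (CARD('v))" | "r > Suc (CARD('v))" by linarith
  then show ?thesis
  proof cases
    case 1
    let ?f = "\<lambda>v :: nat \<Rightarrow>\<^sub>0 ('v, 'k) mpol.
      (0 :: ('v, 'k) bpol, single ({}, 0) (lookup v 0) :: ('v, 'k) bpol)"
    let ?g = "\<lambda>(_ :: ('v, 'k) bpol, u :: ('v, 'k) bpol).
      single (0 :: nat) (lookup u ({}, 0))"
    have "bij_betw ?f (free_mod 1) ({0} \<times> bideg 0 0)"
    proof (rule bij_betwI[where g = ?g])
      show "?f \<in> free_mod 1 \<rightarrow> {0} \<times> bideg 0 0" by (auto simp: bideg_0_0_iff)
      show "?g \<in> {0} \<times> bideg 0 0 \<rightarrow> free_mod 1" by (auto simp: free_mod_single)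
      show "?g (?f v) = v" if "v \<in> free_mod 1" for v
        by (rule free_mod_1_eqI) (use that in \<open>auto simp: free_mod_single\<close>)
    qed (auto simp: bideg_0_0_iff)
    then show ?thesis using 1 by (simp add: skeleton_Mod skel_map_def[abs_def] rank_0 del: One_nat_def)
  next
    case 2
    then have iso: "split_iso r (G r) (H r)" using GH by (simp add: split_isos_def)
    have "bij_betw (\<lambda>v. (ext_scalars (G r) v, ext_scalars (H r) v)) (FM r)
       ((K_ker (r - 1) (n - 1) :: (('v, 'k) bpol) set) \<times> L_ker (r - 1) n)"
    proof (rule bij_betw_imageI)
      show "inj_on (\<lambda>v. (ext_scalars (G r) v, ext_scalars (H r) v :: ('v, 'k) bpol)) (FM r)"
      proof (rule inj_onI)
        fix u v :: "nat \<Rightarrow>\<^sub>0 ('v, 'k) mpol"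
        assume uv: "u \<in> FM r" "v \<in> FM r"
          "(ext_scalars (G r) u, ext_scalars (H r) u) = (ext_scalars (G r) v, ext_scalars (H r) v)"
        have "ext_scalars (G r) (u - v) = 0" "ext_scalars (H r) (u - v) = 0"
          using uv(3) by (simp_all add: ext_scalars_def lin_ext_minus)
        then have "u - v = 0" using split_iso_inj[OF iso free_mod_diff[OF uv(1,2)]] by blast
        then show "u = v" by simp
      qed
      show "(\<lambda>v. (ext_scalars (G r) v, ext_scalars (H r) v)) ` FM r
        = (K_ker (r - 1) (n - 1) :: (('v, 'k) bpol) set) \<times> L_ker (r - 1) n"
        using split_iso_mem[OF iso] split_iso_surj[OF iso] by (force simp: image_iff)
    qed
    then show ?thesis using 2 by (simp add: skeleton_Mod skel_map_def[abs_def])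
  next
    case 3
    have "bij_betw (\<lambda>p. (single (UNIV, 0) p, 0)) UNIV
      ((bideg (CARD('v)) 0 :: (('v, 'k) bpol) set) \<times> {0 :: ('v, 'k) bpol})"
      by (rule bij_betw_imageI) (auto simp: inj_on_def bideg_top_iff dest: arg_cong[where f = "\<lambda>u. lookup u
          (UNIV, 0)"])
    from bij_betw_trans[OF top_map_bij this] show ?thesis
      using 3 by (simp add: skeleton_Mod skel_map_def[abs_def] o_def)
  next
    case 4
    then have "rank F r = 0" by (rule rank_above)
    then have "FM r = {0 :: nat \<Rightarrow>\<^sub>0 ('v, 'k) mpol}" by (auto simp: free_mod_zero_rank)
    then show ?thesis using 4 by (simp add: skeleton_Mod skel_map_def[abs_def] bij_betw_def zero_prod_def)
  qed
qed

lemma skel_map_diff: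
  assumes r: "r \<ge> 1" and u: "u \<in> FM r"
  shows "skel_map (r - 1) (rdiff r u) = Diff (skeleton n c) r (skel_map r u)"
proof -
  consider "r = 1" | "2 \<le> r" "r \<le> CARD('v)" | "r = Suc (CARD('v))" | "r > Suc (CARD('v))" using r by linarith
  then show ?thesis
  proof cases
    case 1
    have u1: "u \<in> FM 1" using u 1 by simp
    have "lookup (rdiff 1 u) 0 = (\<Sum>j\<in>keys u. lookup u j * mod_x1 (gen j))"
      by (simp add: rdiff_def lookup_lin_ext lookup_rcol gen_def)
    then have "single ({}, 0) (lookup (rdiff 1 u) 0) = L_bot c (ext_scalars (H 1) u)"
      using L_bot_ext_scalars_h1[OF u1] GH by (simp add: split_isos_def)
    then show ?thesis using 1 card_ge_2
      by (simp add: skel_map_def skeleton_def cone_of_zero_def LL_def)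
  next
    case 2
    then have chain: "chain_maps r (G (r - 1)) (H (r - 1)) (G r) (H r)" using GH by (simp add: split_isos_def)
    have "r - 1 \<noteq> 0" "r - 1 < CARD('v)" using 2 by auto
    then show ?thesis using 2 chain[unfolded chain_maps_def, THEN bspec, OF u]
      by (simp add: skel_map_def skeleton_def cone_of_zero_def LL_def KK_def del: One_nat_def)
  next
    case 3
    have u1: "u \<in> FM (Suc (CARD('v)))" using u 3 by simp
    have "skel_map (r - 1) (rdiff r u) = (smul (const c * top_map u) (top_syzygy n), 0)"
      using 3 card_ge_2 top_map[OF u1] boundary_multiple(2)[OF u1] by (simp add: skel_map_def)
    also have "\<dots> = Diff (skeleton n c) r (skel_map r u)"
      using 3 card_ge_2 by (simp add: skel_map_def skeleton_def cone_of_zero_def LL_def KK_def K_top_single)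
    finally show ?thesis .
  next
    case 4
    then have "u = 0" using u rank_above by (simp add: free_mod_zero_rank)
    have "skel_map (r - 1) 0 = 0"
    proof (cases "r - 1 = Suc (CARD('v))")
      case True
      have "top_map 0 = 0" using top_map_smul[of 0 0] by simp
      then show ?thesis using True by (simp add: skel_map_def zero_prod_def)
    qed (use 4 in \<open>auto simp: skel_map_def\<close>)
    moreover have "Diff (skeleton n c) r (skel_map r 0) = (0 :: (('v, 'k) bpol) \<times> (('v, 'k) bpol))"
      using 4 card_ge_2 by (simp add: skel_map_def skeleton_def cone_of_zero_def LL_def KK_def K_top_def
          zero_prod_def)
    ultimately show ?thesis using \<open>u = 0\<close> by simp
  qed
qed

lemma tensor_isomorphic_of_split_isos:
  "complex_isomorphic smul (\<lambda>s (u, v). (smul s u, smul s v)) (tensor_Sbar F) (skeleton n c)"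
proof -
  have Mod: "Mod (tensor_Sbar F) r = FM r" and Diff: "Diff (tensor_Sbar F) r = rdiff r" for r
    by (simp_all add: tensor_Sbar_def rdiff_def rcol_def[abs_def])
  show ?thesis
    unfolding complex_isomorphic_def Mod Diff
    by (rule exI[of _ skel_map])
      (use skel_map_bij skel_map_add skel_map_smul skel_map_diff in blast)
qed

end

lemma tensor_isomorphic:
  "complex_isomorphic smul (\<lambda>s (u, v). (smul s u, smul s v)) (tensor_Sbar F) (skeleton n c)"
  using ex_split_isos[of "CARD('v)"] card_ge_2 tensor_isomorphic_of_split_isos by auto

end

lemma prod_power_single:
  fixes x :: "'w::finite \<Rightarrow> 'c::comm_ring_1"
  shows "(\<Prod>i\<in>UNIV. x i ^ lookup (single j (1::nat)) i) = x j"
proof -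
  have "(\<Prod>i\<in>UNIV. x i ^ lookup (single j (1::nat)) i) = (\<Prod>i\<in>UNIV. if i = j then x i else 1)"
    by (intro prod.cong refl) (simp add: lookup_single when_def)
  then show ?thesis by simp
qed

subsection \<open>The resolution of a Gorenstein algebra\<close>

context artinian_gorenstein_algebra begin

lemma presentation_const: "presentation scale x (const a) = scale a 1"
  by (cases "a = 0") (simp_all add: presentation_def const_def)

lemma presentation_linear:
  fixes p :: "('w::finite, 'k) mpol" and x :: "'w \<Rightarrow> 'a"
  assumes "homog 1 p"
  shows "presentation scale x p = (\<Sum>i\<in>UNIV. scale (lookup p (single i 1)) (x i))"
proof -
  have "keys p \<subseteq> range (\<lambda>i. single i 1)"
  proof
    fix \<alpha> assume "\<alpha> \<in> keys p"
    then have "mdeg \<alpha> = 1" using assms by (simp add: homog_def)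
    then show "\<alpha> \<in> range (\<lambda>i. single i 1)" using mdeg_eq_1_D by blast
  qed
  then have "presentation scale x p =
      (\<Sum>\<alpha>\<in>range (\<lambda>i. single i 1). scale (lookup p \<alpha>) (\<Prod>i\<in>UNIV. x i ^ lookup \<alpha> i))"
    unfolding presentation_def by (intro sum.mono_neutral_left) (auto simp: in_keys_iff)
  also have "\<dots> = (\<Sum>i\<in>UNIV. scale (lookup p (single i 1)) (x i))"
  proof (subst sum.reindex)
    show "inj (\<lambda>i::'w. single i (1::nat))"
      by (rule injI) (metis lookup_single_eq lookup_single_not_eq zero_neq_one)
  qed (simp add: prod_power_single del: One_nat_def)
  finally show ?thesis .
qed

text \<open>A constant in the ideal would kill 1, and a linear form would be a relation between the
  basis elements \<open>x\<close>.\<close>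

lemma ideal_degree_ge_2:
  fixes x :: "'w::finite \<Rightarrow> 'a"
  assumes x: "inj x" "independent (range x)" and p: "presentation scale x p = 0" "homog (int n) p" "p \<noteq> 0"
  shows "n \<ge> 2"
proof (rule ccontr)
  assume "\<not> n \<ge> 2"
  then consider "n = 0" | "n = 1" by linarith
  then have "p = 0"
  proof cases
    case 1
    then have "lookup p \<alpha> = 0" if "\<alpha> \<noteq> 0" for \<alpha> using p(2) that by (auto simp: homog_iff mdeg_eq_0_iff)
    then have "p = const (lookup p 0)" by (intro poly_mapping_eqI) simp
    then show ?thesis using p(1) presentation_const[of x "lookup p 0"] by (auto simp: const_def)
  next
    case 2
    let ?u = "\<lambda>a. lookup p (single (inv_into UNIV x a) 1)"
    have "(\<Sum>a\<in>range x. scale (?u a) a) = (\<Sum>i\<in>UNIV. scale (lookup p (single i 1)) (x i))"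
      by (subst sum.reindex[OF x(1)]) (simp add: inv_f_f[OF x(1)])
    also have "\<dots> = 0" using presentation_linear[of p x] p(1,2) 2 by simp
    finally have "?u (x i) = 0" for i using independentD[OF x(2), of "range x" ?u "x i"] by simp
    then have lin: "lookup p (single i 1) = 0" for i by (simp add: inv_f_f[OF x(1)] del: One_nat_def)
    show ?thesis
    proof (rule poly_mapping_eqI)
      fix \<alpha> show "lookup p \<alpha> = lookup 0 \<alpha>"
        using lin mdeg_eq_1_D[of \<alpha>] p(2) 2 by (cases "mdeg \<alpha> = 1") (auto simp: homog_iff)
    qed
  qed
  with p(3) show False ..
qed

text \<open>Twist 0 sends each basis vector of F_0 to a multiple of 1. By minimality the kernel of
  the augmentation has no constant terms, so these multiples are non-zero and two of them cannot
  coexist. The augmentation is thus the presentation up to a unit.\<close>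

lemma augmentation_generator:
  fixes x :: "'w::finite \<Rightarrow> 'a"
  assumes F: "homogeneous_resolution gr (presentation scale x) F" "minimal_complex F" "gorenstein_linear F"
  shows "rank F 0 = 1" and "twists F 0 ! 0 = 0"
    and "{v \<in> free_mod 1. presentation scale x (lookup v 0) = 0} = fdiff F 1 ` free_mod (rank F 1)"
proof -
  let ?\<rho> = "presentation scale x"
  obtain s where tw: "twists F 0 = replicate s 0" using F(3) unfolding gorenstein_linear_def by blast
  obtain e where e: "\<And>j. j < rank F 0 \<Longrightarrow> e j \<in> (if twists F 0 ! j \<ge> 0 then gr (nat (twists F 0 ! j)) else {0})"
    and surj: "augmentation ?\<rho> e ` free_mod (rank F 0) = UNIV"
    and ker: "{v \<in> free_mod (rank F 0). augmentation ?\<rho> e v = 0} = fdiff F 1 ` free_mod (rank F 1)"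
    using F(1) unfolding homogeneous_resolution_def by blast
  have const_term: "lookup (lookup v i) 0 = 0" if "v \<in> free_mod (rank F 0)" "augmentation ?\<rho> e v = 0" for v i
  proof -
    have "v \<in> fdiff F 1 ` free_mod (rank F 1)" using that ker by blast
    then show ?thesis using minimal_const_term[OF F(2)] by auto
  qed
  have "e j \<in> span {1}" if "j < rank F 0" for j
    using e[OF that] that tw gr_0 by (simp add: rank_def)
  then have "\<exists>a. e j = scale a 1" if "j < rank F 0" for j using that by (simp add: span_singleton image_iff)
  then obtain \<epsilon> where \<epsilon>: "\<And>j. j < rank F 0 \<Longrightarrow> e j = scale (\<epsilon> j) 1" by metis
  have aug_single: "augmentation ?\<rho> e (single j p) = ?\<rho> p * e j" for j p
    by (cases "p = 0") (simp_all add: augmentation_def presentation_def)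
  have mult_one: "scale a 1 * scale b 1 = scale (a * b) 1" for a b
    by (metis mult.commute mult_1 scale_mult scale_scale)
  have one: "?\<rho> 1 = 1"
    using presentation_const[of x 1] by (simp add: rhom.one[OF rhom_const])
  have \<epsilon>_nz: "\<epsilon> j \<noteq> 0" if "j < rank F 0" for j
  proof
    assume "\<epsilon> j = 0"
    then have "augmentation ?\<rho> e (single j 1) = 0" using \<epsilon>[OF that] by (simp add: aug_single)
    from const_term[OF free_mod_single[OF that] this, of j] show False by simp
  qed
  have "\<not> rank F 0 \<ge> 2"
  proof
    assume r: "rank F 0 \<ge> 2"
    \<comment> \<open>The obvious relation between two multiples of 1; its entries are non-zero
      constants.\<close>
    define v :: "nat \<Rightarrow>\<^sub>0 ('w, 'k) mpol" where
      "v = single 0 (const (\<epsilon> 1)) + single 1 (const (- \<epsilon> 0))"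
    have v: "v \<in> free_mod (rank F 0)" unfolding v_def using r by (intro free_mod_add free_mod_single) auto
    have lv: "lookup v 0 = const (\<epsilon> 1)" "lookup v 1 = const (- \<epsilon> 0)"
      by (simp_all add: v_def lookup_add lookup_single)
    have nz: "const (\<epsilon> 1) \<noteq> (0 :: ('w, 'k) mpol)" "const (- \<epsilon> 0) \<noteq> (0 :: ('w, 'k) mpol)"
      using \<epsilon>_nz[of 0] \<epsilon>_nz[of 1] r by (auto dest!: arg_cong[where f = "\<lambda>p. lookup p 0"])
    have "keys v = {0, 1}" using nz lv by (auto simp: v_def in_keys_iff lookup_add lookup_single when_def
        split: if_splits)
    then have "augmentation ?\<rho> e v = ?\<rho> (const (\<epsilon> 1)) * e 0 + ?\<rho> (const (- \<epsilon> 0)) * e 1"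
      using lv by (simp add: augmentation_def)
    also have "\<dots> = scale (\<epsilon> 1 * \<epsilon> 0) 1 + scale (- \<epsilon> 0 * \<epsilon> 1) 1"
      using \<epsilon>[of 0] \<epsilon>[of 1] r by (simp add: presentation_const mult_one)
    also have "\<dots> = 0" by (simp flip: scale_left_distrib)
    finally have "lookup (lookup v 0) 0 = 0" using const_term[OF v] by blast
    then show False using lv \<epsilon>_nz[of 1] r by simp
  qed
  moreover have "rank F 0 \<noteq> 0"
  proof
    assume "rank F 0 = 0"
    then have "free_mod (rank F 0) = {0 :: nat \<Rightarrow>\<^sub>0 ('w, 'k) mpol}" by (auto simp: free_mod_zero_rank)
    then have "(UNIV :: 'a set) = {0}" using surj by (simp add: augmentation_def)
    from UNIV_I[of "1 :: 'a", unfolded this] show False by simp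
  qed
  ultimately show rank: "rank F 0 = 1" by linarith
  then show "twists F 0 ! 0 = 0" using tw by (simp add: rank_def)
  have "augmentation ?\<rho> e v = scale (\<epsilon> 0) (?\<rho> (lookup v 0))" if "v \<in> free_mod 1" for v
  proof -
    have "v = single 0 (lookup v 0)"
      using that unfolding free_mod_iff
      by (intro poly_mapping_eqI[of v]) (metis less_one lookup_single_eq lookup_single_not_eq)
    then have "augmentation ?\<rho> e v = ?\<rho> (lookup v 0) * e 0" using aug_single[of 0 "lookup v 0"] by simp
    then show ?thesis using \<epsilon>[of 0] rank by (metis less_one mult.commute mult_1 scale_mult)
  qed
  then have "{v \<in> free_mod 1. ?\<rho> (lookup v 0) = 0} = {v \<in> free_mod (rank F 0). augmentation ?\<rho> e v = 0}"
    using \<epsilon>_nz[of 0] rank by auto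
  then show "{v \<in> free_mod 1. ?\<rho> (lookup v 0) = 0} = fdiff F 1 ` free_mod (rank F 1)" using ker by simp
qed

end

theorem proposition7p6:
  fixes scale :: "'k::field \<Rightarrow> 'a::comm_ring_1 \<Rightarrow> 'a"
    and gr :: "nat \<Rightarrow> 'a set"
    and x :: "'v::{finite,linorder} option \<Rightarrow> 'a"
    and n :: nat
    and \<phi> :: "'v option mon \<Rightarrow>\<^sub>0 'k"
    and I :: "('v option, 'k) mpol set"
    and F :: "('v option, 'k) mpol free_complex"
  assumes A: "artinian_gorenstein_algebra scale gr"
    and x_basis: "inj x" "\<not> module.dependent scale (range x)" "module.span scale (range x) = gr 1"
    and d: "CARD('v option) \<ge> 3"
    and I_def: "I = {p. presentation scale x p = 0}"
    and n: "\<exists>p\<in>I. homog (int n) p \<and> p \<noteq> 0"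
    and n_least: "\<And>m p. m < n \<Longrightarrow> p \<in> I \<Longrightarrow> homog (int m) p \<Longrightarrow> p = 0"
    and F: "homogeneous_resolution gr (presentation scale x) F" "minimal_complex F"
    and F_linear: "gorenstein_linear F"
    and x1_surj: "(\<lambda>a. x None * a) ` gr (n - 1) = gr n"
    and phi: "homog (int (2 * n - 2)) \<phi>" "I = {p. contract p \<phi> = 0}"
  shows "complex_isomorphic smul (\<lambda>s (u, v). (smul s u, smul s v))
    (tensor_Sbar F) (skeleton n (macaulay_const n \<phi>))"
proof -
  interpret alg: artinian_gorenstein_algebra scale gr by (rule A)
  have n2: "n \<ge> 2" using n alg.ideal_degree_ge_2[OF x_basis(1,2)] by (auto simp: I_def)
  interpret inverse_system n \<phi>
  proof
    \<comment> \<open>Non-degeneracy is the minimality of n, applied in degree n - 1.\<close>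
    fix p :: "('v option, 'k) mpol" assume "homog (int (n - 1)) p" "contract p \<phi> = 0"
    then show "p = 0" using n_least[of "n - 1" p] n2 phi(2) by simp
  qed (use n2 phi(1) in auto)
  have ann: "ann = I" by (simp add: ann_def phi(2))
  note gen = alg.augmentation_generator[OF F F_linear]
  interpret gorenstein_resolution n \<phi> F
  proof
    show "CARD('v) \<ge> 2" using d by (simp add: card_UNIV_option)
    show "p = 0" if "m < n" "p \<in> ann" "homog (int m) p" for m p using n_least that by (simp add: ann)
    show "\<exists>p\<in>ann. homog (int n) p \<and> p \<noteq> 0" using n by (simp add: ann)
    show "{v \<in> free_mod 1. lookup v 0 \<in> ann} = fdiff F 1 ` free_mod (rank F 1)" using gen(3) by (simp add: ann I_def)
    show "{v \<in> free_mod (rank F r). fdiff F r v = 0} = fdiff F (Suc r) ` free_mod (rank F (Suc r))" if "1 \<le> r" for r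
      using F(1) that by (simp add: homogeneous_resolution_def)
    show "homogeneous_complex F" using F(1) by (simp add: homogeneous_resolution_def)
  qed (use gen F(2) F_linear in auto)
  show ?thesis by (rule tensor_isomorphic)
qed

end
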